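(* Let $E=\mathrm{FBL}[\ell_1]$, $E_0 = E \hat{\otimes}_{|\pi|} E$, $\mathscr{X}=\mathrm{Ideal}(E)$ and $\mathscr{Y}=\mathrm{Ideal}(E_0)$. The map \[ \Xi \colon \mathscr{X} \times \mathscr{X} \ni (J_1, J_2) \longmapsto J_1 \hat{\otimes}_{|\pi|} J_2 \in \mathscr{Y} \] is $\boldsymbol{\Sigma}^0_2$-measurable when $\mathscr{X}$ and $\mathscr{Y}$ carry the (subspace) Wijsman topologies. In particular, $\Xi$ is Borel measurable. Moreover, the graph $\{(J_1,J_2,K)\colon K=\Xi(J_1,J_2)\}$ of $\Xi$ is a $G_\delta$ subset of $\mathscr{X} \times \mathscr{X} \times \mathscr{Y}$.
   Context: All Banach spaces are real. Free Banach lattice. For a Banach space $X$ with dual $X'$, let $H[X]$ be the vector lattice (pointwise order) of positively homogeneous functions $f\colon X'\to\mathbb R$, and put $\lVert f\rVert_{\mathrm{FBL}[X]}=\sup\{\sum_{i=1}^m\lvert f(x_i^* )\rvert\colon m\in\mathbb N,\ x_1^*,\dots,x_m^*\in X',\ \sup_{\lVert x\rVert\le1}\sum_{i=1}^m\lvert x_i^*(x)\rvert\le1\}$. Let $H_1[X]=\{f\in H[X]\colon\lVert f\rVert_{\mathrm{FBL}[X]}<\infty\}$ and $\delta_X(x)(x^* )=x^*(x)$. Then $\mathrm{FBL}[X]$ is the closure in $H_1[X]$ of the sublattice generated by $\delta_X(X)$; it is a Banach lattice. We write $\mathrm{FBL}[\ell_1]$ for $\mathrm{FBL}[\ell_1(\omega;\mathbb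 R)]$, which is separable. Fremlin tensor product. For Banach lattices $E,F$, the algebraic tensor product $E\otimes F$ is regarded as canonically embedded in the Fremlin vector lattice tensor product of $E$ and $F$ (the Archimedean vector lattice that is universal for lattice bimorphisms from $E\times F$ into Archimedean vector lattices), and order and modulus are understood there. The positive projective norm of $u\in E\otimes F$ is $\lVert u\rVert_{|\pi|}=\inf\{\sum_{j=1}^n\lVert x_j\rVert_E\lVert y_j\rVert_F\colon n\in\mathbb N,\ x_j\in E^+,\ y_j\in F^+,\ \lvert u\rvert\preceq\sum_{j=1}^n x_j\otimes y_j\}$, where $E^+,F^+$ are the positive cones. The completion of $(E\otimes F,\lVert\cdot\rVert_{|\pi|})$ is the Banach lattice $E\hat\otimes_{|\pi|}F$. If $I\subseteq E$ and $J\subseteq F$ are closed ideals, then (a known fact) $I\hat\otimes_{|\pi|}J$ identifies canonically with a closed ideal of $E\hat\otimes_{|\pi|}F$, namely the closed linear span of $\{x\otimes y\colon x\in I,\ y\in J\}$; this identification is used in the definition of $\Xi$. Coding spaces. A closed linear subspace $J$ of a Banach lattice $E$ is a closed (order) ideal if $\lvert x\rvert\preceq\lvert y\rvert$, $y\in J$, $x\in E$ imply $x\in J$. $\mathrm{Ideal}(E)$ is the set of closed order ideals of $E$, as a subset of the family $\mathcal F(E)$ of non-empty closed subsets of $E$. The Wijsman topology on $\mathcal F(E)$, for a compatible metric $d$ on $E$, is the coarsest topology making $F\mapsto d(\alpha_n,F)$ continuous for all $n$, where $(\alpha_n)_{n\in\omega}$ is a dense sequence in $E$ (it does not depend on the choice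 of dense sequence). A map is $\boldsymbol{\Sigma}^0_2$-measurable if the preimage of every open set is $\boldsymbol{\Sigma}^0_2$, i.e. $F_\sigma$. *)

theory Defs
  imports "HOL-Analysis.Analysis" "HOL-Library.Lattice_Algebras"
begin

section \<open>Banach lattices and their closed ideals\<close>

class banach_lattice = banach + ordered_real_vector + lattice_ab_group_add_abs +
  assumes norm_mono_abs: "\<bar>x\<bar> \<le> \<bar>y\<bar> \<Longrightarrow> norm x \<le> norm y"

definition closed_ideals :: "'a::banach_lattice set set" where
  "closed_ideals = {J. closed J \<and> subspace J \<and> (\<forall>x. \<forall>y\<in>J. \<bar>x\<bar> \<le> \<bar>y\<bar> \<longrightarrow> x \<in> J)}"


section \<open>The Banach space of absolutely summable real sequences\<close>

typedef ell1 = "{f :: nat \<Rightarrow> real. summable (\<lambda>n. \<bar>f n\<bar>)}"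
  morphisms ell1_nth Abs_ell1
  by (rule exI[of _ "\<lambda>_. 0"]) simp

setup_lifting type_definition_ell1

lemma ell1_summable: "summable (\<lambda>n. \<bar>ell1_nth x n\<bar>)"
  using ell1_nth[of x] by simp

lemma summable_abs_add:
  fixes f g :: "nat \<Rightarrow> real"
  assumes "summable (\<lambda>n. \<bar>f n\<bar>)" "summable (\<lambda>n. \<bar>g n\<bar>)"
  shows "summable (\<lambda>n. \<bar>f n + g n\<bar>)"
  by (rule summable_comparison_test'[OF summable_add[OF assms]]) (simp add: abs_triangle_ineq)

instantiation ell1 :: real_normed_vector
begin

lift_definition zero_ell1 :: ell1 is "\<lambda>_. 0" by simp

lift_definition plus_ell1 :: "ell1 \<Rightarrow> ell1 \<Rightarrow> ell1" is "\<lambda>f g n. f n + g n"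
  by (rule summable_abs_add)

lift_definition uminus_ell1 :: "ell1 \<Rightarrow> ell1" is "\<lambda>f n. - f n" by simp

lift_definition minus_ell1 :: "ell1 \<Rightarrow> ell1 \<Rightarrow> ell1" is "\<lambda>f g n. f n - g n"
proof -
  fix f g :: "nat \<Rightarrow> real"
  assume "summable (\<lambda>n. \<bar>f n\<bar>)" "summable (\<lambda>n. \<bar>g n\<bar>)"
  then show "summable (\<lambda>n. \<bar>f n - g n\<bar>)"
    using summable_abs_add[of f "\<lambda>n. - g n"] by simp
qed

lift_definition scaleR_ell1 :: "real \<Rightarrow> ell1 \<Rightarrow> ell1" is "\<lambda>c f n. c * f n"
  by (simp add: abs_mult summable_mult)

lift_definition norm_ell1 :: "ell1 \<Rightarrow> real" is "\<lambda>f. \<Sum>n. \<bar>f n\<bar>" .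

definition dist_ell1 :: "ell1 \<Rightarrow> ell1 \<Rightarrow> real" where "dist_ell1 x y = norm (x - y)"
definition sgn_ell1 :: "ell1 \<Rightarrow> ell1" where "sgn_ell1 x = inverse (norm x) *\<^sub>R x"
definition uniformity_ell1 :: "(ell1 \<times> ell1) filter" where
  "uniformity_ell1 = (INF e\<in>{0<..}. principal {(x, y). dist x y < e})"
definition open_ell1 :: "ell1 set \<Rightarrow> bool" where
  "open_ell1 U \<longleftrightarrow> (\<forall>x\<in>U. eventually (\<lambda>(x', y). x' = x \<longrightarrow> y \<in> U) uniformity)"

instance
proof
  fix x y z :: ell1 and a b :: real
  show "x + y + z = x + (y + z)" "x + y = y + x" "0 + x = x" "- x + x = 0" "x - y = x + - y"
    by (transfer; simp add: fun_eq_iff)+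
  show "a *\<^sub>R (x + y) = a *\<^sub>R x + a *\<^sub>R y" "(a + b) *\<^sub>R x = a *\<^sub>R x + b *\<^sub>R x"
    "a *\<^sub>R b *\<^sub>R x = (a * b) *\<^sub>R x" "1 *\<^sub>R x = x"
    by (transfer; simp add: algebra_simps)+
  show "norm x = 0 \<longleftrightarrow> x = 0"
    by transfer (simp add: suminf_eq_zero_iff fun_eq_iff)
  show "norm (a *\<^sub>R x) = \<bar>a\<bar> * norm x"
    by transfer (simp add: abs_mult suminf_mult)
  show "norm (x + y) \<le> norm x + norm y"
  proof transfer
    fix f g :: "nat \<Rightarrow> real"
    assume *: "summable (\<lambda>n. \<bar>f n\<bar>)" "summable (\<lambda>n. \<bar>g n\<bar>)"
    have "(\<Sum>n. \<bar>f n + g n\<bar>) \<le> (\<Sum>n. \<bar>f n\<bar> + \<bar>g n\<bar>)"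
      by (intro suminf_le summable_abs_add summable_add * abs_triangle_ineq)
    then show "(\<Sum>n. \<bar>f n + g n\<bar>) \<le> (\<Sum>n. \<bar>f n\<bar>) + (\<Sum>n. \<bar>g n\<bar>)"
      by (simp add: suminf_add *)
  qed
qed (simp_all add: dist_ell1_def sgn_ell1_def uniformity_ell1_def open_ell1_def)

end

lemma ell1_partial_sum_le_norm: "(\<Sum>k<N. \<bar>ell1_nth x k\<bar>) \<le> norm x"
  by (simp add: norm_ell1.rep_eq sum_le_suminf ell1_summable)

instance ell1 :: banach
proof
  fix X :: "nat \<Rightarrow> ell1" assume X: "Cauchy X"
  have nth_le: "\<bar>ell1_nth x k\<bar> \<le> norm x" for x k
    using ell1_partial_sum_le_norm[of x "Suc k"]
      sum_nonneg[of "{..<k}" "\<lambda>k. \<bar>ell1_nth x k\<bar>"] by (simp, linarith)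
  define F where "F k = lim (\<lambda>n. ell1_nth (X n) k)" for k
  have "Cauchy (\<lambda>n. ell1_nth (X n) k)" for k
  proof (rule CauchyI)
    fix e :: real assume "0 < e"
    then obtain M where M: "\<forall>m\<ge>M. \<forall>n\<ge>M. norm (X m - X n) < e" using CauchyD[OF X] by blast
    have "norm (ell1_nth (X m) k - ell1_nth (X n) k) < e" if "m \<ge> M" "n \<ge> M" for m n
      using nth_le[of "X m - X n" k] M that by (auto simp: minus_ell1.rep_eq intro: le_less_trans)
    then show "\<exists>M. \<forall>m\<ge>M. \<forall>n\<ge>M. norm (ell1_nth (X m) k - ell1_nth (X n) k) < e" by blast
  qed
  then have lim: "(\<lambda>n. ell1_nth (X n) k) \<longlonglongrightarrow> F k" for k
    by (simp add: F_def Cauchy_convergent convergent_LIMSEQ_iff[symmetric])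
  have bound: "(\<Sum>k<N. \<bar>ell1_nth (X n) k - F k\<bar>) \<le> e"
    if M: "\<forall>m\<ge>M. \<forall>n\<ge>M. norm (X m - X n) < e" and n: "n \<ge> M" for M e n N
  proof (rule LIMSEQ_le_const2)
    show "(\<lambda>m. \<Sum>k<N. \<bar>ell1_nth (X n) k - ell1_nth (X m) k\<bar>) \<longlonglongrightarrow> (\<Sum>k<N. \<bar>ell1_nth (X n) k - F k\<bar>)"
      by (intro tendsto_intros lim)
    have "(\<Sum>k<N. \<bar>ell1_nth (X n) k - ell1_nth (X m) k\<bar>) \<le> e" if "m \<ge> M" for m
    proof -
      have "(\<Sum>k<N. \<bar>ell1_nth (X n) k - ell1_nth (X m) k\<bar>) \<le> norm (X n - X m)"
        using ell1_partial_sum_le_norm[of "X n - X m" N] by (simp add: minus_ell1.rep_eq)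
      also have "\<dots> < e" using M n that by blast
      finally show ?thesis by simp
    qed
    then show "\<exists>M. \<forall>m\<ge>M. (\<Sum>k<N. \<bar>ell1_nth (X n) k - ell1_nth (X m) k\<bar>) \<le> e" by blast
  qed
  have summ: "summable (\<lambda>k. \<bar>ell1_nth (X n) k - F k\<bar>)"
    if "\<forall>m\<ge>M. \<forall>n\<ge>M. norm (X m - X n) < e" and "n \<ge> M" for M e n
    using bound[OF that] by (intro summableI_nonneg_bounded[of _ e]) auto
  obtain M1 where M1: "\<forall>m\<ge>M1. \<forall>n\<ge>M1. norm (X m - X n) < 1" using CauchyD[OF X, of 1] by auto
  have F: "summable (\<lambda>k. \<bar>F k\<bar>)"
    using summable_abs_add[OF ell1_summable[of "X M1"], of "\<lambda>k. F k - ell1_nth (X M1) k"]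
      summ[OF M1 order_refl] by (simp add: abs_minus_commute)
  have nF: "ell1_nth (Abs_ell1 F) = F" by (simp add: Abs_ell1_inverse F)
  have "X \<longlonglongrightarrow> Abs_ell1 F"
  proof (rule LIMSEQ_I)
    fix r :: real assume "0 < r"
    then obtain M where M: "\<forall>m\<ge>M. \<forall>n\<ge>M. norm (X m - X n) < r / 2"
      using CauchyD[OF X, of "r/2"] by auto
    have "norm (X n - Abs_ell1 F) < r" if "n \<ge> M" for n
    proof -
      have "norm (X n - Abs_ell1 F) = (\<Sum>k. \<bar>ell1_nth (X n) k - F k\<bar>)"
        by (simp add: norm_ell1.rep_eq minus_ell1.rep_eq nF)
      also have "\<dots> \<le> r / 2" by (intro suminf_le_const summ[OF M that] bound[OF M that])
      finally show ?thesis using \<open>0 < r\<close> by simp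
    qed
    then show "\<exists>M. \<forall>n\<ge>M. norm (X n - Abs_ell1 F) < r" by blast
  qed
  then show "convergent X" by (rule convergentI)
qed


section \<open>The free Banach lattice over a Banach space\<close>

definition pos_homogeneous :: "(('a::real_normed_vector \<Rightarrow>\<^sub>L real) \<Rightarrow> real) \<Rightarrow> bool" where
  "pos_homogeneous f \<longleftrightarrow> (\<forall>c\<ge>0. \<forall>p. f (c *\<^sub>R p) = c * f p)"

text \<open>Finite families of functionals \<open>x\<^sub>1\<^sup>*, \<dots>, x\<^sub>m\<^sup>*\<close> with
  \<open>sup {\<Sum>i. \<bar>x\<^sub>i\<^sup>* x\<bar> | \<parallel>x\<parallel> \<le> 1} \<le> 1\<close>, as lists.\<close>

definition weakly_summing :: "('a::real_normed_vector \<Rightarrow>\<^sub>L real) list set" where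
  "weakly_summing = {ps. \<forall>x. norm x \<le> 1 \<longrightarrow> (\<Sum>p\<leftarrow>ps. \<bar>blinfun_apply p x\<bar>) \<le> 1}"

definition fbl_sums :: "(('a::real_normed_vector \<Rightarrow>\<^sub>L real) \<Rightarrow> real) \<Rightarrow> real set" where
  "fbl_sums f = (\<lambda>ps. \<Sum>p\<leftarrow>ps. \<bar>f p\<bar>) ` weakly_summing"

text \<open>\<open>H1\<close> consists of the functions of finite norm; only there is the real supremum \<open>fbl_norm\<close>
  meaningful.\<close>

definition fbl_norm :: "(('a::real_normed_vector \<Rightarrow>\<^sub>L real) \<Rightarrow> real) \<Rightarrow> real" where
  "fbl_norm f = Sup (fbl_sums f)"

definition H1 :: "(('a::real_normed_vector \<Rightarrow>\<^sub>L real) \<Rightarrow> real) set" where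
  "H1 = {f. pos_homogeneous f \<and> bdd_above (fbl_sums f)}"

text \<open>The vector sublattice generated by the evaluations \<open>\<delta> x\<close>. It contains \<open>0 = \<delta> 0\<close>, and infima
  because \<open>inf f g = - sup (- f) (- g)\<close>.\<close>

inductive_set delta_lattice :: "(('a::real_normed_vector \<Rightarrow>\<^sub>L real) \<Rightarrow> real) set" where
  delta: "(\<lambda>p. blinfun_apply p x) \<in> delta_lattice"
| add: "f \<in> delta_lattice \<Longrightarrow> g \<in> delta_lattice \<Longrightarrow> (\<lambda>p. f p + g p) \<in> delta_lattice"
| scale: "f \<in> delta_lattice \<Longrightarrow> (\<lambda>p. c * f p) \<in> delta_lattice"
| sup: "f \<in> delta_lattice \<Longrightarrow> g \<in> delta_lattice \<Longrightarrow> (\<lambda>p. max (f p) (g p)) \<in> delta_lattice"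

definition FBL :: "(('a::real_normed_vector \<Rightarrow>\<^sub>L real) \<Rightarrow> real) set" where
  "FBL = {f \<in> H1. \<forall>e>0. \<exists>g\<in>delta_lattice. fbl_norm (\<lambda>p. f p - g p) < e}"

lemma fbl_sums_nonempty: "fbl_sums f \<noteq> {}"
  by (auto simp: fbl_sums_def weakly_summing_def intro!: exI[of _ "[]"])

lemma fbl_norm_ge:
  "f \<in> H1 \<Longrightarrow> ps \<in> weakly_summing \<Longrightarrow> (\<Sum>p\<leftarrow>ps. \<bar>f p\<bar>) \<le> fbl_norm f"
  unfolding fbl_norm_def by (rule cSup_upper) (auto simp: fbl_sums_def H1_def)

lemma fbl_norm_nonneg: "f \<in> H1 \<Longrightarrow> 0 \<le> fbl_norm f"
  using fbl_norm_ge[of f "[]"] by (simp add: weakly_summing_def)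

lemma H1_bound:
  assumes "pos_homogeneous f" "\<And>ps. ps \<in> weakly_summing \<Longrightarrow> (\<Sum>p\<leftarrow>ps. \<bar>f p\<bar>) \<le> C"
  shows "f \<in> H1" "fbl_norm f \<le> C"
proof -
  show "f \<in> H1" using assms by (auto simp: H1_def fbl_sums_def intro!: bdd_aboveI)
  show "fbl_norm f \<le> C" unfolding fbl_norm_def
    by (rule cSup_least[OF fbl_sums_nonempty]) (use assms in \<open>auto simp: fbl_sums_def\<close>)
qed

lemma H1_dominated:
  assumes "pos_homogeneous f" "g \<in> H1" "h \<in> H1" "\<And>p. \<bar>f p\<bar> \<le> \<bar>g p\<bar> + \<bar>h p\<bar>"
  shows "f \<in> H1" "fbl_norm f \<le> fbl_norm g + fbl_norm h"
proof -
  have le: "(\<Sum>p\<leftarrow>ps. \<bar>f p\<bar>) \<le> fbl_norm g + fbl_norm h" if "ps \<in> weakly_summing" for ps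
  proof -
    have "(\<Sum>p\<leftarrow>ps. \<bar>f p\<bar>) \<le> (\<Sum>p\<leftarrow>ps. \<bar>g p\<bar> + \<bar>h p\<bar>)"
      by (intro sum_list_mono assms)
    also have "\<dots> = (\<Sum>p\<leftarrow>ps. \<bar>g p\<bar>) + (\<Sum>p\<leftarrow>ps. \<bar>h p\<bar>)" by (rule sum_list_addf)
    also have "\<dots> \<le> fbl_norm g + fbl_norm h" by (intro add_mono fbl_norm_ge assms that)
    finally show ?thesis .
  qed
  show "f \<in> H1" by (rule H1_bound(1)[OF assms(1)]) (rule le)
  show "fbl_norm f \<le> fbl_norm g + fbl_norm h" by (rule H1_bound(2)[OF assms(1)]) (rule le)
qed

lemma H1_hom: "f \<in> H1 \<Longrightarrow> 0 \<le> c \<Longrightarrow> f (c *\<^sub>R p) = c * f p"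
  by (simp add: H1_def pos_homogeneous_def)

lemma H1_zero:
  defines "z \<equiv> \<lambda>p :: 'a::real_normed_vector \<Rightarrow>\<^sub>L real. 0 :: real"
  shows "z \<in> H1" "fbl_norm z = 0"
proof -
  show z: "z \<in> H1"
    by (rule H1_bound(1)[of _ 0]) (simp_all add: pos_homogeneous_def z_def)
  have "fbl_norm z \<le> 0"
    by (rule H1_bound(2)[of _ 0]) (simp_all add: pos_homogeneous_def z_def)
  with fbl_norm_nonneg[OF z] show "fbl_norm z = 0" by simp
qed

lemma H1_mono:
  fixes f g :: "('a::real_normed_vector \<Rightarrow>\<^sub>L real) \<Rightarrow> real"
  assumes "f \<in> H1" "g \<in> H1" "\<And>p. \<bar>f p\<bar> \<le> \<bar>g p\<bar>"
  shows "fbl_norm f \<le> fbl_norm g"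
proof -
  have "fbl_norm f \<le> fbl_norm g + fbl_norm (\<lambda>p :: 'a \<Rightarrow>\<^sub>L real. 0)"
    by (rule H1_dominated(2)) (use assms H1_zero(1) in \<open>auto simp: H1_def\<close>)
  then show ?thesis by (simp add: H1_zero(2))
qed

lemma H1_add:
  assumes "f \<in> H1" "g \<in> H1"
  shows "(\<lambda>p. f p + g p) \<in> H1" "fbl_norm (\<lambda>p. f p + g p) \<le> fbl_norm f + fbl_norm g"
  by (rule H1_dominated[OF _ assms];
      simp add: pos_homogeneous_def H1_hom assms distrib_left abs_triangle_ineq)+

lemma H1_max:
  assumes "f \<in> H1" "g \<in> H1"
  shows "(\<lambda>p. max (f p) (g p)) \<in> H1"
  by (rule H1_dominated[OF _ assms])
    (auto simp: pos_homogeneous_def H1_hom assms max_mult_distrib_left)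

lemma H1_scale:
  assumes "f \<in> H1"
  shows "(\<lambda>p. c * f p) \<in> H1" "fbl_norm (\<lambda>p. c * f p) = \<bar>c\<bar> * fbl_norm f"
proof -
  have sums: "(\<Sum>p\<leftarrow>ps. \<bar>a * f p\<bar>) = \<bar>a\<bar> * (\<Sum>p\<leftarrow>ps. \<bar>f p\<bar>)" for a and f :: "('a \<Rightarrow>\<^sub>L real) \<Rightarrow> real" and ps
    by (simp add: abs_mult sum_list_const_mult)
  have *: "(\<lambda>p. a * f p) \<in> H1 \<and> fbl_norm (\<lambda>p. a * f p) \<le> \<bar>a\<bar> * fbl_norm f"
    if "f \<in> H1" for a and f :: "('a \<Rightarrow>\<^sub>L real) \<Rightarrow> real"
  proof -
    have hom: "pos_homogeneous (\<lambda>p. a * f p)"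
      by (simp add: pos_homogeneous_def H1_hom that)
    have le: "(\<Sum>p\<leftarrow>ps. \<bar>a * f p\<bar>) \<le> \<bar>a\<bar> * fbl_norm f" if "ps \<in> weakly_summing" for ps
      unfolding sums by (intro mult_left_mono fbl_norm_ge \<open>f \<in> H1\<close> that) simp
    show ?thesis
      by (intro conjI H1_bound(1)[OF hom] H1_bound(2)[OF hom]) (rule le, assumption)+
  qed
  show mem: "(\<lambda>p. c * f p) \<in> H1" using * assms by blast
  show "fbl_norm (\<lambda>p. c * f p) = \<bar>c\<bar> * fbl_norm f"
  proof (cases "c = 0")
    case False
    have "fbl_norm (\<lambda>p. inverse c * (c * f p)) \<le> \<bar>inverse c\<bar> * fbl_norm (\<lambda>p. c * f p)"
      using *[OF mem] by blast
    then have "\<bar>c\<bar> * fbl_norm f \<le> fbl_norm (\<lambda>p. c * f p)"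
      using False by (simp add: field_simps mult.assoc[symmetric])
    then show ?thesis using *[OF assms, of c] by simp
  qed (simp add: H1_zero)
qed

lemma H1_diff: "f \<in> H1 \<Longrightarrow> g \<in> H1 \<Longrightarrow> (\<lambda>p. f p - g p) \<in> H1"
  using H1_add(1)[of f "\<lambda>p. -1 * g p"] H1_scale(1)[of g "-1"] by simp

lemma H1_pointwise:
  fixes f :: "('a::real_normed_vector \<Rightarrow>\<^sub>L real) \<Rightarrow> real"
  assumes "f \<in> H1"
  shows "\<bar>f p\<bar> \<le> norm p * fbl_norm f"
proof (cases "p = 0")
  case True
  then show ?thesis using H1_hom[OF assms, of 0 0] by simp
next
  case False
  define q where "q = inverse (norm p) *\<^sub>R p"
  have "\<bar>blinfun_apply q x\<bar> \<le> 1" if "norm x \<le> 1" for x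
    using norm_blinfun[of q x] that False by (auto simp: q_def)
  then have "[q] \<in> weakly_summing" by (simp add: weakly_summing_def)
  from fbl_norm_ge[OF assms this] have "\<bar>f q\<bar> \<le> fbl_norm f" by simp
  moreover have "f q = inverse (norm p) * f p" unfolding q_def by (simp add: H1_hom assms)
  ultimately show ?thesis using False by (simp add: abs_mult field_simps)
qed

lemma delta_lattice_H1: "f \<in> delta_lattice \<Longrightarrow> f \<in> H1"
proof (induction rule: delta_lattice.induct)
  case (delta x)
  show ?case
  proof (rule H1_bound(1)[of _ "norm x"])
    fix ps :: "('a \<Rightarrow>\<^sub>L real) list" assume ps: "ps \<in> weakly_summing"
    show "(\<Sum>p\<leftarrow>ps. \<bar>blinfun_apply p x\<bar>) \<le> norm x"
    proof (cases "x = 0")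
      case False
      have "(\<Sum>p\<leftarrow>ps. \<bar>blinfun_apply p (inverse (norm x) *\<^sub>R x)\<bar>) \<le> 1"
        using ps False by (simp add: weakly_summing_def)
      then have "inverse (norm x) * (\<Sum>p\<leftarrow>ps. \<bar>blinfun_apply p x\<bar>) \<le> 1"
        by (simp add: blinfun.scaleR_right abs_mult sum_list_const_mult)
      then show ?thesis using False by (simp add: field_simps)
    qed (simp add: blinfun.zero_right)
  qed (simp add: pos_homogeneous_def blinfun.scaleR_left)
qed (auto intro: H1_add H1_max H1_scale)

lemma FBL_H1: "f \<in> FBL \<Longrightarrow> f \<in> H1" by (simp add: FBL_def)

lemma FBL_approx:
  assumes "f \<in> FBL" "0 < e"
  obtains g where "g \<in> delta_lattice" "g \<in> H1" "fbl_norm (\<lambda>p. f p - g p) < e"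
proof -
  from assms obtain g where "g \<in> delta_lattice" "fbl_norm (\<lambda>p. f p - g p) < e"
    unfolding FBL_def by blast
  with that delta_lattice_H1 show thesis by blast
qed

lemma FBL_add:
  assumes "f \<in> FBL" "g \<in> FBL"
  shows "(\<lambda>p. f p + g p) \<in> FBL"
proof -
  note H = assms[THEN FBL_H1]
  have "\<exists>h\<in>delta_lattice. fbl_norm (\<lambda>p. f p + g p - h p) < e" if e: "0 < e" for e
  proof -
    obtain f' where f': "f' \<in> delta_lattice" "f' \<in> H1" "fbl_norm (\<lambda>p. f p - f' p) < e/2"
      by (rule FBL_approx[OF assms(1) half_gt_zero[OF e]])
    obtain g' where g': "g' \<in> delta_lattice" "g' \<in> H1" "fbl_norm (\<lambda>p. g p - g' p) < e/2"
      by (rule FBL_approx[OF assms(2) half_gt_zero[OF e]])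
    have "fbl_norm (\<lambda>p. (f p - f' p) + (g p - g' p)) < e"
      using H1_add(2)[OF H1_diff[OF H(1) f'(2)] H1_diff[OF H(2) g'(2)]] f'(3) g'(3) by linarith
    then have "fbl_norm (\<lambda>p. f p + g p - (f' p + g' p)) < e"
      by (simp only: add_diff_add)
    then show ?thesis
      by (intro bexI[of _ "\<lambda>p. f' p + g' p"] delta_lattice.add f' g')
  qed
  then show ?thesis using H by (simp add: FBL_def H1_add)
qed

lemma FBL_max:
  assumes "f \<in> FBL" "g \<in> FBL"
  shows "(\<lambda>p. max (f p) (g p)) \<in> FBL"
proof -
  note H = assms[THEN FBL_H1]
  have "\<exists>h\<in>delta_lattice. fbl_norm (\<lambda>p. max (f p) (g p) - h p) < e" if e: "0 < e" for e
  proof -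
    obtain f' where f': "f' \<in> delta_lattice" "f' \<in> H1" "fbl_norm (\<lambda>p. f p - f' p) < e/2"
      by (rule FBL_approx[OF assms(1) half_gt_zero[OF e]])
    obtain g' where g': "g' \<in> delta_lattice" "g' \<in> H1" "fbl_norm (\<lambda>p. g p - g' p) < e/2"
      by (rule FBL_approx[OF assms(2) half_gt_zero[OF e]])
    have "fbl_norm (\<lambda>p. max (f p) (g p) - max (f' p) (g' p))
        \<le> fbl_norm (\<lambda>p. f p - f' p) + fbl_norm (\<lambda>p. g p - g' p)"
    proof (rule H1_dominated(2)[OF _ H1_diff[OF H(1) f'(2)] H1_diff[OF H(2) g'(2)]])
      show "pos_homogeneous (\<lambda>p. max (f p) (g p) - max (f' p) (g' p))"
        using H1_diff[OF H1_max[OF H] H1_max[OF f'(2) g'(2)]] by (simp add: H1_def)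
    qed linarith
    then have "fbl_norm (\<lambda>p. max (f p) (g p) - max (f' p) (g' p)) < e"
      using f'(3) g'(3) by linarith
    then show ?thesis
      by (intro bexI[of _ "\<lambda>p. max (f' p) (g' p)"] delta_lattice.sup f' g')
  qed
  then show ?thesis using H by (simp add: FBL_def H1_max)
qed

lemma FBL_scale:
  assumes "f \<in> FBL"
  shows "(\<lambda>p. c * f p) \<in> FBL"
proof -
  note H = assms[THEN FBL_H1]
  have "\<exists>h\<in>delta_lattice. fbl_norm (\<lambda>p. c * f p - h p) < e" if "0 < e" for e
  proof -
    have "0 < e / (\<bar>c\<bar> + 1)" using that by simp
    then obtain f' where f': "f' \<in> delta_lattice" "f' \<in> H1" "fbl_norm (\<lambda>p. f p - f' p) < e / (\<bar>c\<bar> + 1)"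
      using FBL_approx[OF assms] by metis
    have "fbl_norm (\<lambda>p. c * f p - c * f' p) = \<bar>c\<bar> * fbl_norm (\<lambda>p. f p - f' p)"
      using H1_scale(2)[OF H1_diff[OF H f'(2)], of c] by (simp add: right_diff_distrib)
    also have "\<dots> \<le> (\<bar>c\<bar> + 1) * fbl_norm (\<lambda>p. f p - f' p)"
      by (intro mult_right_mono fbl_norm_nonneg H1_diff H f') simp
    also have "\<dots> < e" using f'(3) by (simp add: field_simps)
    finally show ?thesis
      by (intro bexI[of _ "\<lambda>p. c * f' p"] delta_lattice.scale f')
  qed
  then show ?thesis using H by (simp add: FBL_def H1_scale)
qed

lemma FBL_closed:
  assumes "f \<in> H1" "\<And>e. 0 < e \<Longrightarrow> \<exists>g\<in>FBL. fbl_norm (\<lambda>p. f p - g p) < e"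
  shows "f \<in> FBL"
proof -
  have "\<exists>h\<in>delta_lattice. fbl_norm (\<lambda>p. f p - h p) < e" if e: "0 < e" for e
  proof -
    obtain g where g: "g \<in> FBL" "fbl_norm (\<lambda>p. f p - g p) < e/2"
      using assms(2)[OF half_gt_zero[OF e]] by blast
    obtain g' where g': "g' \<in> delta_lattice" "g' \<in> H1" "fbl_norm (\<lambda>p. g p - g' p) < e/2"
      by (rule FBL_approx[OF g(1) half_gt_zero[OF e]])
    have "fbl_norm (\<lambda>p. (f p - g p) + (g p - g' p)) < e"
      using H1_add(2)[OF H1_diff[OF assms(1) FBL_H1[OF g(1)]] H1_diff[OF FBL_H1[OF g(1)] g'(2)]]
        g(2) g'(3) by linarith
    then have "fbl_norm (\<lambda>p. f p - g' p) < e" by simp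
    then show ?thesis using g'(1) by blast
  qed
  then show ?thesis using assms(1) by (simp add: FBL_def)
qed

lemma FBL_zero: "(\<lambda>p :: 'a::real_normed_vector \<Rightarrow>\<^sub>L real. 0) \<in> FBL"
proof -
  have "(\<lambda>p :: 'a \<Rightarrow>\<^sub>L real. 0) \<in> delta_lattice"
    using delta_lattice.delta[of 0] by (simp add: blinfun.zero_right)
  then have "\<exists>g\<in>delta_lattice. fbl_norm (\<lambda>p :: 'a \<Rightarrow>\<^sub>L real. 0 - g p) < e" if "0 < e" for e
    using that H1_zero(2)[where 'a = 'a] by (intro bexI[of _ "\<lambda>p. 0"]) simp_all
  then show ?thesis using H1_zero(1) by (simp add: FBL_def)
qed

typedef (overloaded) ('a::banach) fbl = "FBL :: (('a \<Rightarrow>\<^sub>L real) \<Rightarrow> real) set"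
  morphisms fbl_apply Abs_fbl
  using FBL_zero by blast

setup_lifting type_definition_fbl

lemma fbl_apply_H1: "fbl_apply f \<in> H1"
  using fbl_apply FBL_H1 by blast

instantiation fbl :: (banach) real_normed_vector
begin

lift_definition zero_fbl :: "'a fbl" is "\<lambda>p. 0"
  by (rule FBL_zero)

lift_definition plus_fbl :: "'a fbl \<Rightarrow> 'a fbl \<Rightarrow> 'a fbl" is "\<lambda>f g p. f p + g p"
  by (rule FBL_add)

lift_definition uminus_fbl :: "'a fbl \<Rightarrow> 'a fbl" is "\<lambda>f p. - f p"
  using FBL_scale[of _ "-1"] by simp

lift_definition minus_fbl :: "'a fbl \<Rightarrow> 'a fbl \<Rightarrow> 'a fbl" is "\<lambda>f g p. f p - g p"
proof -
  fix f g :: "('a \<Rightarrow>\<^sub>L real) \<Rightarrow> real"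
  assume "f \<in> FBL" "g \<in> FBL"
  then show "(\<lambda>p. f p - g p) \<in> FBL"
    using FBL_add[of f "\<lambda>p. -1 * g p"] FBL_scale[of g "-1"] by simp
qed

lift_definition scaleR_fbl :: "real \<Rightarrow> 'a fbl \<Rightarrow> 'a fbl" is "\<lambda>c f p. c * f p"
  by (rule FBL_scale)

lift_definition norm_fbl :: "'a fbl \<Rightarrow> real" is fbl_norm .

definition dist_fbl :: "'a fbl \<Rightarrow> 'a fbl \<Rightarrow> real" where "dist_fbl x y = norm (x - y)"
definition sgn_fbl :: "'a fbl \<Rightarrow> 'a fbl" where "sgn_fbl x = inverse (norm x) *\<^sub>R x"
definition uniformity_fbl :: "('a fbl \<times> 'a fbl) filter" where
  "uniformity_fbl = (INF e\<in>{0<..}. principal {(x, y). dist x y < e})"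
definition open_fbl :: "'a fbl set \<Rightarrow> bool" where
  "open_fbl U \<longleftrightarrow> (\<forall>x\<in>U. eventually (\<lambda>(x', y). x' = x \<longrightarrow> y \<in> U) uniformity)"

instance
proof
  fix x y z :: "'a fbl" and a b :: real
  show "x + y + z = x + (y + z)" "x + y = y + x" "0 + x = x" "- x + x = 0" "x - y = x + - y"
    by (transfer; simp add: fun_eq_iff)+
  show "a *\<^sub>R (x + y) = a *\<^sub>R x + a *\<^sub>R y" "(a + b) *\<^sub>R x = a *\<^sub>R x + b *\<^sub>R x"
    "a *\<^sub>R b *\<^sub>R x = (a * b) *\<^sub>R x" "1 *\<^sub>R x = x"
    by (transfer; simp add: algebra_simps)+
  show "norm x = 0 \<longleftrightarrow> x = 0"
  proof
    assume "norm x = 0"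
    then have "fbl_apply x p = 0" for p
      using H1_pointwise[OF fbl_apply_H1, of x p] by (simp add: norm_fbl.rep_eq)
    then show "x = 0" by (simp add: fbl_apply_inject[symmetric] zero_fbl.rep_eq fun_eq_iff)
  qed (simp add: norm_fbl.rep_eq zero_fbl.rep_eq H1_zero)
  show "norm (a *\<^sub>R x) = \<bar>a\<bar> * norm x"
    by transfer (simp add: H1_scale FBL_H1)
  show "norm (x + y) \<le> norm x + norm y"
    by transfer (simp add: H1_add FBL_H1)
qed (simp_all add: dist_fbl_def sgn_fbl_def uniformity_fbl_def open_fbl_def)

end

instantiation fbl :: (banach) banach_lattice
begin

lift_definition less_eq_fbl :: "'a fbl \<Rightarrow> 'a fbl \<Rightarrow> bool" is "\<lambda>f g. \<forall>p. f p \<le> g p" .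

definition less_fbl :: "'a fbl \<Rightarrow> 'a fbl \<Rightarrow> bool" where "less_fbl f g \<longleftrightarrow> f \<le> g \<and> \<not> g \<le> f"

lift_definition sup_fbl :: "'a fbl \<Rightarrow> 'a fbl \<Rightarrow> 'a fbl" is "\<lambda>f g p. max (f p) (g p)"
  by (rule FBL_max)

lift_definition inf_fbl :: "'a fbl \<Rightarrow> 'a fbl \<Rightarrow> 'a fbl" is "\<lambda>f g p. min (f p) (g p)"
proof -
  fix f g :: "('a \<Rightarrow>\<^sub>L real) \<Rightarrow> real"
  assume "f \<in> FBL" "g \<in> FBL"
  then have "(\<lambda>p. -1 * max (-1 * f p) (-1 * g p)) \<in> FBL"
    by (intro FBL_scale FBL_max)
  moreover have "-1 * max (-1 * f p) (-1 * g p) = min (f p) (g p)" for p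
    by (simp add: min_def max_def)
  ultimately show "(\<lambda>p. min (f p) (g p)) \<in> FBL" by simp
qed

definition abs_fbl :: "'a fbl \<Rightarrow> 'a fbl" where "abs_fbl f = sup f (- f)"

instance
proof
  fix x y z :: "'a fbl" and a b :: real
  show "x < y \<longleftrightarrow> x \<le> y \<and> \<not> y \<le> x" by (fact less_fbl_def)
  show "x \<le> x" by transfer simp
  show "x \<le> y \<Longrightarrow> y \<le> z \<Longrightarrow> x \<le> z" by transfer (meson order_trans)
  show "x \<le> y \<Longrightarrow> y \<le> x \<Longrightarrow> x = y" by transfer (simp add: fun_eq_iff antisym)
  show "x \<le> y \<Longrightarrow> z + x \<le> z + y" by transfer simp
  show "x \<le> y \<Longrightarrow> 0 \<le> a \<Longrightarrow> a *\<^sub>R x \<le> a *\<^sub>R y" by transfer (simp add: mult_left_mono)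
  show "a \<le> b \<Longrightarrow> 0 \<le> x \<Longrightarrow> a *\<^sub>R x \<le> b *\<^sub>R x" by transfer (simp add: mult_right_mono)
  show "x \<le> sup x y" "y \<le> sup x y" by (transfer; simp)+
  show "y \<le> x \<Longrightarrow> z \<le> x \<Longrightarrow> sup y z \<le> x" by transfer simp
  show "inf x y \<le> x" "inf x y \<le> y" by (transfer; simp)+
  show "x \<le> y \<Longrightarrow> x \<le> z \<Longrightarrow> x \<le> inf y z" by transfer simp
  show "\<bar>x\<bar> = sup x (- x)" by (fact abs_fbl_def)
  show "norm x \<le> norm y" if "\<bar>x\<bar> \<le> \<bar>y\<bar>"
  proof -
    have "\<bar>fbl_apply x p\<bar> \<le> \<bar>fbl_apply y p\<bar>" for p
      using that unfolding abs_fbl_def less_eq_fbl.rep_eq sup_fbl.rep_eq uminus_fbl.rep_eq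
      by (auto simp: abs_real_def max_def dest!: spec[of _ p] split: if_splits)
    then show ?thesis unfolding norm_fbl.rep_eq by (intro H1_mono fbl_apply_H1)
  qed
next
  fix X :: "nat \<Rightarrow> 'a fbl" assume X: "Cauchy X"
  define F where "F p = lim (\<lambda>n. fbl_apply (X n) p)" for p
  have "Cauchy (\<lambda>n. fbl_apply (X n) p)" for p
  proof (rule CauchyI)
    fix e :: real assume "0 < e"
    then have "0 < e / (norm p + 1)" by (simp add: add_nonneg_pos)
    then obtain M where M: "\<forall>m\<ge>M. \<forall>n\<ge>M. norm (X m - X n) < e / (norm p + 1)"
      using CauchyD[OF X] by blast
    have "norm (fbl_apply (X m) p - fbl_apply (X n) p) < e" if "m \<ge> M" "n \<ge> M" for m n
    proof -
      have "\<bar>fbl_apply (X m) p - fbl_apply (X n) p\<bar> \<le> norm p * norm (X m - X n)"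
        using H1_pointwise[OF fbl_apply_H1, of "X m - X n" p]
        by (simp add: norm_fbl.rep_eq minus_fbl.rep_eq)
      also have "\<dots> \<le> (norm p + 1) * norm (X m - X n)" by (simp add: mult_right_mono)
      also have "\<dots> < e"
        using M that by (simp add: pos_less_divide_eq add_nonneg_pos mult.commute)
      finally show ?thesis by simp
    qed
    then show "\<exists>M. \<forall>m\<ge>M. \<forall>n\<ge>M. norm (fbl_apply (X m) p - fbl_apply (X n) p) < e" by blast
  qed
  then have lim: "(\<lambda>n. fbl_apply (X n) p) \<longlonglongrightarrow> F p" for p
    by (simp add: F_def Cauchy_convergent convergent_LIMSEQ_iff[symmetric])
  have homF: "F (c *\<^sub>R p) = c * F p" if "0 \<le> c" for c p
  proof (rule LIMSEQ_unique[OF lim])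
    show "(\<lambda>n. fbl_apply (X n) (c *\<^sub>R p)) \<longlonglongrightarrow> c * F p"
      unfolding H1_hom[OF fbl_apply_H1 that] by (intro tendsto_intros lim)
  qed
  have bound: "(\<lambda>p. F p - fbl_apply (X n) p) \<in> H1 \<and> fbl_norm (\<lambda>p. F p - fbl_apply (X n) p) \<le> e"
    if M: "\<forall>m\<ge>M. \<forall>n\<ge>M. norm (X m - X n) < e" and n: "n \<ge> M" for M e n
  proof -
    have hom: "pos_homogeneous (\<lambda>p. F p - fbl_apply (X n) p)"
      by (simp add: pos_homogeneous_def homF H1_hom[OF fbl_apply_H1] right_diff_distrib)
    have le: "(\<Sum>p\<leftarrow>ps. \<bar>F p - fbl_apply (X n) p\<bar>) \<le> e" if ps: "ps \<in> weakly_summing" for ps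
    proof (rule LIMSEQ_le_const2)
      show "(\<lambda>m. \<Sum>p\<leftarrow>ps. \<bar>fbl_apply (X m) p - fbl_apply (X n) p\<bar>)
          \<longlonglongrightarrow> (\<Sum>p\<leftarrow>ps. \<bar>F p - fbl_apply (X n) p\<bar>)"
        by (induction ps) (auto intro!: tendsto_intros lim)
      have "(\<Sum>p\<leftarrow>ps. \<bar>fbl_apply (X m) p - fbl_apply (X n) p\<bar>) \<le> e" if "m \<ge> M" for m
        using fbl_norm_ge[OF fbl_apply_H1[of "X m - X n"] ps] M n that
        by (fastforce simp: norm_fbl.rep_eq minus_fbl.rep_eq)
      then show "\<exists>M. \<forall>m\<ge>M. (\<Sum>p\<leftarrow>ps. \<bar>fbl_apply (X m) p - fbl_apply (X n) p\<bar>) \<le> e" by blast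
    qed
    show ?thesis by (intro conjI H1_bound(1)[OF hom] H1_bound(2)[OF hom]) (rule le, assumption)+
  qed
  obtain M1 where M1: "\<forall>m\<ge>M1. \<forall>n\<ge>M1. norm (X m - X n) < 1" using CauchyD[OF X, of 1] by auto
  have FH: "F \<in> H1"
    using H1_add(1)[OF bound[OF M1 order_refl, THEN conjunct1] fbl_apply_H1[of "X M1"]] by simp
  have "F \<in> FBL"
  proof (rule FBL_closed[OF FH])
    fix e :: real assume "0 < e"
    then obtain M where M: "\<forall>m\<ge>M. \<forall>n\<ge>M. norm (X m - X n) < e/2"
      using CauchyD[OF X, of "e/2"] by auto
    show "\<exists>g\<in>FBL. fbl_norm (\<lambda>p. F p - g p) < e"
      using bound[OF M order_refl] \<open>0 < e\<close>
      by (intro bexI[of _ "fbl_apply (X M)"]) (auto simp: fbl_apply)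
  qed
  then have nF: "fbl_apply (Abs_fbl F) = F" by (simp add: Abs_fbl_inverse)
  have "X \<longlonglongrightarrow> Abs_fbl F"
  proof (rule LIMSEQ_I)
    fix r :: real assume "0 < r"
    then obtain M where M: "\<forall>m\<ge>M. \<forall>n\<ge>M. norm (X m - X n) < r / 2"
      using CauchyD[OF X, of "r/2"] by auto
    have "norm (X n - Abs_fbl F) < r" if "n \<ge> M" for n
    proof -
      have "norm (Abs_fbl F - X n) \<le> r / 2"
        using bound[OF M that] by (simp add: norm_fbl.rep_eq minus_fbl.rep_eq nF)
      then show ?thesis using \<open>0 < r\<close> by (simp add: norm_minus_commute)
    qed
    then show "\<exists>M. \<forall>n\<ge>M. norm (X n - Abs_fbl F) < r" by blast
  qed
  then show "convergent X" by (rule convergentI)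
qed

end


section \<open>Vector lattices with a carrier, and the Fremlin tensor product\<close>

text \<open>The universal property of the Fremlin tensor product quantifies over vector lattices, so these
  are needed as objects and not only as types of a class.\<close>

record 'v vlat =
  vcarrier :: "'v set"
  vadd :: "'v \<Rightarrow> 'v \<Rightarrow> 'v"
  vzero :: 'v
  vscale :: "real \<Rightarrow> 'v \<Rightarrow> 'v"
  vle :: "'v \<Rightarrow> 'v \<Rightarrow> bool"
  vsup :: "'v \<Rightarrow> 'v \<Rightarrow> 'v"

locale vector_lattice =
  fixes V :: "'v vlat"
  assumes add_closed: "x \<in> vcarrier V \<Longrightarrow> y \<in> vcarrier V \<Longrightarrow> vadd V x y \<in> vcarrier V"
    and zero_closed: "vzero V \<in> vcarrier V"
    and scale_closed: "x \<in> vcarrier V \<Longrightarrow> vscale V c x \<in> vcarrier V"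
    and sup_closed: "x \<in> vcarrier V \<Longrightarrow> y \<in> vcarrier V \<Longrightarrow> vsup V x y \<in> vcarrier V"
    and add_assoc: "x \<in> vcarrier V \<Longrightarrow> y \<in> vcarrier V \<Longrightarrow> z \<in> vcarrier V \<Longrightarrow>
      vadd V (vadd V x y) z = vadd V x (vadd V y z)"
    and add_commute: "x \<in> vcarrier V \<Longrightarrow> y \<in> vcarrier V \<Longrightarrow> vadd V x y = vadd V y x"
    and add_zero: "x \<in> vcarrier V \<Longrightarrow> vadd V x (vzero V) = x"
    and add_neg: "x \<in> vcarrier V \<Longrightarrow> vadd V x (vscale V (-1) x) = vzero V"
    and scale_add: "x \<in> vcarrier V \<Longrightarrow> y \<in> vcarrier V \<Longrightarrow>
      vscale V c (vadd V x y) = vadd V (vscale V c x) (vscale V c y)"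
    and add_scale: "x \<in> vcarrier V \<Longrightarrow> vscale V (c + d) x = vadd V (vscale V c x) (vscale V d x)"
    and scale_scale: "x \<in> vcarrier V \<Longrightarrow> vscale V c (vscale V d x) = vscale V (c * d) x"
    and scale_one: "x \<in> vcarrier V \<Longrightarrow> vscale V 1 x = x"
    and le_refl: "x \<in> vcarrier V \<Longrightarrow> vle V x x"
    and le_antisym: "x \<in> vcarrier V \<Longrightarrow> y \<in> vcarrier V \<Longrightarrow> vle V x y \<Longrightarrow> vle V y x \<Longrightarrow> x = y"
    and le_trans: "x \<in> vcarrier V \<Longrightarrow> y \<in> vcarrier V \<Longrightarrow> z \<in> vcarrier V \<Longrightarrow>
      vle V x y \<Longrightarrow> vle V y z \<Longrightarrow> vle V x z"
    and add_mono: "x \<in> vcarrier V \<Longrightarrow> y \<in> vcarrier V \<Longrightarrow> z \<in> vcarrier V \<Longrightarrow>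
      vle V x y \<Longrightarrow> vle V (vadd V x z) (vadd V y z)"
    and scale_mono: "x \<in> vcarrier V \<Longrightarrow> y \<in> vcarrier V \<Longrightarrow> 0 \<le> c \<Longrightarrow>
      vle V x y \<Longrightarrow> vle V (vscale V c x) (vscale V c y)"
    and sup_ge1: "x \<in> vcarrier V \<Longrightarrow> y \<in> vcarrier V \<Longrightarrow> vle V x (vsup V x y)"
    and sup_ge2: "x \<in> vcarrier V \<Longrightarrow> y \<in> vcarrier V \<Longrightarrow> vle V y (vsup V x y)"
    and sup_least: "x \<in> vcarrier V \<Longrightarrow> y \<in> vcarrier V \<Longrightarrow> z \<in> vcarrier V \<Longrightarrow>
      vle V x z \<Longrightarrow> vle V y z \<Longrightarrow> vle V (vsup V x y) z"

definition vabs :: "'v vlat \<Rightarrow> 'v \<Rightarrow> 'v" where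
  "vabs V x = vsup V x (vscale V (-1) x)"

definition vsum :: "'v vlat \<Rightarrow> 'v list \<Rightarrow> 'v" where
  "vsum V xs = foldr (vadd V) xs (vzero V)"

definition archimedean :: "'v vlat \<Rightarrow> bool" where
  "archimedean V \<longleftrightarrow> (\<forall>x\<in>vcarrier V. \<forall>y\<in>vcarrier V.
     (\<forall>n::nat. vle V (vscale V (real n) x) y) \<longrightarrow> vle V x (vzero V))"

definition lattice_hom :: "'v vlat \<Rightarrow> 'w vlat \<Rightarrow> ('v \<Rightarrow> 'w) \<Rightarrow> bool" where
  "lattice_hom V W T \<longleftrightarrow>
     (\<forall>x\<in>vcarrier V. T x \<in> vcarrier W) \<and>
     (\<forall>x\<in>vcarrier V. \<forall>y\<in>vcarrier V. T (vadd V x y) = vadd W (T x) (T y)) \<and>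
     (\<forall>c. \<forall>x\<in>vcarrier V. T (vscale V c x) = vscale W c (T x)) \<and>
     (\<forall>x\<in>vcarrier V. \<forall>y\<in>vcarrier V. T (vsup V x y) = vsup W (T x) (T y))"

definition bilinear_map :: "'e vlat \<Rightarrow> 'f vlat \<Rightarrow> 'w vlat \<Rightarrow> ('e \<Rightarrow> 'f \<Rightarrow> 'w) \<Rightarrow> bool" where
  "bilinear_map E F W b \<longleftrightarrow>
     (\<forall>x\<in>vcarrier E. \<forall>y\<in>vcarrier F. b x y \<in> vcarrier W) \<and>
     (\<forall>x\<in>vcarrier E. \<forall>x'\<in>vcarrier E. \<forall>y\<in>vcarrier F. b (vadd E x x') y = vadd W (b x y) (b x' y)) \<and>
     (\<forall>x\<in>vcarrier E. \<forall>y\<in>vcarrier F. \<forall>y'\<in>vcarrier F. b x (vadd F y y') = vadd W (b x y) (b x y')) \<and>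
     (\<forall>c. \<forall>x\<in>vcarrier E. \<forall>y\<in>vcarrier F. b (vscale E c x) y = vscale W c (b x y)) \<and>
     (\<forall>c. \<forall>x\<in>vcarrier E. \<forall>y\<in>vcarrier F. b x (vscale F c y) = vscale W c (b x y))"

definition lattice_bimorphism :: "'e vlat \<Rightarrow> 'f vlat \<Rightarrow> 'w vlat \<Rightarrow> ('e \<Rightarrow> 'f \<Rightarrow> 'w) \<Rightarrow> bool" where
  "lattice_bimorphism E F W b \<longleftrightarrow> bilinear_map E F W b \<and>
     (\<forall>x\<in>vcarrier E. vle E (vzero E) x \<longrightarrow> lattice_hom F W (b x)) \<and>
     (\<forall>y\<in>vcarrier F. vle F (vzero F) y \<longrightarrow> lattice_hom E W (\<lambda>x. b x y))"

text \<open>\<open>G\<close> with the map \<open>t\<close> is a Fremlin tensor product of \<open>E\<close> and \<open>F\<close>: an Archimedean vector lattice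
  through which every lattice bimorphism into an Archimedean vector lattice factors uniquely.
  HOL cannot quantify over the type on which the target \<open>W\<close> lives, but the type
  \<open>'g + 'e \<times> 'f\<close> is large enough to lose nothing. It contains a copy of every sublattice of \<open>G\<close>, so
  uniqueness forces \<open>G\<close> to be generated by the range of \<open>t\<close>, which gives uniqueness for all targets.
  A bimorphism takes values in the sublattice generated by its range; if both \<open>E\<close> and \<open>F\<close> are
  nonzero this has at most as many elements as \<open>E \<times> F\<close>, which contains the continuum, and otherwise it
  is zero. So it has a copy on \<open>'e \<times> 'f\<close>.\<close>

definition fremlin_tensor_product ::
    "'e vlat \<Rightarrow> 'f vlat \<Rightarrow> 'g vlat \<Rightarrow> ('e \<Rightarrow> 'f \<Rightarrow> 'g) \<Rightarrow> bool" where
  "fremlin_tensor_product E F G t \<longleftrightarrow>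
     vector_lattice G \<and> archimedean G \<and> lattice_bimorphism E F G t \<and>
     (\<forall>(W :: ('g + 'e \<times> 'f) vlat) b.
        vector_lattice W \<and> archimedean W \<and> lattice_bimorphism E F W b \<longrightarrow>
        (\<exists>T. lattice_hom G W T \<and> (\<forall>x\<in>vcarrier E. \<forall>y\<in>vcarrier F. T (t x y) = b x y)) \<and>
        (\<forall>T T'. lattice_hom G W T \<and> lattice_hom G W T' \<and>
           (\<forall>x\<in>vcarrier E. \<forall>y\<in>vcarrier F. T (t x y) = b x y \<and> T' (t x y) = b x y) \<longrightarrow>
           (\<forall>u\<in>vcarrier G. T u = T' u)))"

definition lattice_of_type :: "'a::banach_lattice vlat" where
  "lattice_of_type = \<lparr>vcarrier = UNIV, vadd = (+), vzero = 0, vscale = (*\<^sub>R), vle = (\<le>), vsup = sup\<rparr>"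


section \<open>The positive projective tensor product\<close>

text \<open>The algebraic tensor product, embedded in the Fremlin tensor product as the set of finite sums
  of elementary tensors.\<close>

definition algebraic_tensor ::
    "'g vlat \<Rightarrow> ('e::banach_lattice \<Rightarrow> 'f::banach_lattice \<Rightarrow> 'g) \<Rightarrow> 'g set" where
  "algebraic_tensor G t = range (\<lambda>ps. vsum G (map (\<lambda>(x, y). t x y) ps))"

definition pos_proj_norm ::
    "'g vlat \<Rightarrow> ('e::banach_lattice \<Rightarrow> 'f::banach_lattice \<Rightarrow> 'g) \<Rightarrow> 'g \<Rightarrow> real" where
  "pos_proj_norm G t u = Inf {(\<Sum>(x, y)\<leftarrow>ps. norm x * norm y) | ps.
     (\<forall>(x, y)\<in>set ps. 0 \<le> x \<and> 0 \<le> y) \<and> vle G (vabs G u) (vsum G (map (\<lambda>(x, y). t x y) ps))}"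

text \<open>The Banach lattice \<open>'z\<close>, with the canonical map \<open>j\<close> defined on the whole Fremlin tensor product
  \<open>G\<close>, is the completion of the algebraic tensor product for the positive projective norm. That \<open>j\<close> is
  a lattice homomorphism on \<open>G\<close> determines the order of \<open>'z\<close>: the algebraic tensor product itself is in
  general not a lattice.\<close>

definition pos_proj_completion ::
    "'g vlat \<Rightarrow> ('e::banach_lattice \<Rightarrow> 'f::banach_lattice \<Rightarrow> 'g) \<Rightarrow> ('g \<Rightarrow> 'z::banach_lattice) \<Rightarrow> bool" where
  "pos_proj_completion G t j \<longleftrightarrow>
     lattice_hom G lattice_of_type j \<and>
     (\<forall>u\<in>algebraic_tensor G t. norm (j u) = pos_proj_norm G t u) \<and>
     closure (j ` algebraic_tensor G t) = UNIV"

text \<open>A realisation of \<open>E \<otimes> F\<close> as a Banach lattice \<open>'z\<close>, with elementary tensors \<open>j (t x y)\<close>.\<close>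

definition pos_proj_tensor_product ::
    "'g vlat \<Rightarrow> ('e::banach_lattice \<Rightarrow> 'f::banach_lattice \<Rightarrow> 'g) \<Rightarrow> ('g \<Rightarrow> 'z::banach_lattice) \<Rightarrow> bool" where
  "pos_proj_tensor_product G t j \<longleftrightarrow>
     fremlin_tensor_product lattice_of_type lattice_of_type G t \<and> pos_proj_completion G t j"

text \<open>The copy of the positive projective tensor product of two closed ideals inside that of the whole
  lattices, where \<open>m x y\<close> is the elementary tensor of \<open>x\<close> and \<open>y\<close>.\<close>

definition ideal_tensor ::
    "('e::banach_lattice \<Rightarrow> 'f::banach_lattice \<Rightarrow> 'z::banach_lattice) \<Rightarrow> 'e set \<times> 'f set \<Rightarrow> 'z set" where
  "ideal_tensor m = (\<lambda>(I, J). closure (span {m x y | x y. x \<in> I \<and> y \<in> J}))"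


section \<open>Wijsman topology and descriptive complexity\<close>

definition compatible_metric :: "('a::topological_space \<Rightarrow> 'a \<Rightarrow> real) \<Rightarrow> bool" where
  "compatible_metric d \<longleftrightarrow> Metric_space UNIV d \<and> Metric_space.mtopology UNIV d = euclidean"

definition dense_sequence :: "(nat \<Rightarrow> 'a::topological_space) \<Rightarrow> bool" where
  "dense_sequence a \<longleftrightarrow> closure (range a) = UNIV"

text \<open>The coarsest topology on the nonempty closed sets for which all maps \<open>F \<mapsto> d(a n, F)\<close> are
  continuous.\<close>

definition wijsman :: "('a::topological_space \<Rightarrow> 'a \<Rightarrow> real) \<Rightarrow> (nat \<Rightarrow> 'a) \<Rightarrow> 'a set topology" where
  "wijsman d a = topology_generated_by
     {{F. closed F \<and> F \<noteq> {} \<and> (INF x\<in>F. d (a n) x) \<in> U} | n U. open U}"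

definition ideal_space ::
    "('a::banach_lattice \<Rightarrow> 'a \<Rightarrow> real) \<Rightarrow> (nat \<Rightarrow> 'a) \<Rightarrow> 'a set topology" where
  "ideal_space d a = subtopology (wijsman d a) closed_ideals"

definition sigma02_measurable :: "'a topology \<Rightarrow> 'b topology \<Rightarrow> ('a \<Rightarrow> 'b) \<Rightarrow> bool" where
  "sigma02_measurable X Y f \<longleftrightarrow> f \<in> topspace X \<rightarrow> topspace Y \<and>
     (\<forall>U. openin Y U \<longrightarrow> fsigma_in X {x \<in> topspace X. f x \<in> U})"

definition borel_of_topology :: "'a topology \<Rightarrow> 'a measure" where
  "borel_of_topology X = sigma (topspace X) {U. openin X U}"

end

theory Submission
  imports Defs
begin

text \<open>The only property of \<open>\<Xi>\<close> behind the descriptive complexity is lower semicontinuity. For open \<open>V\<close>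
  the set of pairs \<open>(J\<^sub>1, J\<^sub>2)\<close> with \<open>\<Xi> (J\<^sub>1, J\<^sub>2) \<inter> V \<noteq> {}\<close> is open: a closure meets \<open>V\<close> iff the span does,
  a point of the span in \<open>V\<close> is a finite combination of elementary tensors \<open>x\<^sub>i \<otimes> y\<^sub>i\<close>, the tensor map is
  continuous, and "\<open>J\<close> meets a small ball about \<open>x\<^sub>i\<close>" is an open condition on \<open>J\<close>. Hence each distance
  \<open>d\<^sub>0(\<alpha>\<^sub>n, \<Xi>(J\<^sub>1, J\<^sub>2))\<close> is upper semicontinuous in \<open>(J\<^sub>1, J\<^sub>2)\<close>. In a metrizable space an upper
  semicontinuous function pulls open sets of reals back to \<open>F\<^sub>\<sigma>\<close> sets, and the Wijsman space embeds in
  a countable product of lines by its distance functions, so \<open>\<Xi>\<close> is measurable. The graph is the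
  set where, for all \<open>n\<close> and rational \<open>r\<close>, the conditions \<open>d\<^sub>0(\<alpha>\<^sub>n, K) < r\<close> and
  \<open>d\<^sub>0(\<alpha>\<^sub>n, \<Xi>(J\<^sub>1, J\<^sub>2)) < r\<close> agree; each agreement is the union of an open and a closed set, so a \<open>G\<^sub>\<delta>\<close>.
  This part is \<open>lower_semicontinuous_sigma02\<close>, \<open>lower_semicontinuous_equalizer\<close> and
  \<open>ideal_tensor_lower_semicontinuous\<close>.

  What remains is that \<open>\<Xi>\<close> takes values in the closed ideals (\<open>ideal_tensor_closed_ideal\<close>). The whole
  argument sees the tensor product only through the map \<open>m x y = j (t x y)\<close>, a lattice bimorphism of
  Banach lattices with \<open>\<parallel>m x y\<parallel> \<le> \<parallel>x\<parallel> \<parallel>y\<parallel>\<close> and dense span. The key case is \<open>0 \<le> w \<le> m x y\<close> with \<open>x\<close>, \<open>y\<close>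
  positive elements of the two ideals. Such a \<open>w\<close> is a limit of sums \<open>\<Sum> m (a i) (b i)\<close>; after passing to
  positive parts it is a limit of sums \<open>\<Sum> m (h k) (c k)\<close> with \<open>h k, c k \<ge> 0\<close>
  (\<open>positive_part_approximation\<close>), and truncating \<open>h k\<close> at a multiple of \<open>x\<close> and \<open>c k\<close> at a multiple of \<open>y\<close>
  moves these sums into the ideals at the price of a small error (\<open>truncated_tensor_bound\<close>).

  Both approximations are inequalities inside a principal ideal. They are checked by real numbers:
  on the principal ideal of \<open>e\<close> there are enough real lattice homomorphisms \<open>\<omega>\<close> with \<open>\<omega> e = 1\<close>
  (\<open>le_zero_by_characters\<close>), and on the principal ideal of \<open>m A B\<close> each of them factors as
  \<open>\<omega> (m x y) = \<phi> x * \<psi> y\<close> (\<open>character_factor\<close>), so that elements behave like functions on a product of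
  two spaces.\<close>

section \<open>Banach lattice arithmetic\<close>

lemma sup_scaleR:
  fixes x y :: "'a::banach_lattice"
  assumes "0 \<le> c"
  shows "sup (c *\<^sub>R x) (c *\<^sub>R y) = c *\<^sub>R sup x y"
proof (cases "c = 0")
  case False
  with assms have c: "0 < c" by simp
  have "sup x y \<le> inverse c *\<^sub>R sup (c *\<^sub>R x) (c *\<^sub>R y)"
  proof (rule sup_least)
    have "inverse c *\<^sub>R (c *\<^sub>R x) \<le> inverse c *\<^sub>R sup (c *\<^sub>R x) (c *\<^sub>R y)"
      using c by (intro scaleR_left_mono) auto
    then show "x \<le> inverse c *\<^sub>R sup (c *\<^sub>R x) (c *\<^sub>R y)" using c by simp
    have "inverse c *\<^sub>R (c *\<^sub>R y) \<le> inverse c *\<^sub>R sup (c *\<^sub>R x) (c *\<^sub>R y)"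
      using c by (intro scaleR_left_mono) auto
    then show "y \<le> inverse c *\<^sub>R sup (c *\<^sub>R x) (c *\<^sub>R y)" using c by simp
  qed
  then have "c *\<^sub>R sup x y \<le> c *\<^sub>R (inverse c *\<^sub>R sup (c *\<^sub>R x) (c *\<^sub>R y))"
    using c by (intro scaleR_left_mono) auto
  then have "c *\<^sub>R sup x y \<le> sup (c *\<^sub>R x) (c *\<^sub>R y)" using c by simp
  then show ?thesis
    using c by (intro antisym sup_least scaleR_left_mono) auto
qed simp

lemma abs_scaleR_lattice:
  fixes x :: "'a::banach_lattice"
  shows "\<bar>c *\<^sub>R x\<bar> = \<bar>c\<bar> *\<^sub>R \<bar>x\<bar>"
proof -
  have "\<bar>c *\<^sub>R x\<bar> = \<bar>\<bar>c\<bar> *\<^sub>R x\<bar>" by (cases "0 \<le> c") auto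
  also have "\<dots> = \<bar>c\<bar> *\<^sub>R \<bar>x\<bar>"
    using sup_scaleR[of "\<bar>c\<bar>" x "- x"] by (simp add: abs_lattice[of x] abs_lattice[of "\<bar>c\<bar> *\<^sub>R x"])
  finally show ?thesis .
qed

lemma abs_sup_le:
  fixes x y :: "'a::lattice_ab_group_add_abs"
  shows "\<bar>sup x y\<bar> \<le> \<bar>x\<bar> + \<bar>y\<bar>"
proof (rule abs_leI)
  have "x \<le> \<bar>x\<bar> + \<bar>y\<bar>" "y \<le> \<bar>x\<bar> + \<bar>y\<bar>"
    by (simp_all add: add_increasing add_increasing2 abs_ge_self)
  then show "sup x y \<le> \<bar>x\<bar> + \<bar>y\<bar>" by simp
  have "- sup x y \<le> - x" by simp
  also have "\<dots> \<le> \<bar>x\<bar> + \<bar>y\<bar>" by (simp add: add_increasing2 abs_ge_minus_self)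
  finally show "- sup x y \<le> \<bar>x\<bar> + \<bar>y\<bar>" .
qed

lemma norm_mono_nonneg:
  fixes x y :: "'a::banach_lattice"
  shows "0 \<le> x \<Longrightarrow> x \<le> y \<Longrightarrow> norm x \<le> norm y"
  by (rule norm_mono_abs) (simp add: order_trans[of 0 x y])

lemma norm_abs_lattice [simp]:
  fixes x :: "'a::banach_lattice"
  shows "norm \<bar>x\<bar> = norm x"
  by (intro antisym norm_mono_abs) simp_all

lemma norm_pprt_le:
  fixes x :: "'a::banach_lattice"
  shows "norm (pprt x) \<le> norm x"
proof (rule norm_mono_abs)
  have "pprt x \<le> \<bar>x\<bar>" by (simp add: pprt_def abs_ge_self)
  then show "\<bar>pprt x\<bar> \<le> \<bar>x\<bar>" by simp
qed

text \<open>Banach lattices are Archimedean: the positive part of \<open>z\<close> is dominated in norm by every positive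
  multiple of the norm of \<open>e\<close>.\<close>

lemma archimedean_le_zero:
  fixes z e :: "'a::banach_lattice"
  assumes "\<And>\<epsilon>. 0 < \<epsilon> \<Longrightarrow> z \<le> \<epsilon> *\<^sub>R e"
  shows "z \<le> 0"
proof -
  have "norm (pprt z) \<le> \<epsilon>" if "0 < \<epsilon>" for \<epsilon>
  proof -
    define \<eta> where "\<eta> = \<epsilon> / (norm e + 1)"
    have \<eta>: "0 < \<eta>" using that unfolding \<eta>_def by (simp add: add_nonneg_pos)
    have "norm (pprt z) \<le> norm (pprt (\<eta> *\<^sub>R e))"
      by (rule norm_mono_nonneg) (use assms[OF \<eta>] in auto)
    also have "\<dots> \<le> \<eta> * norm e" using norm_pprt_le[of "\<eta> *\<^sub>R e"] \<eta> by simp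
    also have "\<dots> \<le> \<epsilon>" unfolding \<eta>_def using that by (simp add: pos_divide_le_eq add_nonneg_pos)
    finally show ?thesis .
  qed
  then have "norm (pprt z) \<le> 0" by (rule field_le_epsilon) simp
  then show ?thesis by (simp add: le_zero_iff_zero_pprt)
qed

section \<open>Real characters of a principal ideal\<close>

definition principal_ideal :: "'a::banach_lattice \<Rightarrow> 'a set" where
  "principal_ideal e = {x. \<exists>c. \<bar>x\<bar> \<le> c *\<^sub>R e}"

lemma principal_ideal_solid:
  "y \<in> principal_ideal e \<Longrightarrow> \<bar>x\<bar> \<le> \<bar>y\<bar> \<Longrightarrow> x \<in> principal_ideal e"
  unfolding principal_ideal_def by (auto intro: order_trans)

lemma principal_ideal_zero [simp]: "0 \<in> principal_ideal e"
  unfolding principal_ideal_def by (auto intro!: exI[of _ 0])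

lemma principal_ideal_add [simp]:
  assumes "x \<in> principal_ideal e" "y \<in> principal_ideal e"
  shows "x + y \<in> principal_ideal e"
proof -
  from assms obtain c d where "\<bar>x\<bar> \<le> c *\<^sub>R e" "\<bar>y\<bar> \<le> d *\<^sub>R e"
    unfolding principal_ideal_def by blast
  then have "\<bar>x + y\<bar> \<le> (c + d) *\<^sub>R e"
    unfolding scaleR_add_left by (intro order_trans[OF abs_triangle_ineq] add_mono)
  then show ?thesis unfolding principal_ideal_def by blast
qed

lemma principal_ideal_scaleR [simp]:
  assumes "x \<in> principal_ideal e"
  shows "c *\<^sub>R x \<in> principal_ideal e"
proof -
  from assms obtain d where "\<bar>x\<bar> \<le> d *\<^sub>R e"
    unfolding principal_ideal_def by blast
  then have "\<bar>c *\<^sub>R x\<bar> \<le> (\<bar>c\<bar> * d) *\<^sub>R e"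
    using scaleR_left_mono[of "\<bar>x\<bar>" "d *\<^sub>R e" "\<bar>c\<bar>"] by (simp add: abs_scaleR_lattice)
  then show ?thesis unfolding principal_ideal_def by blast
qed

lemma principal_ideal_abs [simp]: "x \<in> principal_ideal e \<Longrightarrow> \<bar>x\<bar> \<in> principal_ideal e"
  by (auto intro: principal_ideal_solid)

lemma principal_ideal_uminus [simp]: "x \<in> principal_ideal e \<Longrightarrow> - x \<in> principal_ideal e"
  by (auto intro: principal_ideal_solid)

lemma principal_ideal_diff [simp]:
  "x \<in> principal_ideal e \<Longrightarrow> y \<in> principal_ideal e \<Longrightarrow> x - y \<in> principal_ideal e"
  using principal_ideal_add[of x e "- y"] by simp

lemma principal_ideal_sup [simp]:
  assumes "x \<in> principal_ideal e" "y \<in> principal_ideal e"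
  shows "sup x y \<in> principal_ideal e"
proof (rule principal_ideal_solid)
  show "\<bar>x\<bar> + \<bar>y\<bar> \<in> principal_ideal e" using assms by simp
  show "\<bar>sup x y\<bar> \<le> \<bar>\<bar>x\<bar> + \<bar>y\<bar>\<bar>" using abs_sup_le[of x y] by simp
qed

lemma principal_ideal_inf [simp]:
  assumes "x \<in> principal_ideal e" "y \<in> principal_ideal e"
  shows "inf x y \<in> principal_ideal e"
  unfolding inf_eq_neg_sup by (intro principal_ideal_uminus principal_ideal_sup assms)

lemma principal_ideal_pprt [simp]: "x \<in> principal_ideal e \<Longrightarrow> pprt x \<in> principal_ideal e"
  by (simp add: pprt_def)

lemma principal_ideal_sum [simp]:
  "\<forall>i\<in>I. f i \<in> principal_ideal e \<Longrightarrow> sum f I \<in> principal_ideal e"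
  by (induction I rule: infinite_finite_induct) auto

lemma principal_ideal_bounded: "\<bar>x\<bar> \<le> e \<Longrightarrow> x \<in> principal_ideal e"
  unfolding principal_ideal_def by (auto intro!: exI[of _ 1])

lemma principal_ideal_unit [simp]: "0 \<le> e \<Longrightarrow> e \<in> principal_ideal e"
  by (simp add: principal_ideal_bounded)

lemma principal_ideal_bound:
  assumes "x \<in> principal_ideal e" "0 \<le> e"
  obtains c where "0 \<le> c" "\<bar>x\<bar> \<le> c *\<^sub>R e"
proof -
  from assms obtain c where "\<bar>x\<bar> \<le> c *\<^sub>R e" unfolding principal_ideal_def by blast
  also have "\<dots> \<le> \<bar>c\<bar> *\<^sub>R e" using assms by (intro scaleR_right_mono) auto
  finally show thesis using that[of "\<bar>c\<bar>"] by simp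
qed

text \<open>Real lattice homomorphisms arise as the minimal sublinear functionals that turn suprema into maxima.
  The condition on suprema is kept through the usual Hahn--Banach argument, so that no separate step is
  needed to make the linear functional at the end a lattice homomorphism.\<close>

definition max_sublinear :: "'a::banach_lattice set \<Rightarrow> ('a \<Rightarrow> real) \<Rightarrow> bool" where
  "max_sublinear V q \<longleftrightarrow>
     (\<forall>x\<in>V. \<forall>y\<in>V. q (x + y) \<le> q x + q y) \<and>
     (\<forall>c\<ge>0. \<forall>x\<in>V. q (c *\<^sub>R x) = c * q x) \<and>
     (\<forall>x\<in>V. \<forall>y\<in>V. q (sup x y) = max (q x) (q y))"

lemma max_sublinearI:
  assumes "\<And>x y. x \<in> principal_ideal e \<Longrightarrow> y \<in> principal_ideal e \<Longrightarrow> q (x + y) \<le> q x + q y"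
    and "\<And>c x. 0 < c \<Longrightarrow> x \<in> principal_ideal e \<Longrightarrow> q (c *\<^sub>R x) \<le> c * q x"
    and "\<And>x y. x \<in> principal_ideal e \<Longrightarrow> y \<in> principal_ideal e \<Longrightarrow> q (sup x y) = max (q x) (q y)"
    and "q 0 \<le> 0"
  shows "max_sublinear (principal_ideal e) q"
proof -
  have "q (c *\<^sub>R x) = c * q x" if "0 \<le> c" "x \<in> principal_ideal e" for c x
  proof (cases "c = 0")
    case True
    have "q 0 \<le> q 0 + q 0" using assms(1)[of 0 0] by simp
    then show ?thesis using True assms(4) by simp
  next
    case False
    then have c: "0 < c" using that by simp
    have "q (inverse c *\<^sub>R (c *\<^sub>R x)) \<le> inverse c * q (c *\<^sub>R x)"
      by (rule assms(2)) (use c that in auto)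
    then have "c * q x \<le> q (c *\<^sub>R x)" using c by (simp add: field_simps)
    then show ?thesis using assms(2)[OF c that(2)] by simp
  qed
  then show ?thesis using assms(1,3) by (simp add: max_sublinear_def)
qed

locale max_sublinear_functional =
  fixes e :: "'a::banach_lattice" and q :: "'a \<Rightarrow> real"
  assumes max_sublinear: "max_sublinear (principal_ideal e) q"
begin

abbreviation "V \<equiv> principal_ideal e"

lemma subadditive: "x \<in> V \<Longrightarrow> y \<in> V \<Longrightarrow> q (x + y) \<le> q x + q y"
  and homogeneous: "0 \<le> c \<Longrightarrow> x \<in> V \<Longrightarrow> q (c *\<^sub>R x) = c * q x"
  and maxitive: "x \<in> V \<Longrightarrow> y \<in> V \<Longrightarrow> q (sup x y) = max (q x) (q y)"
  using max_sublinear by (auto simp: max_sublinear_def)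

lemma at_zero: "q 0 = 0"
  using homogeneous[of 0 0] by simp

lemma lower_bound: "x \<in> V \<Longrightarrow> - q (- x) \<le> q x"
  using subadditive[of x "- x"] at_zero by simp

text \<open>The Hahn--Banach modification of \<open>q\<close>: the largest sublinear functional \<open>r \<le> q\<close> with \<open>r (- z) \<le> - q z\<close>.\<close>

definition flatten :: "'a \<Rightarrow> 'a \<Rightarrow> real" where
  "flatten z x = (INF s\<in>{0..}. q (x + s *\<^sub>R z) - s * q z)"

context
  fixes z assumes z: "z \<in> V"
begin

lemma flatten_term_bound:
  assumes "x \<in> V" "0 \<le> s"
  shows "- q (- x) \<le> q (x + s *\<^sub>R z) - s * q z"
  using subadditive[of "x + s *\<^sub>R z" "- x"] homogeneous[of s z] assms z by simp

lemma flatten_bdd: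
  assumes "x \<in> V"
  shows "bdd_below ((\<lambda>s. q (x + s *\<^sub>R z) - s * q z) ` {0..})"
  by (rule bdd_belowI[of _ "- q (- x)"]) (use flatten_term_bound[OF assms] in auto)

lemma flatten_le_term:
  assumes "x \<in> V" "0 \<le> s"
  shows "flatten z x \<le> q (x + s *\<^sub>R z) - s * q z"
  unfolding flatten_def by (rule cINF_lower[OF flatten_bdd]) (use assms in auto)

lemma flatten_greatest:
  "(\<And>s. 0 \<le> s \<Longrightarrow> r \<le> q (x + s *\<^sub>R z) - s * q z) \<Longrightarrow> r \<le> flatten z x"
  unfolding flatten_def by (rule cINF_greatest) auto

lemma flatten_approx:
  assumes "x \<in> V" "flatten z x < r"
  obtains s where "0 \<le> s" "q (x + s *\<^sub>R z) - s * q z < r"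
  using flatten_greatest[of r x] assms by (meson not_le)

text \<open>This monotonicity is what lets the infimum in \<open>flatten\<close> commute with maxima: almost optimal parameters
  for two points may both be replaced by the larger one.\<close>

lemma flatten_term_antimono:
  assumes "x \<in> V" "0 \<le> s" "s \<le> \<mu>"
  shows "q (x + \<mu> *\<^sub>R z) - \<mu> * q z \<le> q (x + s *\<^sub>R z) - s * q z"
proof -
  have "x + \<mu> *\<^sub>R z = (x + s *\<^sub>R z) + (\<mu> - s) *\<^sub>R z" by (simp add: algebra_simps)
  then have "q (x + \<mu> *\<^sub>R z) \<le> q (x + s *\<^sub>R z) + (\<mu> - s) * q z"
    using subadditive[of "x + s *\<^sub>R z" "(\<mu> - s) *\<^sub>R z"] homogeneous[of "\<mu> - s" z] assms z
    by (simp only: principal_ideal_add principal_ideal_scaleR diff_ge_0_iff_ge)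
  then show ?thesis by (simp add: algebra_simps)
qed

lemma flatten_le: "x \<in> V \<Longrightarrow> flatten z x \<le> q x"
  using flatten_le_term[of x 0] by simp

lemma flatten_neg: "flatten z (- z) \<le> - q z"
  using flatten_le_term[of "- z" 1] z at_zero by simp

lemma flatten_max_sublinear: "max_sublinear V (flatten z)"
proof (rule max_sublinearI)
  fix x y assume xy: "x \<in> V" "y \<in> V"
  show "flatten z (x + y) \<le> flatten z x + flatten z y"
  proof (rule field_le_epsilon)
    fix \<epsilon> :: real assume \<epsilon>: "0 < \<epsilon>"
    obtain s where l: "0 \<le> s" "q (x + s *\<^sub>R z) - s * q z < flatten z x + \<epsilon>/2"
      using flatten_approx[OF xy(1), of "flatten z x + \<epsilon>/2"] \<epsilon> by auto
    obtain \<mu> where m: "0 \<le> \<mu>" "q (y + \<mu> *\<^sub>R z) - \<mu> * q z < flatten z y + \<epsilon>/2"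
      using flatten_approx[OF xy(2), of "flatten z y + \<epsilon>/2"] \<epsilon> by auto
    have "flatten z (x + y) \<le> q ((x + y) + (s + \<mu>) *\<^sub>R z) - (s + \<mu>) * q z"
      using xy l m by (intro flatten_le_term) auto
    moreover have "q ((x + y) + (s + \<mu>) *\<^sub>R z) \<le> q (x + s *\<^sub>R z) + q (y + \<mu> *\<^sub>R z)"
      using subadditive[of "x + s *\<^sub>R z" "y + \<mu> *\<^sub>R z"] xy z by (simp add: algebra_simps)
    ultimately show "flatten z (x + y) \<le> flatten z x + flatten z y + \<epsilon>"
      using l m by (simp add: algebra_simps)
  qed
  show "flatten z (sup x y) = max (flatten z x) (flatten z y)"
  proof (rule antisym)
    show "flatten z (sup x y) \<le> max (flatten z x) (flatten z y)"
    proof (rule field_le_epsilon)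
      fix \<epsilon> :: real assume \<epsilon>: "0 < \<epsilon>"
      obtain s where l: "0 \<le> s" "q (x + s *\<^sub>R z) - s * q z < flatten z x + \<epsilon>"
        using flatten_approx[OF xy(1), of "flatten z x + \<epsilon>"] \<epsilon> by auto
      obtain \<mu> where m: "0 \<le> \<mu>" "q (y + \<mu> *\<^sub>R z) - \<mu> * q z < flatten z y + \<epsilon>"
        using flatten_approx[OF xy(2), of "flatten z y + \<epsilon>"] \<epsilon> by auto
      define \<nu> where "\<nu> = max s \<mu>"
      have "sup x y + \<nu> *\<^sub>R z = sup (x + \<nu> *\<^sub>R z) (y + \<nu> *\<^sub>R z)"
        by (simp add: add_sup_distrib_right)
      then have "q (sup x y + \<nu> *\<^sub>R z) = max (q (x + \<nu> *\<^sub>R z)) (q (y + \<nu> *\<^sub>R z))"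
        using xy z by (simp add: maxitive)
      moreover have "flatten z (sup x y) \<le> q (sup x y + \<nu> *\<^sub>R z) - \<nu> * q z"
        using xy l by (intro flatten_le_term) (auto simp: \<nu>_def)
      moreover have "q (x + \<nu> *\<^sub>R z) - \<nu> * q z < flatten z x + \<epsilon>"
        using flatten_term_antimono[OF xy(1) l(1), of \<nu>] l by (auto simp: \<nu>_def)
      moreover have "q (y + \<nu> *\<^sub>R z) - \<nu> * q z < flatten z y + \<epsilon>"
        using flatten_term_antimono[OF xy(2) m(1), of \<nu>] m by (auto simp: \<nu>_def)
      ultimately show "flatten z (sup x y) \<le> max (flatten z x) (flatten z y) + \<epsilon>" by linarith
    qed
    have "flatten z w \<le> flatten z (sup x y)" if w: "w \<in> V" "sup w (sup x y) = sup x y" for w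
    proof (rule flatten_greatest)
      fix s :: real assume l: "0 \<le> s"
      have "sup (w + s *\<^sub>R z) (sup x y + s *\<^sub>R z) = sup x y + s *\<^sub>R z"
        using w(2) by (simp only: add_sup_distrib_right[symmetric])
      then have "q (w + s *\<^sub>R z) \<le> q (sup x y + s *\<^sub>R z)"
        using maxitive[of "w + s *\<^sub>R z" "sup x y + s *\<^sub>R z"] w xy z by simp
      then show "flatten z w \<le> q (sup x y + s *\<^sub>R z) - s * q z"
        using flatten_le_term[OF w(1) l] by simp
    qed
    from this[of x] this[of y] show "max (flatten z x) (flatten z y) \<le> flatten z (sup x y)"
      using xy by (simp add: sup.left_commute)
  qed
next
  fix c :: real and x assume c: "0 < c" and x: "x \<in> V"
  have "inverse c * flatten z (c *\<^sub>R x) \<le> flatten z x"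
  proof (rule flatten_greatest)
    fix s :: real assume l: "0 \<le> s"
    have "flatten z (c *\<^sub>R x) \<le> q (c *\<^sub>R x + (c * s) *\<^sub>R z) - (c * s) * q z"
      using c l x by (intro flatten_le_term) auto
    also have "q (c *\<^sub>R x + (c * s) *\<^sub>R z) = c * q (x + s *\<^sub>R z)"
      using homogeneous[of c "x + s *\<^sub>R z"] c x z by (simp add: scaleR_add_right)
    finally show "inverse c * flatten z (c *\<^sub>R x) \<le> q (x + s *\<^sub>R z) - s * q z"
      using c by (simp add: field_simps)
  qed
  then show "flatten z (c *\<^sub>R x) \<le> c * flatten z x"
    using c by (simp add: field_simps)
next
  show "flatten z 0 \<le> 0" using flatten_le[of 0] at_zero by simp
qed

end

end

text \<open>A unital real lattice homomorphism on the principal ideal of \<open>e\<close>. For the lattice of continuous functions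
  on a compact Hausdorff space and \<open>e = 1\<close> these are the point evaluations.\<close>

locale character =
  fixes e :: "'a::banach_lattice" and \<omega> :: "'a \<Rightarrow> real"
  assumes unit: "\<omega> e = 1" and unit_nonneg: "0 \<le> e"
    and add: "x \<in> principal_ideal e \<Longrightarrow> y \<in> principal_ideal e \<Longrightarrow> \<omega> (x + y) = \<omega> x + \<omega> y"
    and scaleR: "x \<in> principal_ideal e \<Longrightarrow> \<omega> (c *\<^sub>R x) = c * \<omega> x"
    and sup: "x \<in> principal_ideal e \<Longrightarrow> y \<in> principal_ideal e \<Longrightarrow> \<omega> (sup x y) = max (\<omega> x) (\<omega> y)"

text \<open>By Zorn's lemma there is a minimal functional below \<open>q\<^sub>0\<close>. It agrees with all its modifications
  \<open>flatten z\<close>, and this makes it odd, which for a sublinear functional amounts to linearity.\<close>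

lemma minimal_max_sublinear:
  assumes q\<^sub>0: "max_sublinear (principal_ideal e) q\<^sub>0"
  obtains q where "max_sublinear (principal_ideal e) q"
    "\<And>x. x \<in> principal_ideal e \<Longrightarrow> q x \<le> q\<^sub>0 x"
    "\<And>x. x \<in> principal_ideal e \<Longrightarrow> q (- x) = - q x"
proof -
  let ?V = "principal_ideal e"
  interpret q0: max_sublinear_functional e q\<^sub>0 by unfold_locales (rule q\<^sub>0)
  \<comment> \<open>Normalising to \<open>0\<close> off the ideal makes the pointwise order antisymmetric.\<close>
  define A where "A = {q. max_sublinear ?V q \<and> (\<forall>x. x \<notin> ?V \<longrightarrow> q x = 0) \<and> (\<forall>x\<in>?V. q x \<le> q\<^sub>0 x)}"
  define below where "below q r \<longleftrightarrow> (\<forall>x. r x \<le> q x)" for q r :: "'a \<Rightarrow> real"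
  have lower: "- q\<^sub>0 (- x) \<le> q x" if "q \<in> A" "x \<in> ?V" for q x
  proof -
    interpret max_sublinear_functional e q using that by unfold_locales (simp add: A_def)
    have "q (- x) \<le> q\<^sub>0 (- x)" using that by (simp add: A_def)
    then show ?thesis using lower_bound[OF that(2)] by simp
  qed
  have restrict: "(\<lambda>x. if x \<in> ?V then q x else 0) \<in> A"
    if "max_sublinear ?V q" "\<And>x. x \<in> ?V \<Longrightarrow> q x \<le> q\<^sub>0 x" for q
    using that unfolding A_def max_sublinear_def by simp
  have "\<exists>m\<in>A. \<forall>a\<in>A. below m a \<longrightarrow> a = m"
  proof (rule predicate_Zorn)
    show "partial_order_on A (relation_of below A)"
      by (rule partial_order_on_relation_ofI) (auto simp: below_def fun_eq_iff intro: order_trans antisym)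
    fix C assume C: "C \<in> Chains (relation_of below A)"
    then have CA: "C \<subseteq> A" by (auto simp: Chains_def relation_of_def)
    have total: "below q r \<or> below r q" if "q \<in> C" "r \<in> C" for q r
      using C that by (auto simp: Chains_def relation_of_def)
    show "\<exists>u\<in>A. \<forall>a\<in>C. below a u"
    proof (cases "C = {}")
      case True
      then show ?thesis using restrict[OF q\<^sub>0] by auto
    next
      case False
      define u where "u x = (INF q\<in>C. q x)" for x
      have bdd: "bdd_below ((\<lambda>q. q x) ` C)" if "x \<in> ?V" for x
        by (rule bdd_belowI[of _ "- q\<^sub>0 (- x)"]) (use CA lower that in auto)
      have u_le: "u x \<le> q x" if "x \<in> ?V" "q \<in> C" for x q
        unfolding u_def by (rule cINF_lower[OF bdd[OF that(1)] that(2)])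
      have u_ge: "r \<le> u x" if "\<And>q. q \<in> C \<Longrightarrow> r \<le> q x" for r x
        unfolding u_def by (rule cINF_greatest[OF False that])
      have approx: "\<exists>q\<in>C. q x < u x + \<epsilon> \<and> q y < u y + \<epsilon>"
        if xy: "x \<in> ?V" "y \<in> ?V" and \<epsilon>: "0 < \<epsilon>" for x y \<epsilon>
      proof -
        have "\<exists>q\<in>C. q x < u x + \<epsilon>" for x
          using u_ge[of "u x + \<epsilon>" x] \<epsilon> by (meson less_add_same_cancel1 not_le)
        then obtain q r where qr: "q \<in> C" "r \<in> C" "q x < u x + \<epsilon>" "r y < u y + \<epsilon>" by meson
        from total[OF qr(1,2)] show ?thesis
        proof
          assume "below q r"
          then have "r x \<le> q x" by (simp add: below_def)
          then show ?thesis using qr by (intro bexI[of _ r]) auto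
        next
          assume "below r q"
          then have "q y \<le> r y" by (simp add: below_def)
          then show ?thesis using qr by (intro bexI[of _ q]) auto
        qed
      qed
      have msf: "max_sublinear_functional e q" if "q \<in> C" for q
        using that CA by unfold_locales (auto simp: A_def)
      have "max_sublinear ?V u"
      proof (rule max_sublinearI)
        fix x y assume xy: "x \<in> ?V" "y \<in> ?V"
        show "u (x + y) \<le> u x + u y"
        proof (rule field_le_epsilon)
          fix \<epsilon> :: real assume "0 < \<epsilon>"
          then obtain q where q: "q \<in> C" "q x < u x + \<epsilon>/2" "q y < u y + \<epsilon>/2"
            using approx[OF xy, of "\<epsilon>/2"] by auto
          have "u (x + y) \<le> q x + q y"
            using u_le[of "x + y" q] max_sublinear_functional.subadditive[OF msf[OF q(1)] xy] xy q
            by simp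
          then show "u (x + y) \<le> u x + u y + \<epsilon>" using q by simp
        qed
        show "u (sup x y) = max (u x) (u y)"
        proof (rule antisym)
          show "u (sup x y) \<le> max (u x) (u y)"
          proof (rule field_le_epsilon)
            fix \<epsilon> :: real assume "0 < \<epsilon>"
            then obtain q where q: "q \<in> C" "q x < u x + \<epsilon>" "q y < u y + \<epsilon>"
              using approx[OF xy, of \<epsilon>] by auto
            have "u (sup x y) \<le> max (q x) (q y)"
              using u_le[of "sup x y" q] max_sublinear_functional.maxitive[OF msf[OF q(1)] xy] xy q
              by simp
            then show "u (sup x y) \<le> max (u x) (u y) + \<epsilon>" using q by simp
          qed
          show "max (u x) (u y) \<le> u (sup x y)"
          proof (rule u_ge)
            fix q assume q: "q \<in> C"
            then show "max (u x) (u y) \<le> q (sup x y)"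
              using u_le[OF xy(1) q] u_le[OF xy(2) q] max_sublinear_functional.maxitive[OF msf[OF q] xy]
              by linarith
          qed
        qed
      next
        fix c :: real and x assume c: "0 < c" and x: "x \<in> ?V"
        have "inverse c * u (c *\<^sub>R x) \<le> u x"
        proof (rule u_ge)
          fix q assume q: "q \<in> C"
          then show "inverse c * u (c *\<^sub>R x) \<le> q x"
            using u_le[of "c *\<^sub>R x" q] max_sublinear_functional.homogeneous[OF msf[OF q], of c x] c x
            by (simp add: field_simps)
        qed
        then show "u (c *\<^sub>R x) \<le> c * u x" using c by (simp add: field_simps)
      next
        from False obtain q where "q \<in> C" by blast
        then show "u 0 \<le> 0"
          using u_le[of 0 q] max_sublinear_functional.at_zero[OF msf, of q] by simp
      qed
      moreover have "u x \<le> q\<^sub>0 x" if "x \<in> ?V" for x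
      proof -
        from False obtain q where "q \<in> C" by blast
        then show ?thesis using u_le[OF that] CA that unfolding A_def by force
      qed
      ultimately have "(\<lambda>x. if x \<in> ?V then u x else 0) \<in> A" by (rule restrict)
      moreover have "below q (\<lambda>x. if x \<in> ?V then u x else 0)" if "q \<in> C" for q
        using u_le that CA by (auto simp: below_def A_def)
      ultimately show ?thesis by blast
    qed
  qed
  then obtain q where q: "q \<in> A" and minimal: "\<And>r. r \<in> A \<Longrightarrow> below q r \<Longrightarrow> r = q" by blast
  interpret max_sublinear_functional e q using q by unfold_locales (simp add: A_def)
  have "q (- z) = - q z" if z: "z \<in> ?V" for z
  proof -
    have "(\<lambda>x. if x \<in> ?V then flatten z x else 0) \<in> A"
    proof (rule restrict[OF flatten_max_sublinear[OF z]])
      fix x assume x: "x \<in> ?V"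
      then have "q x \<le> q\<^sub>0 x" using q by (simp add: A_def)
      with flatten_le[OF z x] show "flatten z x \<le> q\<^sub>0 x" by simp
    qed
    moreover have "below q (\<lambda>x. if x \<in> ?V then flatten z x else 0)"
      using flatten_le[OF z] q by (simp add: below_def A_def)
    ultimately have "(\<lambda>x. if x \<in> ?V then flatten z x else 0) = q" by (rule minimal)
    from fun_cong[OF this, of "- z"] have "q (- z) \<le> - q z"
      using flatten_neg[OF z] z by simp
    with lower_bound[OF z] show ?thesis by simp
  qed
  with that show thesis using q by (auto simp: A_def)
qed

text \<open>The gauge \<open>p x = Inf {s. x \<le> s *\<^sub>R e}\<close> is the functional to start from, and it is flattened at \<open>w\<close> first:
  every linear functional below \<open>p.flatten w\<close> takes at \<open>w\<close> the value \<open>p w\<close>, which is positive because \<open>w\<close> is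
  not below zero.\<close>

lemma character_positive_exists:
  assumes e: "0 \<le> e" and w: "w \<in> principal_ideal e" and "\<not> w \<le> 0"
  obtains \<omega> where "character e \<omega>" "0 < \<omega> w"
proof -
  let ?V = "principal_ideal e"
  have "e \<noteq> 0" using w \<open>\<not> w \<le> 0\<close> by (auto simp: principal_ideal_def)
  have scale_cancel: "s \<le> r" if "s *\<^sub>R e \<le> r *\<^sub>R e" for s r
  proof (rule ccontr)
    assume "\<not> s \<le> r"
    then have "0 < s - r" by simp
    have "(s - r) *\<^sub>R e \<le> 0" using that by (simp add: scaleR_left_diff_distrib)
    then have "inverse (s - r) *\<^sub>R ((s - r) *\<^sub>R e) \<le> inverse (s - r) *\<^sub>R 0"
      using \<open>0 < s - r\<close> by (intro scaleR_left_mono) auto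
    then have "e \<le> 0" using \<open>0 < s - r\<close> by simp
    with e \<open>e \<noteq> 0\<close> show False by simp
  qed
  define p where "p x = Inf {s. x \<le> s *\<^sub>R e}" for x
  have p_attained: "x \<le> p x *\<^sub>R e" and p_le: "x \<le> s *\<^sub>R e \<Longrightarrow> p x \<le> s" if x: "x \<in> ?V" for x s
  proof -
    obtain c where c: "0 \<le> c" "\<bar>x\<bar> \<le> c *\<^sub>R e" using principal_ideal_bound[OF x e] .
    have ne: "{s. x \<le> s *\<^sub>R e} \<noteq> {}" using c(2) abs_le_D1 by blast
    have bdd: "bdd_below {s. x \<le> s *\<^sub>R e}"
    proof (rule bdd_belowI)
      fix s assume "s \<in> {s. x \<le> s *\<^sub>R e}"
      moreover have "- (c *\<^sub>R e) \<le> x" using abs_le_D2[OF c(2)] by (simp add: minus_le_iff)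
      ultimately have "(- c) *\<^sub>R e \<le> s *\<^sub>R e" by simp
      then show "- c \<le> s" by (rule scale_cancel)
    qed
    show "p x \<le> s" if "x \<le> s *\<^sub>R e"
      unfolding p_def by (rule cInf_lower) (use that bdd in auto)
    have "x - p x *\<^sub>R e \<le> \<epsilon> *\<^sub>R e" if "0 < \<epsilon>" for \<epsilon>
    proof -
      obtain s where s: "x \<le> s *\<^sub>R e" "s < p x + \<epsilon>"
        using cInf_lessD[OF ne, of "p x + \<epsilon>"] \<open>0 < \<epsilon>\<close> by (auto simp: p_def)
      have "x \<le> (p x + \<epsilon>) *\<^sub>R e"
        using s e by (intro order_trans[OF s(1)] scaleR_right_mono) auto
      then show ?thesis by (simp add: algebra_simps)
    qed
    from archimedean_le_zero[OF this] show "x \<le> p x *\<^sub>R e" by simp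
  qed
  have p_max_sublinear: "max_sublinear ?V p"
  proof (rule max_sublinearI)
    fix x y assume xy: "x \<in> ?V" "y \<in> ?V"
    have "x + y \<le> (p x + p y) *\<^sub>R e"
      unfolding scaleR_add_left by (intro add_mono p_attained xy)
    then show "p (x + y) \<le> p x + p y" using xy by (intro p_le) auto
    have "sup x y \<le> max (p x) (p y) *\<^sub>R e"
    proof (rule sup_least)
      show "x \<le> max (p x) (p y) *\<^sub>R e" "y \<le> max (p x) (p y) *\<^sub>R e"
        using e xy by (auto intro!: order_trans[OF p_attained] scaleR_right_mono)
    qed
    then have "p (sup x y) \<le> max (p x) (p y)" using xy by (intro p_le) auto
    moreover have "p x \<le> p (sup x y)" "p y \<le> p (sup x y)"
      using xy by (auto intro!: p_le order_trans[OF _ p_attained])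
    ultimately show "p (sup x y) = max (p x) (p y)" by linarith
  next
    fix c :: real and x assume "0 < c" "x \<in> ?V"
    then have "c *\<^sub>R x \<le> c *\<^sub>R (p x *\<^sub>R e)" by (intro scaleR_left_mono p_attained) auto
    then show "p (c *\<^sub>R x) \<le> c * p x" using \<open>x \<in> ?V\<close> by (intro p_le) auto
  next
    show "p 0 \<le> 0" by (rule p_le) auto
  qed
  interpret p: max_sublinear_functional e p by unfold_locales (rule p_max_sublinear)
  obtain q where q: "max_sublinear ?V q" "\<And>x. x \<in> ?V \<Longrightarrow> q x \<le> p.flatten w x"
    "\<And>x. x \<in> ?V \<Longrightarrow> q (- x) = - q x"
    using minimal_max_sublinear[OF p.flatten_max_sublinear[OF w]] by blast
  interpret q: max_sublinear_functional e q by unfold_locales (rule q)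
  have q_le: "q x \<le> p x" if "x \<in> ?V" for x
    using q(2)[OF that] p.flatten_le[OF w that] by simp
  show thesis
  proof
    show "character e q"
    proof
      show "0 \<le> e" by (rule e)
      have "q e \<le> 1" "q (- e) \<le> -1"
        using e by (auto intro!: order_trans[OF q_le] p_le)
      then show "q e = 1" using q(3)[of e] e by simp
      fix x y assume xy: "x \<in> ?V" "y \<in> ?V"
      have "q (- x + - y) \<le> q (- x) + q (- y)" using xy by (intro q.subadditive) auto
      then have "- q (x + y) \<le> - q x - q y" using q(3)[of "x + y"] q(3)[of x] q(3)[of y] xy by simp
      then show "q (x + y) = q x + q y" using q.subadditive[OF xy] by simp
      show "q (sup x y) = max (q x) (q y)" by (rule q.maxitive[OF xy])
    next
      fix x c assume x: "x \<in> ?V"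
      show "q (c *\<^sub>R x) = c * q x"
        using q.homogeneous[of c x] q.homogeneous[of "- c" x] q(3)[of "c *\<^sub>R x"] x
        by (cases "0 \<le> c") auto
    qed
    have "0 < p w"
    proof (rule ccontr)
      assume "\<not> 0 < p w"
      then have "p w *\<^sub>R e \<le> 0 *\<^sub>R e" using e by (intro scaleR_right_mono) auto
      with p_attained[OF w] \<open>\<not> w \<le> 0\<close> show False by simp
    qed
    moreover have "q (- w) \<le> - p w" using q(2)[of "- w"] p.flatten_neg[OF w] w by simp
    ultimately show "0 < q w" using q(3)[OF w] by simp
  qed
qed

context character
begin

lemma zero: "\<omega> 0 = 0"
  using scaleR[of 0 0] by simp

lemma uminus: "x \<in> principal_ideal e \<Longrightarrow> \<omega> (- x) = - \<omega> x"
  using scaleR[of x "-1"] by simp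

lemma diff: "x \<in> principal_ideal e \<Longrightarrow> y \<in> principal_ideal e \<Longrightarrow> \<omega> (x - y) = \<omega> x - \<omega> y"
  using add[of x "- y"] uminus[of y] by simp

lemma inf: "x \<in> principal_ideal e \<Longrightarrow> y \<in> principal_ideal e \<Longrightarrow> \<omega> (inf x y) = min (\<omega> x) (\<omega> y)"
  by (simp only: inf_eq_neg_sup uminus sup principal_ideal_uminus principal_ideal_sup)

lemma abs: "x \<in> principal_ideal e \<Longrightarrow> \<omega> \<bar>x\<bar> = \<bar>\<omega> x\<bar>"
  unfolding abs_lattice[of x] by (simp add: uminus sup max_def abs_real_def)

lemma pprt: "x \<in> principal_ideal e \<Longrightarrow> \<omega> (pprt x) = max (\<omega> x) 0"
  by (simp add: pprt_def sup zero)

lemma sum: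
  "\<forall>i\<in>I. f i \<in> principal_ideal e \<Longrightarrow> \<omega> (sum f I) = (\<Sum>i\<in>I. \<omega> (f i))"
  by (induction I rule: infinite_finite_induct) (auto simp: zero add)

lemma mono:
  assumes "x \<in> principal_ideal e" "y \<in> principal_ideal e" "x \<le> y"
  shows "\<omega> x \<le> \<omega> y"
  using sup[OF assms(1,2)] assms(3) by (simp add: sup_absorb2)

lemma unit_ideal: "e \<in> principal_ideal e"
  using unit_nonneg by simp

lemma nonneg: "x \<in> principal_ideal e \<Longrightarrow> 0 \<le> x \<Longrightarrow> 0 \<le> \<omega> x"
  using mono[of 0 x] zero by simp

lemma le_one: "x \<in> principal_ideal e \<Longrightarrow> x \<le> e \<Longrightarrow> \<omega> x \<le> 1"
  using mono[of x e] unit unit_ideal by simp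

lemma abs_le_one: "\<bar>x\<bar> \<le> e \<Longrightarrow> \<bar>\<omega> x\<bar> \<le> 1"
  using le_one[of "\<bar>x\<bar>"] abs[of x] principal_ideal_bounded[of x e] by simp

end

lemma le_zero_by_characters:
  assumes "0 \<le> e" "z \<in> principal_ideal e" "\<And>\<omega>. character e \<omega> \<Longrightarrow> \<omega> z \<le> 0"
  shows "z \<le> 0"
proof (rule ccontr)
  assume "\<not> z \<le> 0"
  with assms(1,2) obtain \<omega> where "character e \<omega>" "0 < \<omega> z" by (rule character_positive_exists)
  with assms(3)[of \<omega>] show False by simp
qed

section \<open>Lattice bimorphisms\<close>

text \<open>The norm bound is asked only of positive elements, where it can be read off from the positive projective
  norm; \<open>norm_le\<close> extends it.\<close>

locale bimorphism =
  fixes m :: "'e::banach_lattice \<Rightarrow> 'f::banach_lattice \<Rightarrow> 'z::banach_lattice"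
  assumes add_left: "m (x + x') y = m x y + m x' y"
    and add_right: "m x (y + y') = m x y + m x y'"
    and scale_left: "m (c *\<^sub>R x) y = c *\<^sub>R m x y"
    and scale_right: "m x (c *\<^sub>R y) = c *\<^sub>R m x y"
    and sup_left: "0 \<le> y \<Longrightarrow> m (sup x x') y = sup (m x y) (m x' y)"
    and sup_right: "0 \<le> x \<Longrightarrow> m x (sup y y') = sup (m x y) (m x y')"
    and norm_nonneg_le: "0 \<le> x \<Longrightarrow> 0 \<le> y \<Longrightarrow> norm (m x y) \<le> norm x * norm y"
begin

lemma zero_left [simp]: "m 0 y = 0"
  using scale_left[of 0 0 y] by simp

lemma minus_left: "m (- x) y = - m x y"
  using scale_left[of "-1" x y] by simp

lemma minus_right: "m x (- y) = - m x y"
  using scale_right[of x "-1" y] by simp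

lemma diff_left: "m (x - x') y = m x y - m x' y"
  using add_left[of x "- x'" y] by (simp add: minus_left)

lemma diff_right: "m x (y - y') = m x y - m x y'"
  using add_right[of x y "- y'"] by (simp add: minus_right)

lemma nonneg: "0 \<le> x \<Longrightarrow> 0 \<le> y \<Longrightarrow> 0 \<le> m x y"
  using sup_left[of y x 0] by (simp add: sup_absorb1 le_iff_sup sup_commute)

lemma mono_left:
  assumes "x \<le> x'" "0 \<le> y"
  shows "m x y \<le> m x' y"
  using nonneg[of "x' - x" y] assms by (simp add: diff_left)

lemma mono_right:
  assumes "0 \<le> x" "y \<le> y'"
  shows "m x y \<le> m x y'"
  using nonneg[of x "y' - y"] assms by (simp add: diff_right)

lemma mono: "x \<le> x' \<Longrightarrow> y \<le> y' \<Longrightarrow> 0 \<le> y \<Longrightarrow> 0 \<le> x' \<Longrightarrow> m x y \<le> m x' y'"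
  by (rule order_trans[OF mono_left mono_right])

lemma abs_left: "0 \<le> y \<Longrightarrow> \<bar>m x y\<bar> = m \<bar>x\<bar> y"
  using sup_left[of y x "- x"] by (simp add: abs_lattice minus_left)

lemma abs_le: "\<bar>m x y\<bar> \<le> m \<bar>x\<bar> \<bar>y\<bar>"
proof -
  have "m x y = m x (pprt y) - m x (- nprt y)"
    using prts[of y] by (metis add_right diff_minus_eq_add minus_right minus_minus)
  then have "\<bar>m x y\<bar> \<le> m \<bar>x\<bar> (pprt y) + m \<bar>x\<bar> (- nprt y)"
    using abs_triangle_ineq4[of "m x (pprt y)" "m x (- nprt y)"] by (simp add: abs_left)
  also have "\<dots> = m \<bar>x\<bar> \<bar>y\<bar>"
    by (simp add: abs_prts[of y] add_right[symmetric])
  finally show ?thesis .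
qed

lemma norm_le: "norm (m x y) \<le> norm x * norm y"
proof -
  have "norm (m x y) \<le> norm (m \<bar>x\<bar> \<bar>y\<bar>)"
    by (rule norm_mono_abs) (simp add: abs_le nonneg)
  also have "\<dots> \<le> norm x * norm y"
    using norm_nonneg_le[of "\<bar>x\<bar>" "\<bar>y\<bar>"] by simp
  finally show ?thesis .
qed

lemma bounded_bilinear: "bounded_bilinear m"
  by standard (auto simp: add_left add_right scale_left scale_right intro!: exI[of _ 1] norm_le)

lemma principal_ideal_product:
  assumes "x \<in> principal_ideal A" "y \<in> principal_ideal B" "0 \<le> A" "0 \<le> B"
  shows "m x y \<in> principal_ideal (m A B)"
proof -
  obtain c where c: "0 \<le> c" "\<bar>x\<bar> \<le> c *\<^sub>R A" using principal_ideal_bound[OF assms(1,3)] .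
  obtain d where d: "0 \<le> d" "\<bar>y\<bar> \<le> d *\<^sub>R B" using principal_ideal_bound[OF assms(2,4)] .
  have "\<bar>m x y\<bar> \<le> m \<bar>x\<bar> \<bar>y\<bar>" by (rule abs_le)
  also have "\<dots> \<le> m (c *\<^sub>R A) (d *\<^sub>R B)"
    using c d assms by (intro mono) (auto simp: scaleR_nonneg_nonneg)
  also have "\<dots> = (c * d) *\<^sub>R m A B" by (simp add: scale_left scale_right)
  finally show ?thesis unfolding principal_ideal_def by blast
qed

text \<open>A character of the principal ideal of \<open>m A B\<close> is multiplicative on tensors. For fixed \<open>y\<close> the functional
  \<open>\<lambda>x. \<omega> (m x y)\<close> is dominated by a multiple of the character \<open>\<lambda>x. \<omega> (m x B)\<close> and therefore is a
  multiple of it.\<close>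

lemma character_factor:
  assumes "0 \<le> A" "0 \<le> B" "character (m A B) \<omega>"
  obtains \<phi> \<psi> where "character A \<phi>" "character B \<psi>"
    "\<And>x y. x \<in> principal_ideal A \<Longrightarrow> y \<in> principal_ideal B \<Longrightarrow> \<omega> (m x y) = \<phi> x * \<psi> y"
proof
  interpret \<omega>: character "m A B" \<omega> by fact
  note ideal = principal_ideal_product[OF _ _ assms(1,2)]
  have unit: "A \<in> principal_ideal A" "B \<in> principal_ideal B" using assms by auto
  show \<phi>: "character A (\<lambda>x. \<omega> (m x B))"
    using assms unit
    by unfold_locales (auto simp: add_left scale_left sup_left \<omega>.unit \<omega>.add \<omega>.scaleR \<omega>.sup ideal)
  show "character B (\<lambda>y. \<omega> (m A y))"
    using assms unit
    by unfold_locales (auto simp: add_right scale_right sup_right \<omega>.unit \<omega>.add \<omega>.scaleR \<omega>.sup ideal)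
  interpret \<phi>: character A "\<lambda>x. \<omega> (m x B)" by (rule \<phi>)
  fix x y assume x: "x \<in> principal_ideal A" and y: "y \<in> principal_ideal B"
  \<comment> \<open>The kernel of a character is solid, so \<open>x\<close> may be replaced by the multiple of the unit on which
    \<open>m _ B\<close> takes the same value.\<close>
  define z where "z = x - \<omega> (m x B) *\<^sub>R A"
  have z: "z \<in> principal_ideal A" using x unit by (simp add: z_def)
  have "\<omega> (m z B) = 0"
    unfolding z_def using x unit by (simp add: \<phi>.diff \<phi>.scaleR \<phi>.unit)
  then have z0: "\<omega> (m \<bar>z\<bar> B) = 0" using \<phi>.abs[OF z] by simp
  obtain c where c: "0 \<le> c" "\<bar>y\<bar> \<le> c *\<^sub>R B" using principal_ideal_bound[OF y assms(2)] .
  have "\<bar>m z y\<bar> \<le> m \<bar>z\<bar> (c *\<^sub>R B)"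
    using c by (intro order_trans[OF abs_le] mono_right) auto
  then have "\<omega> \<bar>m z y\<bar> \<le> \<omega> (c *\<^sub>R m \<bar>z\<bar> B)"
    using z y unit by (intro \<omega>.mono) (auto simp: ideal scale_right)
  then have "\<omega> (m z y) = 0"
    using z0 z y unit by (simp add: \<omega>.abs \<omega>.scaleR ideal)
  then show "\<omega> (m x y) = \<omega> (m x B) * \<omega> (m A y)"
    unfolding z_def using x y unit
    by (simp add: diff_left scale_left \<omega>.diff \<omega>.scaleR ideal)
qed

text \<open>The test used below: an inequality between tensor expressions holds as soon as it holds for products
  of real numbers.\<close>

lemma le_zero_by_product_characters:
  assumes "0 \<le> A" "0 \<le> B" "z \<in> principal_ideal (m A B)"
    and "\<And>\<omega> \<phi> \<psi>. character (m A B) \<omega> \<Longrightarrow> character A \<phi> \<Longrightarrow> character B \<psi> \<Longrightarrow>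
      (\<And>x y. x \<in> principal_ideal A \<Longrightarrow> y \<in> principal_ideal B \<Longrightarrow> \<omega> (m x y) = \<phi> x * \<psi> y) \<Longrightarrow> \<omega> z \<le> 0"
  shows "z \<le> 0"
  by (rule le_zero_by_characters[OF nonneg[OF assms(1,2)] assms(3)])
    (metis character_factor[OF assms(1,2)] assms(4))

end

section \<open>Approximation by positive tensors\<close>

lemma nonneg_member_le_sum:
  fixes f :: "'b \<Rightarrow> 'a::ordered_ab_group_add"
  assumes "finite I" "i \<in> I" "\<And>k. k \<in> I \<Longrightarrow> 0 \<le> f k"
  shows "f i \<le> sum f I"
  using sum_mono2[of I "{i}" f] assms by simp

lemma finite_net_of_cube:
  fixes \<delta> :: real and n :: nat
  assumes "0 < \<delta>"
  obtains N where "finite N"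
    "\<And>x. (\<And>i. i < n \<Longrightarrow> \<bar>x i\<bar> \<le> 1) \<Longrightarrow> \<exists>\<alpha>\<in>N. (\<Sum>i<n. \<bar>x i - \<alpha> i\<bar>) \<le> \<delta>"
proof
  define \<eta> where "\<eta> = \<delta> / (real n + 1)"
  have \<eta>: "0 < \<eta>" using assms by (simp add: \<eta>_def)
  define S where "S = (\<lambda>k::int. of_int k * \<eta>) ` {\<lfloor>- 1 / \<eta>\<rfloor>..\<lfloor>1 / \<eta>\<rfloor>}"
  have net: "\<exists>s\<in>S. \<bar>x - s\<bar> \<le> \<eta>" if "\<bar>x\<bar> \<le> 1" for x
  proof -
    have "- 1 / \<eta> \<le> x / \<eta>" "x / \<eta> \<le> 1 / \<eta>"
      using that \<eta> by (intro divide_right_mono; simp add: abs_le_iff)+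
    then have "\<lfloor>x / \<eta>\<rfloor> \<in> {\<lfloor>- 1 / \<eta>\<rfloor>..\<lfloor>1 / \<eta>\<rfloor>}"
      by (auto intro: floor_mono)
    moreover have "\<bar>x - of_int \<lfloor>x / \<eta>\<rfloor> * \<eta>\<bar> \<le> \<eta>"
    proof -
      define k :: real where "k = of_int \<lfloor>x / \<eta>\<rfloor>"
      have "k \<le> x / \<eta>" "x / \<eta> \<le> k + 1" unfolding k_def by linarith+
      then have "k * \<eta> \<le> x" "x \<le> k * \<eta> + \<eta>"
        using \<eta> by (auto simp: pos_le_divide_eq pos_divide_le_eq distrib_right)
      then show ?thesis unfolding k_def by linarith
    qed
    ultimately show ?thesis unfolding S_def by blast
  qed
  show "finite (PiE {..<n} (\<lambda>_. S))" by (intro finite_PiE) (auto simp: S_def)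
  fix x :: "nat \<Rightarrow> real" assume x: "\<And>i. i < n \<Longrightarrow> \<bar>x i\<bar> \<le> 1"
  then have "\<forall>i\<in>{..<n}. \<exists>s. s \<in> S \<and> \<bar>x i - s\<bar> \<le> \<eta>" using net by blast
  then obtain s where s: "\<And>i. i < n \<Longrightarrow> s i \<in> S \<and> \<bar>x i - s i\<bar> \<le> \<eta>"
    by (auto dest!: bchoice)
  have "(\<Sum>i<n. \<bar>x i - restrict s {..<n} i\<bar>) \<le> (\<Sum>i<n. \<eta>)"
    using s by (intro sum_mono) auto
  also have "\<dots> \<le> \<delta>" using assms by (simp add: \<eta>_def field_simps)
  finally show "\<exists>\<alpha>\<in>PiE {..<n} (\<lambda>_. S). (\<Sum>i<n. \<bar>x i - \<alpha> i\<bar>) \<le> \<delta>"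
    using s by (intro bexI[of _ "restrict s {..<n}"]) auto
qed

text \<open>A weighted average of \<open>max (C k) 0\<close> is close to \<open>max U 0\<close> if \<open>C k\<close> is close to \<open>U\<close> for those \<open>k\<close> that
  carry weight.\<close>

lemma weighted_positive_parts:
  fixes H C :: "nat \<Rightarrow> real"
  assumes "\<And>k. k < N \<Longrightarrow> 0 \<le> H k" "(\<Sum>k<N. H k) = 1"
    and "\<And>k. k < N \<Longrightarrow> 0 < H k \<Longrightarrow> \<bar>U - C k\<bar> \<le> \<delta>"
  shows "\<bar>max U 0 - (\<Sum>k<N. H k * max (C k) 0)\<bar> \<le> \<delta>"
proof -
  have "max U 0 - (\<Sum>k<N. H k * max (C k) 0) = (\<Sum>k<N. H k * (max U 0 - max (C k) 0))"
    using assms(2) by (simp add: right_diff_distrib sum_subtractf sum_distrib_right[symmetric])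
  also have "\<bar>\<dots>\<bar> \<le> (\<Sum>k<N. \<bar>H k * (max U 0 - max (C k) 0)\<bar>)" by (rule sum_abs)
  also have "\<dots> \<le> (\<Sum>k<N. H k * \<delta>)"
  proof (rule sum_mono)
    fix k assume k: "k \<in> {..<N}"
    show "\<bar>H k * (max U 0 - max (C k) 0)\<bar> \<le> H k * \<delta>"
    proof (cases "H k = 0")
      case False
      then have "0 < H k" using assms(1)[of k] k by simp
      moreover have "\<bar>max U 0 - max (C k) 0\<bar> \<le> \<bar>U - C k\<bar>" by linarith
      ultimately show ?thesis using assms(3)[of k] k by (simp add: abs_mult)
    qed simp
  qed
  also have "\<dots> = \<delta>" using assms(2) by (simp add: sum_distrib_right[symmetric])
  finally show ?thesis .
qed

context bimorphism
begin

text \<open>Think of \<open>u = \<Sum>i<n. m (a i) (b i)\<close> as the function \<open>(\<Sum>i<n. a i(s) * b i(t))\<close> of two variables. The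
  lattice \<open>'e\<close> contains partitions \<open>h\<close> of the unit \<open>A\<close> such that on the support of \<open>h k\<close> all \<open>a i\<close> are nearly
  constant multiples \<open>\<alpha> k i\<close> of \<open>A\<close>. There \<open>u\<close> is nearly \<open>A\<close> times \<open>\<Sum>i<n. \<alpha> k i *\<^sub>R b i\<close>, and so its
  positive part is nearly \<open>A\<close> times the positive part \<open>c k\<close> of that sum.\<close>

lemma positive_part_approximation:
  fixes a :: "nat \<Rightarrow> 'e" and b :: "nat \<Rightarrow> 'f" and n :: nat
  assumes "0 < \<delta>"
  defines "A \<equiv> \<Sum>i<n. \<bar>a i\<bar>" and "B \<equiv> \<Sum>i<n. \<bar>b i\<bar>"
  obtains N and h :: "nat \<Rightarrow> 'e" and c :: "nat \<Rightarrow> 'f"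
  where "\<And>k. 0 \<le> h k" "\<And>k. 0 \<le> c k"
    "\<bar>pprt (\<Sum>i<n. m (a i) (b i)) - (\<Sum>k<N. m (h k) (c k))\<bar> \<le> \<delta> *\<^sub>R m A B"
proof -
  have A: "\<bar>a i\<bar> \<le> A" and B: "\<bar>b i\<bar> \<le> B" if "i < n" for i
    unfolding A_def B_def using that by (auto intro: nonneg_member_le_sum)
  have A0: "0 \<le> A" and B0: "0 \<le> B" by (auto simp: A_def B_def sum_nonneg)
  obtain net where net: "finite net"
    "\<And>x. (\<And>i. i < n \<Longrightarrow> \<bar>x i\<bar> \<le> 1) \<Longrightarrow> \<exists>\<alpha>\<in>net. (\<Sum>i<n. \<bar>x i - \<alpha> i\<bar>) \<le> \<delta> / 2"
    using finite_net_of_cube[of "\<delta> / 2" n] assms(1) by auto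
  obtain N and \<alpha> :: "nat \<Rightarrow> nat \<Rightarrow> real" where \<alpha>: "net = \<alpha> ` {..<N}"
    using finite_imp_nat_seg_image_inj_on[OF net(1)] by (auto simp: lessThan_def)
  \<comment> \<open>\<open>g k\<close> equals \<open>A\<close> where \<open>r k \<le> (\<delta> / 2) A\<close>, and vanishes unless \<open>r k < \<delta> A\<close>. The differences
    of the successive suprema \<open>S k\<close> form a partition of unity subordinate to the \<open>g k\<close>; unlike
    products or quotients they exist in every vector lattice.\<close>
  define r where "r k = (\<Sum>i<n. \<bar>a i - \<alpha> k i *\<^sub>R A\<bar>)" for k
  define g where "g k = inf A (pprt (2 *\<^sub>R A - (2 / \<delta>) *\<^sub>R r k))" for k
  define S where "S = rec_nat 0 (\<lambda>k s. sup s (g k))"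
  have S: "S 0 = 0" "S (Suc k) = sup (S k) (g k)" for k by (simp_all add: S_def)
  define h where "h k = S (Suc k) - S k" for k
  define c where "c k = pprt (\<Sum>i<n. \<alpha> k i *\<^sub>R b i)" for k
  have h: "0 \<le> h k" for k by (simp add: h_def S)
  have c: "0 \<le> c k" for k by (simp add: c_def)
  note ideal = principal_ideal_product[OF _ _ A0 B0]
  note closed = principal_ideal_sum[rule_format] principal_ideal_diff principal_ideal_scaleR principal_ideal_abs
    principal_ideal_pprt principal_ideal_inf principal_ideal_unit ideal
  have aI: "a i \<in> principal_ideal A" and bI: "b i \<in> principal_ideal B" if "i < n" for i
    using A[OF that] B[OF that] by (auto intro: principal_ideal_bounded)
  have rI: "r k \<in> principal_ideal A" for k
    unfolding r_def using A0 by (intro closed aI) auto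
  have gI: "g k \<in> principal_ideal A" for k using rI A0 by (simp add: g_def)
  have SI: "S k \<in> principal_ideal A" for k by (induction k) (auto simp: S gI)
  have S_nonneg: "0 \<le> S k" for k by (induction k) (auto simp: S intro: le_supI1)
  have hI: "h k \<in> principal_ideal A" for k using SI by (simp add: h_def)
  have cI: "c k \<in> principal_ideal B" for k using bI by (simp add: c_def)
  have "\<bar>pprt (\<Sum>i<n. m (a i) (b i)) - (\<Sum>k<N. m (h k) (c k))\<bar> - \<delta> *\<^sub>R m A B \<le> 0"
  proof (rule le_zero_by_product_characters[OF A0 B0])
    show "\<bar>pprt (\<Sum>i<n. m (a i) (b i)) - (\<Sum>k<N. m (h k) (c k))\<bar> - \<delta> *\<^sub>R m A B \<in> principal_ideal (m A B)"
      using A0 B0 by (intro closed aI bI hI cI nonneg) auto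
    fix \<omega> \<phi> \<psi>
    assume "character (m A B) \<omega>" "character A \<phi>" "character B \<psi>"
      and factor: "\<And>x y. x \<in> principal_ideal A \<Longrightarrow> y \<in> principal_ideal B \<Longrightarrow> \<omega> (m x y) = \<phi> x * \<psi> y"
    interpret \<omega>: character "m A B" \<omega> by fact
    interpret \<phi>: character A \<phi> by fact
    interpret \<psi>: character B \<psi> by fact
    have \<phi>a: "\<bar>\<phi> (a i)\<bar> \<le> 1" and \<psi>b: "\<bar>\<psi> (b i)\<bar> \<le> 1" if "i < n" for i
      using A[OF that] B[OF that] by (simp_all add: \<phi>.abs_le_one \<psi>.abs_le_one)
    have \<phi>r: "\<phi> (r k) = (\<Sum>i<n. \<bar>\<phi> (a i) - \<alpha> k i\<bar>)" for k
      using aI \<phi>.unit_ideal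
      by (simp add: r_def \<phi>.sum \<phi>.abs \<phi>.diff \<phi>.scaleR \<phi>.unit)
    have \<phi>g: "\<phi> (g k) = min 1 (max (2 - 2 / \<delta> * \<phi> (r k)) 0)" for k
      using rI \<phi>.unit_ideal
      by (simp add: g_def \<phi>.inf \<phi>.pprt \<phi>.diff \<phi>.scaleR \<phi>.unit)
    have \<phi>S: "\<phi> (S (Suc k)) = max (\<phi> (S k)) (\<phi> (g k))" for k
      using SI gI by (simp add: S \<phi>.sup)
    have \<phi>h: "\<phi> (h k) = \<phi> (S (Suc k)) - \<phi> (S k)" for k
      using SI by (simp add: h_def \<phi>.diff)
    have S_le: "\<phi> (S k) \<le> 1" for k
      by (induction k) (auto simp: S(1) \<phi>.zero \<phi>S \<phi>g)
    have g_le_S: "\<phi> (g l) \<le> \<phi> (S k)" if "l < k" for l k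
      using that by (induction k) (auto simp: \<phi>S less_Suc_eq)
    have "\<phi> (S N) = 1"
    proof -
      obtain \<beta> where "\<beta> \<in> net" and \<beta>: "(\<Sum>i<n. \<bar>\<phi> (a i) - \<beta> i\<bar>) \<le> \<delta> / 2"
        using net(2)[of "\<lambda>i. \<phi> (a i)"] \<phi>a by blast
      then obtain l where "l < N" "\<beta> = \<alpha> l" using \<alpha> by auto
      with \<beta> have "\<phi> (r l) \<le> \<delta> / 2" by (simp add: \<phi>r)
      then have "2 / \<delta> * \<phi> (r l) \<le> 1" using assms(1) by (simp add: field_simps)
      then have "\<phi> (g l) = 1" by (simp add: \<phi>g)
      with g_le_S[OF \<open>l < N\<close>] S_le[of N] show ?thesis by simp
    qed
    then have sum_h: "(\<Sum>k<N. \<phi> (h k)) = 1"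
      unfolding \<phi>h sum_lessThan_telescope[of "\<lambda>k. \<phi> (S k)" N] by (simp only: S(1) \<phi>.zero)
    have "\<bar>max (\<Sum>i<n. \<phi> (a i) * \<psi> (b i)) 0
        - (\<Sum>k<N. \<phi> (h k) * max (\<Sum>i<n. \<alpha> k i * \<psi> (b i)) 0)\<bar> \<le> \<delta>"
    proof (rule weighted_positive_parts[OF _ sum_h])
      fix k
      show "0 \<le> \<phi> (h k)" using h hI by (rule \<phi>.nonneg[rotated])
      assume "0 < \<phi> (h k)"
      then have "0 < \<phi> (g k)"
        using \<phi>h[of k] \<phi>S[of k] \<phi>.nonneg[OF SI S_nonneg, of k] by linarith
      then have "2 / \<delta> * \<phi> (r k) < 2" by (simp add: \<phi>g split: if_splits)
      then have "\<phi> (r k) \<le> \<delta>" using assms(1) by (simp add: field_simps)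
      have "\<bar>(\<Sum>i<n. \<phi> (a i) * \<psi> (b i)) - (\<Sum>i<n. \<alpha> k i * \<psi> (b i))\<bar>
          \<le> (\<Sum>i<n. \<bar>(\<phi> (a i) - \<alpha> k i) * \<psi> (b i)\<bar>)"
        unfolding sum_subtractf[symmetric] left_diff_distrib[symmetric] by (rule sum_abs)
      also have "\<dots> \<le> \<phi> (r k)"
        unfolding \<phi>r using \<psi>b by (intro sum_mono) (simp add: abs_mult mult_left_le)
      also have "\<dots> \<le> \<delta>" by fact
      finally show "\<bar>(\<Sum>i<n. \<phi> (a i) * \<psi> (b i)) - (\<Sum>i<n. \<alpha> k i * \<psi> (b i))\<bar> \<le> \<delta>" .
    qed
    moreover have "\<psi> (c k) = max (\<Sum>i<n. \<alpha> k i * \<psi> (b i)) 0" for k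
      using bI by (simp add: c_def \<psi>.pprt \<psi>.sum \<psi>.scaleR)
    ultimately show "\<omega> (\<bar>pprt (\<Sum>i<n. m (a i) (b i)) - (\<Sum>k<N. m (h k) (c k))\<bar> - \<delta> *\<^sub>R m A B) \<le> 0"
      using aI bI hI cI \<omega>.unit_ideal
      by (simp add: ideal \<omega>.diff \<omega>.abs \<omega>.pprt \<omega>.sum \<omega>.scaleR \<omega>.unit factor)
  qed
  then show thesis using that[of h c N] h c by simp
qed

text \<open>In terms of functions: where \<open>s *\<^sub>R x\<close> and \<open>s *\<^sub>R y\<close> exceed the units \<open>H\<close> and \<open>C\<close> the truncations change
  nothing, and elsewhere \<open>m x y\<close> itself is at most \<open>m H C / s\<close>.\<close>

lemma truncated_tensor_bound:
  fixes h :: "nat \<Rightarrow> 'e" and c :: "nat \<Rightarrow> 'f" and N :: nat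
  assumes h: "\<And>k. 0 \<le> h k" and c: "\<And>k. 0 \<le> c k" and x: "0 \<le> x" and y: "0 \<le> y" and s: "0 < s"
  defines "H \<equiv> x + (\<Sum>k<N. h k)" and "C \<equiv> y + (\<Sum>k<N. c k)"
  shows "inf (m x y) (\<Sum>k<N. m (h k) (c k))
      - (\<Sum>k<N. m (inf (h k) (s *\<^sub>R x)) (inf (c k) (s *\<^sub>R y))) \<le> (1 / s) *\<^sub>R m H C"
proof -
  have H0: "0 \<le> H" and C0: "0 \<le> C" using assms by (auto simp: H_def C_def sum_nonneg)
  have hH: "h k \<le> H" and cC: "c k \<le> C" if "k < N" for k
    using that x y h c
    by (auto simp: H_def C_def intro!: add_increasing nonneg_member_le_sum)
  have xH: "x \<le> H" and yC: "y \<le> C" using h c by (auto simp: H_def C_def sum_nonneg)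
  have I: "x \<in> principal_ideal H" "y \<in> principal_ideal C"
    using x y xH yC by (auto intro!: principal_ideal_bounded)
  have hI: "h k \<in> principal_ideal H" and cI: "c k \<in> principal_ideal C" if "k < N" for k
    using h c hH[OF that] cC[OF that] by (auto intro!: principal_ideal_bounded)
  note ideal = principal_ideal_product[OF _ _ H0 C0]
  note closed = principal_ideal_sum[rule_format] principal_ideal_diff principal_ideal_scaleR principal_ideal_abs
    principal_ideal_pprt principal_ideal_inf principal_ideal_unit ideal
  let ?d = "inf (m x y) (\<Sum>k<N. m (h k) (c k))
      - (\<Sum>k<N. m (inf (h k) (s *\<^sub>R x)) (inf (c k) (s *\<^sub>R y))) - (1 / s) *\<^sub>R m H C"
  have "?d \<le> 0"
  proof (rule le_zero_by_product_characters[OF H0 C0])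
    show "?d \<in> principal_ideal (m H C)"
      using H0 C0 by (intro closed I hI cI nonneg) auto
    fix \<omega> \<phi> \<psi>
    assume "character (m H C) \<omega>" "character H \<phi>" "character C \<psi>"
      and factor: "\<And>x y. x \<in> principal_ideal H \<Longrightarrow> y \<in> principal_ideal C \<Longrightarrow> \<omega> (m x y) = \<phi> x * \<psi> y"
    interpret \<omega>: character "m H C" \<omega> by fact
    interpret \<phi>: character H \<phi> by fact
    interpret \<psi>: character C \<psi> by fact
    define X Y h' c' where "X = \<phi> x" and "Y = \<psi> y" and "h' k = \<phi> (h k)" and "c' k = \<psi> (c k)" for k
    have X: "0 \<le> X" "X \<le> 1" and Y: "0 \<le> Y" "Y \<le> 1"
      using I x y xH yC by (auto simp: X_def Y_def \<phi>.nonneg \<psi>.nonneg \<phi>.le_one \<psi>.le_one)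
    have h': "0 \<le> h' k" "h' k \<le> 1" and c': "0 \<le> c' k" "c' k \<le> 1" if "k < N" for k
      using hI cI h c hH cC that
      by (auto simp: h'_def c'_def \<phi>.nonneg \<psi>.nonneg \<phi>.le_one \<psi>.le_one)
    have "min (X * Y) (\<Sum>k<N. h' k * c' k) - (\<Sum>k<N. min (h' k) (s * X) * min (c' k) (s * Y)) \<le> 1 / s"
    proof (cases "1 \<le> s * X \<and> 1 \<le> s * Y")
      case True
      then have "min (h' k) (s * X) * min (c' k) (s * Y) = h' k * c' k" if "k < N" for k
        using h'[OF that] c'[OF that] by (simp add: min_def)
      then have "(\<Sum>k<N. min (h' k) (s * X) * min (c' k) (s * Y)) = (\<Sum>k<N. h' k * c' k)" by simp
      moreover have "0 \<le> 1 / s" using s by simp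
      ultimately show ?thesis by linarith
    next
      case False
      then have "s * (X * Y) \<le> 1"
      proof (cases "s * X < 1")
        case True
        have "s * X * Y \<le> 1 * 1" using True X Y s by (intro mult_mono) auto
        then show ?thesis by (simp add: mult.assoc)
      next
        case F: False
        have "s * Y * X \<le> 1 * 1" using F False X Y s by (intro mult_mono) auto
        then show ?thesis by (simp add: mult_ac)
      qed
      then have "X * Y \<le> 1 / s" using s by (simp add: field_simps)
      moreover have "0 \<le> (\<Sum>k<N. min (h' k) (s * X) * min (c' k) (s * Y))"
        using h' c' X Y s by (intro sum_nonneg mult_nonneg_nonneg) auto
      ultimately show ?thesis by linarith
    qed
    then show "\<omega> ?d \<le> 0"
      using I hI cI \<omega>.unit_ideal
      by (simp add: ideal \<omega>.diff \<omega>.inf \<omega>.sum \<omega>.scaleR \<omega>.unit factor \<phi>.inf \<psi>.inf \<phi>.scaleR \<psi>.scaleR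
          X_def Y_def h'_def c'_def)
  qed
  then show ?thesis by simp
qed

end

section \<open>The tensor product of closed ideals is a closed ideal\<close>

lemma pprt_lipschitz:
  fixes x y :: "'a::banach_lattice"
  shows "norm (pprt x - pprt y) \<le> norm (x - y)"
proof (rule norm_mono_abs)
  have *: "pprt x - pprt y \<le> \<bar>x - y\<bar>" for x y :: 'a
  proof -
    have "x \<le> y + \<bar>x - y\<bar>" using abs_ge_self[of "x - y"] by (simp add: algebra_simps)
    also have "\<dots> \<le> pprt y + \<bar>x - y\<bar>" by (simp add: pprt_def)
    finally have "pprt x \<le> pprt y + \<bar>x - y\<bar>" by (simp add: pprt_def add_nonneg_nonneg)
    then show ?thesis by (simp add: algebra_simps)
  qed
  show "\<bar>pprt x - pprt y\<bar> \<le> \<bar>x - y\<bar>"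
    using *[of x y] *[of y x] by (intro abs_leI) (simp_all add: abs_minus_commute)
qed

lemma inf_lipschitz:
  fixes w x y :: "'a::banach_lattice"
  shows "norm (inf w x - inf w y) \<le> norm (x - y)"
proof (rule norm_mono_abs)
  have *: "inf w x - inf w y \<le> \<bar>x - y\<bar>" for x y :: 'a
  proof -
    have "x - \<bar>x - y\<bar> \<le> y" using abs_ge_self[of "x - y"] by (simp add: algebra_simps)
    then have "inf w x - \<bar>x - y\<bar> \<le> y"
      by (rule order_trans[rotated]) (rule diff_right_mono, simp)
    moreover have "inf w x - \<bar>x - y\<bar> \<le> w"
      using add_mono[OF inf_le1[of w x] abs_ge_zero[of "x - y"]] by (simp add: diff_le_eq)
    ultimately have "inf w x - \<bar>x - y\<bar> \<le> inf w y" by (rule inf_greatest[rotated])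
    then show ?thesis by (simp only: diff_le_eq add.commute)
  qed
  show "\<bar>inf w x - inf w y\<bar> \<le> \<bar>x - y\<bar>"
  proof (rule abs_leI[OF *])
    show "- (inf w x - inf w y) \<le> \<bar>x - y\<bar>"
      using *[of y x] by (simp only: minus_diff_eq abs_minus_commute)
  qed
qed

lemma subspace_closure:
  fixes S :: "'a::real_normed_vector set"
  assumes "subspace S"
  shows "subspace (closure S)"
proof (rule subspaceI)
  show "0 \<in> closure S" using subspace_0[OF assms] closure_subset by blast
next
  fix x y assume "x \<in> closure S" "y \<in> closure S"
  then obtain f g where "\<And>n. f n \<in> S" "f \<longlonglongrightarrow> x" "\<And>n. g n \<in> S" "g \<longlonglongrightarrow> y"
    by (auto simp: closure_sequential)
  then show "x + y \<in> closure S"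
    unfolding closure_sequential
    by (intro exI[of _ "\<lambda>n. f n + g n"]) (auto intro: tendsto_add subspace_add[OF assms])
next
  fix c x assume "x \<in> closure S"
  then obtain f where "\<And>n. f n \<in> S" "f \<longlonglongrightarrow> x" by (auto simp: closure_sequential)
  then show "c *\<^sub>R x \<in> closure S"
    unfolding closure_sequential
    by (intro exI[of _ "\<lambda>n. c *\<^sub>R f n"])
      (auto intro: tendsto_scaleR tendsto_const subspace_scale[OF assms])
qed

lemma closed_ideals_solid: "J \<in> closed_ideals \<Longrightarrow> y \<in> J \<Longrightarrow> \<bar>x\<bar> \<le> \<bar>y\<bar> \<Longrightarrow> x \<in> J"
  and closed_ideals_subspace: "J \<in> closed_ideals \<Longrightarrow> subspace J"
  and closed_ideals_closed: "J \<in> closed_ideals \<Longrightarrow> closed J"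
  by (auto simp: closed_ideals_def)

lemma closed_ideals_abs: "J \<in> closed_ideals \<Longrightarrow> x \<in> J \<Longrightarrow> \<bar>x\<bar> \<in> J"
  by (erule closed_ideals_solid) auto

lemma closed_ideal_tensor: "closed (ideal_tensor m (I, J))"
  by (simp add: ideal_tensor_def)

lemma subspace_ideal_tensor: "subspace (ideal_tensor m (I, J))"
  by (simp add: ideal_tensor_def subspace_closure)

text \<open>Density of the span of all \<open>m x y\<close> is the statement that the two improper ideals have the whole space
  as their tensor product.\<close>

locale dense_bimorphism = bimorphism m
  for m :: "'e::banach_lattice \<Rightarrow> 'f::banach_lattice \<Rightarrow> 'z::banach_lattice" +
  assumes dense: "ideal_tensor m (UNIV, UNIV) = UNIV"
begin

lemma span_products_sum:
  assumes "u \<in> span {m x y | x y. x \<in> I \<and> y \<in> J}"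
  obtains n :: nat and a b where "u = (\<Sum>i<n. m (a i) (b i))"
proof -
  from assms have "\<exists>(n::nat) a b. u = (\<Sum>i<n. m (a i) (b i))"
  proof (induction rule: span_induct_alt)
    case base
    show ?case by (rule exI[of _ 0]) simp
  next
    case (step c z u)
    then obtain n :: nat and a b x y where u: "u = (\<Sum>i<n. m (a i) (b i))" and z: "z = m x y" by blast
    show ?case
      by (rule exI[of _ "Suc n"], rule exI[of _ "a(n := c *\<^sub>R x)"], rule exI[of _ "b(n := y)"])
        (simp add: u z scale_left add.commute)
  qed
  with that show thesis by blast
qed

text \<open>Choose \<open>u\<close> in the algebraic span near \<open>w\<close>, then \<open>v\<close> near the positive part of \<open>u\<close> with positive
  tensors as terms, and then the truncation \<open>v'\<close> of \<open>v\<close>. Since \<open>w \<le> m x y\<close>, the part of \<open>v\<close> that is lost by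
  truncation is controlled where it matters, and \<open>v' \<le> v\<close> controls the other side.\<close>

lemma dominated_by_product_in_ideal_tensor:
  assumes I: "I \<in> closed_ideals" and J: "J \<in> closed_ideals"
    and x: "x \<in> I" "0 \<le> x" and y: "y \<in> J" "0 \<le> y" and w: "0 \<le> w" "w \<le> m x y"
  shows "w \<in> ideal_tensor m (I, J)"
  unfolding ideal_tensor_def case_prod_conv closure_approachable
proof (intro allI impI)
  fix \<epsilon> :: real assume \<epsilon>: "0 < \<epsilon>"
  have "w \<in> closure (span {m x y | x y. x \<in> UNIV \<and> y \<in> UNIV})"
    using dense by (simp add: ideal_tensor_def)
  moreover have "0 < \<epsilon> / 4" using \<epsilon> by simp
  ultimately obtain u where u_span: "u \<in> span {m x y | x y. x \<in> UNIV \<and> y \<in> UNIV}"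
    and "dist w u < \<epsilon> / 4"
    using closure_approachableD by blast
  then have wu: "norm (w - u) < \<epsilon> / 4" by (simp add: dist_norm)
  obtain n :: nat and a b where u: "u = (\<Sum>i<n. m (a i) (b i))"
    by (rule span_products_sum[OF u_span])
  define P where "P = m (\<Sum>i<n. \<bar>a i\<bar>) (\<Sum>i<n. \<bar>b i\<bar>)"
  define \<delta> where "\<delta> = \<epsilon> / 4 / (norm P + 1)"
  have \<delta>: "0 < \<delta>" using \<epsilon> by (simp add: \<delta>_def add_nonneg_pos)
  obtain N and h :: "nat \<Rightarrow> 'e" and c :: "nat \<Rightarrow> 'f"
    where h: "\<And>k. 0 \<le> h k" and c: "\<And>k. 0 \<le> c k"
      and approx: "\<bar>pprt u - (\<Sum>k<N. m (h k) (c k))\<bar> \<le> \<delta> *\<^sub>R P"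
    by (rule positive_part_approximation[OF \<delta>, where a = a and b = b and n = n, folded u P_def])
      (rule that; assumption)
  define v where "v = (\<Sum>k<N. m (h k) (c k))"
  have "norm (pprt u - v) \<le> norm (\<delta> *\<^sub>R P)"
    using approx unfolding v_def by (intro norm_mono_abs) (rule order_trans[OF _ abs_ge_self])
  also have "\<dots> = \<delta> * norm P" using \<delta> by simp
  also have "\<dots> \<le> \<delta> * (norm P + 1)" using \<delta> by simp
  also have "\<dots> = \<epsilon> / 4"
  proof -
    have "norm P + 1 \<noteq> 0" using norm_ge_zero[of P] by linarith
    from iffD1[OF nonzero_eq_divide_eq[OF this] \<delta>_def] show ?thesis .
  qed
  finally have uv: "norm (pprt u - v) \<le> \<epsilon> / 4" .
  have "norm (w - v) \<le> norm (pprt w - pprt u) + norm (pprt u - v)"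
    using norm_triangle_ineq[of "pprt w - pprt u" "pprt u - v"] w(1) by simp
  then have wv: "norm (w - v) < \<epsilon> / 2"
    using pprt_lipschitz[of w u] wu uv by linarith
  define Q where "Q = m (x + (\<Sum>k<N. h k)) (y + (\<Sum>k<N. c k))"
  define s where "s = 2 * (norm Q + 1) / \<epsilon>"
  have s: "0 < s" using \<epsilon> by (simp add: s_def add_nonneg_pos)
  define v' where "v' = (\<Sum>k<N. m (inf (h k) (s *\<^sub>R x)) (inf (c k) (s *\<^sub>R y)))"
  have Q: "0 \<le> Q" unfolding Q_def using h c x y by (intro nonneg add_nonneg_nonneg sum_nonneg) auto
  have sx: "0 \<le> s *\<^sub>R x" and sy: "0 \<le> s *\<^sub>R y" using s x y by (auto simp: scaleR_nonneg_nonneg)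
  have "v' \<le> v"
    unfolding v_def v'_def using h c sx sy by (intro sum_mono mono) auto
  have "\<bar>v' - w\<bar> \<le> \<bar>w - v\<bar> + (1 / s) *\<^sub>R Q"
  proof (rule abs_leI)
    have "v' - w \<le> v - w" using \<open>v' \<le> v\<close> by (simp add: diff_right_mono)
    also have "\<dots> \<le> \<bar>w - v\<bar>" using abs_ge_minus_self[of "w - v"] by simp
    finally show "v' - w \<le> \<bar>w - v\<bar> + (1 / s) *\<^sub>R Q"
      using s Q by (intro add_increasing2) (auto simp: scaleR_nonneg_nonneg)
    have "w = inf (m x y) w" using w(2) by (simp add: inf_absorb2)
    also have "\<dots> \<le> inf (m x y) (v + \<bar>w - v\<bar>)"
      using abs_ge_self[of "w - v"] by (intro inf_mono) (auto simp: algebra_simps)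
    also have "\<dots> \<le> inf (m x y) v + \<bar>w - v\<bar>"
      by (simp add: add_inf_distrib_right le_infI1 add_increasing2)
    finally have "w - \<bar>w - v\<bar> \<le> inf (m x y) v" by (simp only: diff_le_eq)
    moreover have "inf (m x y) v - v' \<le> (1 / s) *\<^sub>R Q"
      unfolding v_def v'_def Q_def by (rule truncated_tensor_bound[OF h c x(2) y(2) s])
    ultimately have "(w - \<bar>w - v\<bar>) + (inf (m x y) v - v') \<le> inf (m x y) v + (1 / s) *\<^sub>R Q"
      by (rule add_mono)
    then show "- (v' - w) \<le> \<bar>w - v\<bar> + (1 / s) *\<^sub>R Q" by (simp add: algebra_simps)
  qed
  then have "norm (v' - w) \<le> norm (\<bar>w - v\<bar> + (1 / s) *\<^sub>R Q)"
    by (intro norm_mono_abs) (rule order_trans[OF _ abs_ge_self])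
  also have "\<dots> \<le> norm (w - v) + norm Q / s"
    using norm_triangle_ineq[of "\<bar>w - v\<bar>" "(1 / s) *\<^sub>R Q"] s by simp
  also have "norm Q / s \<le> \<epsilon> / 2"
    unfolding pos_divide_le_eq[OF s] using \<epsilon> by (simp add: s_def)
  finally have "norm (v' - w) < \<epsilon>" using wv by linarith
  moreover have "v' \<in> span {m x y | x y. x \<in> I \<and> y \<in> J}"
    unfolding v'_def
  proof (rule span_sum, rule span_base)
    fix k
    have "s *\<^sub>R x \<in> I" "s *\<^sub>R y \<in> J"
      using x y I J by (auto intro: subspace_scale closed_ideals_subspace)
    then have "inf (h k) (s *\<^sub>R x) \<in> I" "inf (c k) (s *\<^sub>R y) \<in> J"
      using h[of k] c[of k] sx sy by (auto elim!: closed_ideals_solid[OF I] closed_ideals_solid[OF J])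
    then show "m (inf (h k) (s *\<^sub>R x)) (inf (c k) (s *\<^sub>R y)) \<in> {m x y | x y. x \<in> I \<and> y \<in> J}"
      by blast
  qed
  ultimately show "\<exists>v\<in>span {m x y | x y. x \<in> I \<and> y \<in> J}. dist v w < \<epsilon>"
    by (auto simp: dist_norm)
qed

text \<open>Every element of the span is dominated by some \<open>m x y\<close> with positive \<open>x \<in> I\<close> and \<open>y \<in> J\<close>. An
  element dominated by a limit of the span is treated by cutting it off at the approximants.\<close>

theorem ideal_tensor_closed_ideal:
  assumes I: "I \<in> closed_ideals" and J: "J \<in> closed_ideals"
  shows "ideal_tensor m (I, J) \<in> closed_ideals"
proof -
  let ?K = "ideal_tensor m (I, J)"
  have span_bound: "\<exists>x\<in>I. \<exists>y\<in>J. 0 \<le> x \<and> 0 \<le> y \<and> \<bar>v\<bar> \<le> m x y"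
    if "v \<in> span {m x y | x y. x \<in> I \<and> y \<in> J}" for v
    using that
  proof (induction rule: span_induct_alt)
    case base
    show ?case using I J by (intro bexI[of _ 0]) (auto simp: closed_ideals_def subspace_0)
  next
    case (step r z v)
    then obtain x y x' y' where x: "x \<in> I" "0 \<le> x" and y: "y \<in> J" "0 \<le> y" and v: "\<bar>v\<bar> \<le> m x y"
      and z: "z = m x' y'" "x' \<in> I" "y' \<in> J" by blast
    let ?x = "\<bar>r *\<^sub>R x'\<bar> + x" and ?y = "\<bar>y'\<bar> + y"
    have "\<bar>r *\<^sub>R z + v\<bar> \<le> \<bar>m (r *\<^sub>R x') y'\<bar> + \<bar>v\<bar>"
      unfolding z scale_left[symmetric] by (rule abs_triangle_ineq)
    also have "\<dots> \<le> m \<bar>r *\<^sub>R x'\<bar> \<bar>y'\<bar> + m x y" by (intro add_mono abs_le v)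
    also have "\<dots> \<le> m \<bar>r *\<^sub>R x'\<bar> ?y + m x ?y"
      using x y by (intro add_mono mono_right) auto
    also have "\<dots> = m ?x ?y" by (simp add: add_left)
    finally have "\<bar>r *\<^sub>R z + v\<bar> \<le> m ?x ?y" .
    moreover have "?x \<in> I" "?y \<in> J"
      using x y z I J
      by (auto intro!: subspace_add closed_ideals_subspace closed_ideals_abs subspace_scale)
    moreover have "0 \<le> ?x" "0 \<le> ?y" using x y by auto
    ultimately show ?case by blast
  qed
  have pos: "w \<in> ?K" if v: "v \<in> ?K" and w: "0 \<le> w" "w \<le> \<bar>v\<bar>" for v w
  proof -
    obtain f where f: "\<And>n. f n \<in> span {m x y | x y. x \<in> I \<and> y \<in> J}" and lim: "f \<longlonglongrightarrow> v"
      using v by (auto simp: ideal_tensor_def closure_sequential)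
    have "inf w \<bar>f n\<bar> \<in> ?K" for n
    proof -
      obtain x y where "x \<in> I" "0 \<le> x" "y \<in> J" "0 \<le> y" "\<bar>f n\<bar> \<le> m x y" using span_bound[OF f] by blast
      then show ?thesis
        using w by (intro dominated_by_product_in_ideal_tensor[OF I J, of x y]) (auto intro: le_infI2)
    qed
    moreover have "(\<lambda>n. inf w \<bar>f n\<bar>) \<longlonglongrightarrow> inf w \<bar>v\<bar>"
    proof (rule metric_tendsto_imp_tendsto[OF lim], rule always_eventually, rule allI)
      fix n
      have "norm (inf w \<bar>f n\<bar> - inf w \<bar>v\<bar>) \<le> norm (\<bar>f n\<bar> - \<bar>v\<bar>)" by (rule inf_lipschitz)
      also have "\<dots> \<le> norm (f n - v)"
        by (rule norm_mono_abs) (rule abs_triangle_ineq3)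
      finally show "dist (inf w \<bar>f n\<bar>) (inf w \<bar>v\<bar>) \<le> dist (f n) v" by (simp add: dist_norm)
    qed
    ultimately have "inf w \<bar>v\<bar> \<in> ?K" by (rule closed_sequentially[OF closed_ideal_tensor])
    then show ?thesis using w(2) by (simp add: inf_absorb1)
  qed
  have "w \<in> ?K" if "v \<in> ?K" "\<bar>w\<bar> \<le> \<bar>v\<bar>" for v w
  proof -
    have "pprt w \<le> \<bar>v\<bar>" "pprt (- w) \<le> \<bar>v\<bar>"
      unfolding pprt_def using abs_le_D1[OF that(2)] abs_le_D2[OF that(2)] by simp_all
    then have "pprt w \<in> ?K" "pprt (- w) \<in> ?K" using pos[OF that(1)] by auto
    then have "pprt w - pprt (- w) \<in> ?K" by (rule subspace_diff[OF subspace_ideal_tensor])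
    moreover have "pprt w - pprt (- w) = w"
      unfolding pprt_neg by (metis diff_minus_eq_add prts)
    ultimately show ?thesis by simp
  qed
  then show ?thesis
    using closed_ideal_tensor subspace_ideal_tensor unfolding closed_ideals_def by blast
qed

end

section \<open>The Wijsman topology\<close>

text \<open>The coordinates that define the Wijsman topology, as a map into the countable product of lines. This
  map is a homeomorphism onto its image.\<close>

definition distance_profile :: "('a \<Rightarrow> 'a \<Rightarrow> real) \<Rightarrow> (nat \<Rightarrow> 'a) \<Rightarrow> 'a set \<Rightarrow> nat \<Rightarrow> real" where
  "distance_profile d a F n = (INF x\<in>F. d (a n) x)"

locale wijsman_data =
  fixes d :: "'a::topological_space \<Rightarrow> 'a \<Rightarrow> real" and a :: "nat \<Rightarrow> 'a"
  assumes compatible: "compatible_metric d" and dense: "dense_sequence a"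
begin

sublocale Metric_space UNIV d
  using compatible by (simp add: compatible_metric_def)

lemma mtopology_euclidean: "mtopology = euclidean"
  using compatible by (simp add: compatible_metric_def)

lemma open_distance_ball: "open {x. d c x < r}"
proof -
  have "mball c r = {x. d c x < r}" by auto
  then show ?thesis using openin_mball[of c r] by (simp add: mtopology_euclidean)
qed

lemma ball_around_dense_point:
  assumes "open V" "x \<in> V"
  obtains n r where "d (a n) x < r" "{y. d (a n) y < r} \<subseteq> V"
proof -
  have "openin mtopology V" using assms by (simp add: mtopology_euclidean)
  then obtain r where r: "0 < r" "mball x r \<subseteq> V" using assms(2) by (auto simp: openin_mtopology)
  have "{y. d x y < r / 2} \<inter> range a \<noteq> {}"
  proof
    assume "{y. d x y < r / 2} \<inter> range a = {}"
    then have "{y. d x y < r / 2} \<inter> closure (range a) = {}"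
      using open_Int_closure_eq_empty[OF open_distance_ball] by blast
    moreover have "x \<in> {y. d x y < r / 2}" using r(1) by simp
    moreover have "closure (range a) = UNIV" using dense by (simp add: dense_sequence_def)
    ultimately show False by (metis Int_UNIV_right empty_iff)
  qed
  then obtain n where n: "d x (a n) < r / 2" by auto
  show thesis
  proof
    show "d (a n) x < r / 2" using n by (simp add: commute)
    have "d x y < r" if "d (a n) y < r / 2" for y
      using triangle[of x "a n" y] n that by simp
    then show "{y. d (a n) y < r / 2} \<subseteq> V" using r(2) by auto
  qed
qed

lemma distance_profile_less_iff:
  assumes "F \<noteq> {}"
  shows "distance_profile d a F n < r \<longleftrightarrow> F \<inter> {x. d (a n) x < r} \<noteq> {}"
proof -
  have "bdd_below (d (a n) ` F)" by (rule bdd_belowI[of _ 0]) auto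
  then show ?thesis unfolding distance_profile_def using assms by (subst cINF_less_iff) auto
qed

lemma distance_profile_mono_imp_subset:
  assumes "closed F'" "F \<noteq> {}" "F' \<noteq> {}"
    and "\<And>n. distance_profile d a F' n \<le> distance_profile d a F n"
  shows "F \<subseteq> F'"
proof
  fix x assume "x \<in> F"
  show "x \<in> F'"
  proof (rule ccontr)
    assume "x \<notin> F'"
    then obtain n r where nr: "d (a n) x < r" "{y. d (a n) y < r} \<subseteq> - F'"
      using ball_around_dense_point[of "- F'" x] assms(1) by (auto simp: open_Compl)
    then have "distance_profile d a F n < r"
      using distance_profile_less_iff[OF assms(2)] \<open>x \<in> F\<close> by blast
    then have "distance_profile d a F' n < r" using assms(4)[of n] by simp
    then show False using distance_profile_less_iff[OF assms(3)] nr(2) by blast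
  qed
qed

lemma distance_profile_inject:
  assumes "closed F" "F \<noteq> {}" "closed F'" "F' \<noteq> {}"
    and "distance_profile d a F = distance_profile d a F'"
  shows "F = F'"
  using distance_profile_mono_imp_subset[of F F'] distance_profile_mono_imp_subset[of F' F] assms
  by simp

lemma openin_wijsman_coordinate:
  assumes "open U"
  shows "openin (wijsman d a) {F. closed F \<and> F \<noteq> {} \<and> distance_profile d a F n \<in> U}"
  unfolding wijsman_def distance_profile_def
  by (rule topology_generated_by_Basis) (use assms in blast)

lemma topspace_wijsman: "topspace (wijsman d a) = {F. closed F \<and> F \<noteq> {}}"
proof
  show "topspace (wijsman d a) \<subseteq> {F. closed F \<and> F \<noteq> {}}"
    unfolding wijsman_def topology_generated_by_topspace by blast
  show "{F. closed F \<and> F \<noteq> {}} \<subseteq> topspace (wijsman d a)"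
    using openin_subset[OF openin_wijsman_coordinate[of UNIV 0]] by simp
qed

lemma continuous_distance_profile:
  "continuous_map (wijsman d a) euclidean (distance_profile d a)"
proof -
  have "continuous_map (wijsman d a) euclidean (\<lambda>F. distance_profile d a F n)" for n
    unfolding continuous_map_def topspace_wijsman
    using openin_wijsman_coordinate[of _ n] by (simp add: conj_assoc)
  then show ?thesis
    by (simp only: euclidean_product_topology[symmetric] continuous_map_componentwise_UNIV) simp
qed

lemma openin_wijsman_iff:
  "openin (wijsman d a) \<U> \<longleftrightarrow>
     (\<exists>W. open W \<and> \<U> = {F. closed F \<and> F \<noteq> {} \<and> distance_profile d a F \<in> W})"
proof
  assume "openin (wijsman d a) \<U>"
  then have "generate_topology_on
      {{F. closed F \<and> F \<noteq> {} \<and> (INF x\<in>F. d (a n) x) \<in> U} | n U. open U} \<U>"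
    unfolding wijsman_def by (rule openin_topology_generated_by)
  then show "\<exists>W. open W \<and> \<U> = {F. closed F \<and> F \<noteq> {} \<and> distance_profile d a F \<in> W}"
  proof (induction rule: generate_topology_on.induct)
    case Empty
    show ?case by (rule exI[of _ "{}"]) simp
  next
    case (Int \<U> \<V>)
    then obtain V W where "open V" "\<U> = {F. closed F \<and> F \<noteq> {} \<and> distance_profile d a F \<in> V}"
      "open W" "\<V> = {F. closed F \<and> F \<noteq> {} \<and> distance_profile d a F \<in> W}" by blast
    then show ?case by (intro exI[of _ "V \<inter> W"]) auto
  next
    case (UN \<K>)
    then have "\<forall>\<U>\<in>\<K>. \<exists>W. open W \<and> \<U> = {F. closed F \<and> F \<noteq> {} \<and> distance_profile d a F \<in> W}"
      by blast
    from bchoice[OF this] obtain W where W: "\<forall>\<U>\<in>\<K>. open (W \<U>) \<and>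
        \<U> = {F. closed F \<and> F \<noteq> {} \<and> distance_profile d a F \<in> W \<U>}" ..
    have "F \<in> \<Union>\<K> \<longleftrightarrow> closed F \<and> F \<noteq> {} \<and> distance_profile d a F \<in> (\<Union>\<U>\<in>\<K>. W \<U>)" for F
    proof -
      have "F \<in> \<U> \<longleftrightarrow> closed F \<and> F \<noteq> {} \<and> distance_profile d a F \<in> W \<U>" if "\<U> \<in> \<K>" for \<U>
        using W that by blast
      then show ?thesis by (simp add: Union_iff)
    qed
    then have "\<Union>\<K> = {F. closed F \<and> F \<noteq> {} \<and> distance_profile d a F \<in> (\<Union>\<U>\<in>\<K>. W \<U>)}"
      by blast
    moreover have "open (\<Union>\<U>\<in>\<K>. W \<U>)" using W by blast
    ultimately show ?case by blast
  next
    case (Basis \<U>)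
    then obtain n U where "open U" and \<U>: "\<U> = {F. closed F \<and> F \<noteq> {} \<and> (INF x\<in>F. d (a n) x) \<in> U}"
      by blast
    have "open ((\<lambda>f :: nat \<Rightarrow> real. f n) -` U)"
      by (intro open_vimage \<open>open U\<close> continuous_on_product_coordinates)
    then show ?case
      by (intro exI[of _ "(\<lambda>f. f n) -` U"]) (simp add: \<U> distance_profile_def)
  qed
next
  assume "\<exists>W. open W \<and> \<U> = {F. closed F \<and> F \<noteq> {} \<and> distance_profile d a F \<in> W}"
  then obtain W where "open W" and \<U>: "\<U> = {F. closed F \<and> F \<noteq> {} \<and> distance_profile d a F \<in> W}"
    by blast
  then have "openin (wijsman d a) {F \<in> topspace (wijsman d a). distance_profile d a F \<in> W}"
    by (intro openin_continuous_map_preimage[OF continuous_distance_profile]) simp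
  then show "openin (wijsman d a) \<U>" by (simp add: \<U> topspace_wijsman conj_assoc)
qed

text \<open>The Wijsman topology refines the lower Vietoris topology, since a closed set meets \<open>V\<close> iff it
  has distance less than \<open>r\<close> from some \<open>a n\<close> whose ball of radius \<open>r\<close> lies in \<open>V\<close>.\<close>

lemma openin_wijsman_hit:
  assumes "open V"
  shows "openin (wijsman d a) {F. closed F \<and> F \<inter> V \<noteq> {}}"
proof -
  have "{F. closed F \<and> F \<inter> V \<noteq> {}} =
      \<Union>{{F. closed F \<and> F \<noteq> {} \<and> distance_profile d a F n \<in> {..<r}} | n r. {x. d (a n) x < r} \<subseteq> V}"
    (is "?L = \<Union>?R")
  proof
    show "?L \<subseteq> \<Union>?R"
    proof
      fix F assume F: "F \<in> ?L"
      then obtain x where "x \<in> F" "x \<in> V" by blast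
      then obtain n r where "d (a n) x < r" "{y. d (a n) y < r} \<subseteq> V"
        using ball_around_dense_point[OF assms] by blast
      moreover from this have "distance_profile d a F n < r"
        using distance_profile_less_iff[of F n r] \<open>x \<in> F\<close> by blast
      ultimately show "F \<in> \<Union>?R" using F \<open>x \<in> F\<close> by blast
    qed
    show "\<Union>?R \<subseteq> ?L"
    proof
      fix F assume "F \<in> \<Union>?R"
      then obtain n r where F: "closed F" "F \<noteq> {}" "distance_profile d a F n < r"
        and V: "{x. d (a n) x < r} \<subseteq> V" by blast
      have "F \<inter> {x. d (a n) x < r} \<noteq> {}" by (rule iffD1[OF distance_profile_less_iff[OF F(2)] F(3)])
      with V F(1) show "F \<in> ?L" by blast
    qed
  qed
  moreover have "openin (wijsman d a) \<dots>"
  proof (rule openin_Union)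
    fix \<U> assume "\<U> \<in> ?R"
    then obtain n r where "\<U> = {F. closed F \<and> F \<noteq> {} \<and> distance_profile d a F n \<in> {..<r}}" by blast
    then show "openin (wijsman d a) \<U>" by (simp only: openin_wijsman_coordinate open_lessThan)
  qed
  ultimately show ?thesis by simp
qed

end

locale ideal_wijsman = wijsman_data d a
  for d :: "'a::banach_lattice \<Rightarrow> 'a \<Rightarrow> real" and a
begin

lemma closed_ideals_wijsman: "closed_ideals \<subseteq> topspace (wijsman d a)"
  unfolding topspace_wijsman closed_ideals_def using subspace_0 by blast

lemma closed_ideals_nonempty: "J \<in> closed_ideals \<Longrightarrow> J \<noteq> {}"
  unfolding closed_ideals_def using subspace_0 by blast

lemma topspace_ideal_space [simp]: "topspace (ideal_space d a) = closed_ideals"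
  unfolding ideal_space_def using closed_ideals_wijsman by auto

lemma openin_ideal_space_iff:
  "openin (ideal_space d a) \<U> \<longleftrightarrow>
     (\<exists>W. open W \<and> \<U> = {J \<in> closed_ideals. distance_profile d a J \<in> W})"
proof -
  have "{F. closed F \<and> F \<noteq> {} \<and> distance_profile d a F \<in> W} \<inter> closed_ideals =
      {J \<in> closed_ideals. distance_profile d a J \<in> W}" for W
    using closed_ideals_wijsman unfolding topspace_wijsman by blast
  note trace = this
  show ?thesis
  proof
    assume "openin (ideal_space d a) \<U>"
    then obtain T where T: "openin (wijsman d a) T" "\<U> = T \<inter> closed_ideals"
      unfolding ideal_space_def openin_subtopology by (elim exE conjE)
    from T(1) obtain W where "open W" "T = {F. closed F \<and> F \<noteq> {} \<and> distance_profile d a F \<in> W}"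
      unfolding openin_wijsman_iff by (elim exE conjE)
    then show "\<exists>W. open W \<and> \<U> = {J \<in> closed_ideals. distance_profile d a J \<in> W}"
      using T(2) trace[of W] by (intro exI[of _ W]) simp
  next
    assume "\<exists>W. open W \<and> \<U> = {J \<in> closed_ideals. distance_profile d a J \<in> W}"
    then obtain W where "open W" and \<U>: "\<U> = {J \<in> closed_ideals. distance_profile d a J \<in> W}"
      by (elim exE conjE)
    have "openin (wijsman d a) {F. closed F \<and> F \<noteq> {} \<and> distance_profile d a F \<in> W}"
      unfolding openin_wijsman_iff by (intro exI[of _ W] conjI refl \<open>open W\<close>)
    moreover have "\<U> = {F. closed F \<and> F \<noteq> {} \<and> distance_profile d a F \<in> W} \<inter> closed_ideals"
      by (simp only: \<U> trace)
    ultimately show "openin (ideal_space d a) \<U>"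
      unfolding ideal_space_def openin_subtopology by (intro exI conjI)
  qed
qed

lemma openin_ideal_space_hit:
  assumes "open V"
  shows "openin (ideal_space d a) {J \<in> closed_ideals. J \<inter> V \<noteq> {}}"
proof -
  have "{J \<in> closed_ideals. J \<inter> V \<noteq> {}} = {F. closed F \<and> F \<inter> V \<noteq> {}} \<inter> closed_ideals"
    using closed_ideals_wijsman unfolding topspace_wijsman by blast
  then show ?thesis
    unfolding ideal_space_def openin_subtopology
    by (intro exI[of _ "{F. closed F \<and> F \<inter> V \<noteq> {}}"] conjI openin_wijsman_hit[OF assms])
qed

lemma metrizable_ideal_space: "metrizable_space (ideal_space d a)"
proof -
  let ?S = "distance_profile d a ` closed_ideals"
  have cont: "continuous_map (ideal_space d a) (subtopology euclidean ?S) (distance_profile d a)"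
    unfolding continuous_map_in_subtopology
  proof
    show "continuous_map (ideal_space d a) euclidean (distance_profile d a)"
      unfolding ideal_space_def by (rule continuous_map_from_subtopology[OF continuous_distance_profile])
  qed simp
  have "homeomorphic_map (ideal_space d a) (subtopology euclidean ?S) (distance_profile d a)"
  proof (rule bijective_open_imp_homeomorphic_map[OF cont])
    show "open_map (ideal_space d a) (subtopology euclidean ?S) (distance_profile d a)"
      unfolding open_map_def
    proof (intro allI impI)
      fix \<U> assume "openin (ideal_space d a) \<U>"
      then obtain W where "open W" "\<U> = {J \<in> closed_ideals. distance_profile d a J \<in> W}"
        by (auto simp: openin_ideal_space_iff)
      then have "distance_profile d a ` \<U> = W \<inter> ?S" by auto
      then show "openin (subtopology euclidean ?S) (distance_profile d a ` \<U>)"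
        using \<open>open W\<close> by (auto simp: openin_subtopology)
    qed
    show "distance_profile d a ` topspace (ideal_space d a) = topspace (subtopology euclidean ?S)"
      by simp
    show "inj_on (distance_profile d a) (topspace (ideal_space d a))"
      by (intro inj_onI distance_profile_inject closed_ideals_nonempty closed_ideals_closed) simp_all
  qed
  then have "ideal_space d a homeomorphic_space subtopology euclidean ?S"
    by (rule homeomorphic_map_imp_homeomorphic_space)
  then show ?thesis
    using homeomorphic_metrizable_space metrizable_space_subtopology metrizable_space_euclidean
    by blast
qed

end

section \<open>Descriptive complexity of lower semicontinuous maps\<close>

lemma fsigma_in_INT_finite:
  assumes "finite I" "\<And>i. i \<in> I \<Longrightarrow> fsigma_in X (S i)"
  shows "fsigma_in X (topspace X \<inter> (\<Inter>i\<in>I. S i))"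
  using assms
proof (induction I)
  case (insert i I)
  have "topspace X \<inter> (\<Inter>i\<in>insert i I. S i) = S i \<inter> (topspace X \<inter> (\<Inter>i\<in>I. S i))" by auto
  then show ?case using insert by (simp add: fsigma_in_Int)
qed simp

text \<open>Sublevel sets \<open>{f < r}\<close> are open, so \<open>F\<^sub>\<sigma>\<close> by metrizability, and \<open>{f > r}\<close> is a countable union of the
  closed sets \<open>{f \<ge> r + 1/(k+1)}\<close>.\<close>

lemma fsigma_in_upper_semicontinuous_preimage:
  fixes f :: "'a \<Rightarrow> real"
  assumes X: "metrizable_space X" and f: "\<And>r. openin X {x \<in> topspace X. f x < r}" and "open W"
  shows "fsigma_in X {x \<in> topspace X. f x \<in> W}"
proof -
  have below: "fsigma_in X {x \<in> topspace X. f x < r}" for r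
    by (rule open_imp_fsigma_in[OF X f])
  have above: "fsigma_in X {x \<in> topspace X. r < f x}" for r
  proof -
    have "{x \<in> topspace X. r < f x} = \<Union>(range (\<lambda>k. {x \<in> topspace X. r + 1 / real (Suc k) \<le> f x}))"
    proof (intro equalityI subsetI)
      fix x assume x: "x \<in> {x \<in> topspace X. r < f x}"
      then obtain k where "1 / real (Suc k) < f x - r"
        using nat_approx_posE[of "f x - r"] by auto
      with x show "x \<in> \<Union>(range (\<lambda>k. {x \<in> topspace X. r + 1 / real (Suc k) \<le> f x}))"
        by (auto intro!: exI[of _ k])
    next
      fix x assume "x \<in> \<Union>(range (\<lambda>k. {x \<in> topspace X. r + 1 / real (Suc k) \<le> f x}))"
      then obtain k where "x \<in> topspace X" "r + 1 / real (Suc k) \<le> f x" by blast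
      moreover have "0 < 1 / real (Suc k)" by simp
      ultimately have "x \<in> topspace X \<and> r < f x" by linarith
      then show "x \<in> {x \<in> topspace X. r < f x}" by simp
    qed
    moreover have closed: "closedin X {x \<in> topspace X. s \<le> f x}" for s
    proof -
      have "{x \<in> topspace X. s \<le> f x} = topspace X - {x \<in> topspace X. f x < s}" by auto
      then show ?thesis using f[of s] by (simp add: closedin_diff)
    qed
    moreover have "fsigma_in X (\<Union>(range (\<lambda>k. {x \<in> topspace X. r + 1 / real (Suc k) \<le> f x})))"
      by (rule fsigma_in_Union) (auto intro: closed_imp_fsigma_in closed)
    ultimately show ?thesis by simp
  qed
  define Q where "Q = {(p, q). p \<in> \<rat> \<and> q \<in> \<rat> \<and> {p<..<q} \<subseteq> W}"
  have "countable Q"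
    by (rule countable_subset[of _ "\<rat> \<times> \<rat>"]) (auto simp: Q_def countable_rat)
  have "{x \<in> topspace X. f x \<in> W} =
      \<Union>((\<lambda>(p, q). {x \<in> topspace X. p < f x} \<inter> {x \<in> topspace X. f x < q}) ` Q)"
  proof (intro equalityI subsetI)
    fix x assume x: "x \<in> {x \<in> topspace X. f x \<in> W}"
    then obtain e where e: "0 < e" "ball (f x) e \<subseteq> W" using \<open>open W\<close> open_contains_ball by blast
    obtain p where p: "p \<in> \<rat>" "f x - e < p" "p < f x" using Rats_dense_in_real[of "f x - e" "f x"] e by auto
    obtain q where q: "q \<in> \<rat>" "f x < q" "q < f x + e" using Rats_dense_in_real[of "f x" "f x + e"] e by auto
    have "{p<..<q} \<subseteq> ball (f x) e" using p q by (auto simp: dist_real_def)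
    then have "(p, q) \<in> Q" using e p q by (auto simp: Q_def)
    then show "x \<in> \<Union>((\<lambda>(p, q). {x \<in> topspace X. p < f x} \<inter> {x \<in> topspace X. f x < q}) ` Q)"
      using x p q by force
  qed (auto simp: Q_def)
  moreover have "fsigma_in X \<dots>"
    using \<open>countable Q\<close> by (intro fsigma_in_Union) (auto intro: fsigma_in_Int below above)
  ultimately show ?thesis by simp
qed

context ideal_wijsman
begin

context
  fixes X :: "'x topology" and \<Xi> :: "'x \<Rightarrow> 'a set"
  assumes X: "metrizable_space X"
    and \<Xi>: "\<Xi> \<in> topspace X \<rightarrow> closed_ideals"
    and lsc: "\<And>V. open V \<Longrightarrow> openin X {x \<in> topspace X. \<Xi> x \<inter> V \<noteq> {}}"
begin

text \<open>Lower semicontinuity of \<open>\<Xi>\<close> is upper semicontinuity of its distance functions.\<close>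

lemma openin_profile_less: "openin X {x \<in> topspace X. distance_profile d a (\<Xi> x) n < r}"
proof -
  have "{x \<in> topspace X. distance_profile d a (\<Xi> x) n < r} =
      {x \<in> topspace X. \<Xi> x \<inter> {y. d (a n) y < r} \<noteq> {}}"
  proof (intro Collect_cong conj_cong refl distance_profile_less_iff)
    show "\<Xi> x \<noteq> {}" if "x \<in> topspace X" for x
      using \<Xi> that by (intro closed_ideals_nonempty) blast
  qed
  then show ?thesis using lsc[OF open_distance_ball, of "a n" r] by simp
qed

text \<open>An open set of the product of lines is a countable union of boxes with finitely many sides other
  than the whole line, so its preimage is built from those of the previous lemmas by countable unions and
  finite intersections.\<close>

lemma lower_semicontinuous_sigma02: "sigma02_measurable X (ideal_space d a) \<Xi>"
  unfolding sigma02_measurable_def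
proof (intro conjI allI impI)
  show "\<Xi> \<in> topspace X \<rightarrow> topspace (ideal_space d a)" using \<Xi> by simp
  fix \<U> assume "openin (ideal_space d a) \<U>"
  then obtain W where W: "open W" and \<U>: "\<U> = {J \<in> closed_ideals. distance_profile d a J \<in> W}"
    by (auto simp: openin_ideal_space_iff)
  obtain \<B> :: "(nat \<Rightarrow> real) set set" where \<B>: "topological_basis \<B>" "countable \<B>"
    and box: "\<And>B. B \<in> \<B> \<Longrightarrow> \<exists>I. B = Pi\<^sub>E UNIV I \<and> (\<forall>i. open (I i)) \<and> finite {i. I i \<noteq> UNIV}"
    using product_topology_countable_basis by blast
  obtain \<B>' where \<B>': "\<B>' \<subseteq> \<B>" "W = \<Union>\<B>'"
    using \<B>(1) W unfolding topological_basis_def by blast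
  have "fsigma_in X {x \<in> topspace X. distance_profile d a (\<Xi> x) \<in> B}" if B: "B \<in> \<B>" for B
  proof -
    obtain I where I: "B = Pi\<^sub>E UNIV I" "\<And>i. open (I i)" "finite {i. I i \<noteq> UNIV}"
      using box[OF B] by blast
    have "{x \<in> topspace X. distance_profile d a (\<Xi> x) \<in> B} =
        topspace X \<inter> (\<Inter>i\<in>{i. I i \<noteq> UNIV}. {x \<in> topspace X. distance_profile d a (\<Xi> x) i \<in> I i})"
      unfolding I(1) by (auto simp: PiE_UNIV_domain)
    moreover have "fsigma_in X \<dots>"
      by (intro fsigma_in_INT_finite[OF I(3)]
          fsigma_in_upper_semicontinuous_preimage[OF X openin_profile_less I(2)])
    ultimately show ?thesis by simp
  qed
  then have "fsigma_in X (\<Union>((\<lambda>B. {x \<in> topspace X. distance_profile d a (\<Xi> x) \<in> B}) ` \<B>'))"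
    using \<B>' \<B>(2) by (intro fsigma_in_Union) (auto intro: countable_subset)
  moreover have "{x \<in> topspace X. \<Xi> x \<in> \<U>} =
      \<Union>((\<lambda>B. {x \<in> topspace X. distance_profile d a (\<Xi> x) \<in> B}) ` \<B>')"
    using \<Xi> \<B>'(2) by (auto simp: \<U> Pi_iff)
  ultimately show "fsigma_in X {x \<in> topspace X. \<Xi> x \<in> \<U>}" by simp
qed

text \<open>Stated for a continuous \<open>g\<close> so that it yields the graph of \<open>\<Xi>\<close> on every product space that has the
  arguments and the value among its coordinates, however the product is bracketed.\<close>

lemma lower_semicontinuous_equalizer:
  assumes g: "continuous_map X (ideal_space d a) g"
  shows "gdelta_in X {x \<in> topspace X. g x = \<Xi> x}"
proof -
  have g_ideal: "g x \<in> closed_ideals" if "x \<in> topspace X" for x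
    using continuous_map_image_subset_topspace[OF g] that by auto
  define A where "A n r = {x \<in> topspace X. distance_profile d a (\<Xi> x) n < r}" for n r
  define B where "B n r = {x \<in> topspace X. distance_profile d a (g x) n < r}" for n r
  have A: "openin X (A n r)" for n r unfolding A_def by (rule openin_profile_less)
  have B: "openin X (B n r)" for n r
  proof -
    have "B n r = {x \<in> topspace X. g x \<in> {J \<in> closed_ideals. J \<inter> {y. d (a n) y < r} \<noteq> {}}}"
      using closed_ideals_nonempty g_ideal by (auto simp: B_def distance_profile_less_iff)
    then show ?thesis
      using openin_continuous_map_preimage[OF g openin_ideal_space_hit[OF open_distance_ball]] by simp
  qed
  define E where "E n r = (A n r \<inter> B n r) \<union> ((topspace X - A n r) \<inter> (topspace X - B n r))" for n r
  have E_iff: "x \<in> E n r \<longleftrightarrow> x \<in> topspace X \<and>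
      (distance_profile d a (\<Xi> x) n < r \<longleftrightarrow> distance_profile d a (g x) n < r)" for x n r
    by (auto simp: E_def A_def B_def)
  have "gdelta_in X (E n r)" for n r
    unfolding E_def
    by (intro gdelta_in_Un open_imp_gdelta_in closed_imp_gdelta_in[OF X] openin_Int closedin_Int
        closedin_diff closedin_topspace A B)
  then have "gdelta_in X (\<Inter>((\<lambda>(n, r). E n r) ` (UNIV \<times> \<rat>)))"
    by (intro gdelta_in_Inter) (auto simp: countable_rat intro: Rats_0)
  moreover have "\<Inter>((\<lambda>(n, r). E n r) ` (UNIV \<times> \<rat>)) = {x \<in> topspace X. g x = \<Xi> x}"
  proof (intro equalityI subsetI)
    fix x assume x: "x \<in> \<Inter>((\<lambda>(n, r). E n r) ` (UNIV \<times> \<rat>))"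
    then have E: "x \<in> E n r" if "r \<in> \<rat>" for n r using that by blast
    from E[of 0 0] have mem: "x \<in> topspace X" by (simp add: E_iff)
    have no_gap: "\<not> s < t" if st: "s = distance_profile d a (\<Xi> x) n \<and> t = distance_profile d a (g x) n \<or>
        t = distance_profile d a (\<Xi> x) n \<and> s = distance_profile d a (g x) n" for s t n
    proof
      assume "s < t"
      then obtain r where "r \<in> \<rat>" "s < r" "r < t" using Rats_dense_in_real by blast
      with E[of r n] st show False by (auto simp: E_iff)
    qed
    have "distance_profile d a (\<Xi> x) n = distance_profile d a (g x) n" for n
      using no_gap[of "distance_profile d a (\<Xi> x) n" n "distance_profile d a (g x) n"]
        no_gap[of "distance_profile d a (g x) n" n "distance_profile d a (\<Xi> x) n"]
      by linarith
    then have "distance_profile d a (\<Xi> x) = distance_profile d a (g x)" by (rule ext)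
    moreover have "\<Xi> x \<in> closed_ideals" using \<Xi> mem by blast
    ultimately have "\<Xi> x = g x"
      using g_ideal[OF mem]
      by (intro distance_profile_inject closed_ideals_nonempty closed_ideals_closed)
    then show "x \<in> {x \<in> topspace X. g x = \<Xi> x}" using mem by simp
  qed (auto simp: E_iff)
  ultimately show ?thesis by simp
qed

end

end

lemma sigma02_measurable_imp_borel:
  assumes "sigma02_measurable X Y f"
  shows "f \<in> borel_of_topology X \<rightarrow>\<^sub>M borel_of_topology Y"
proof -
  have PowX: "{U. openin X U} \<subseteq> Pow (topspace X)" and PowY: "{U. openin Y U} \<subseteq> Pow (topspace Y)"
    by (auto dest: openin_subset)
  have space: "space (borel_of_topology X) = topspace X"
    unfolding borel_of_topology_def using PowX by (rule space_measure_of)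
  have closed: "S \<in> sets (borel_of_topology X)" if "closedin X S" for S
  proof -
    have "topspace X - S \<in> sets (borel_of_topology X)"
      unfolding borel_of_topology_def sets_measure_of[OF PowX]
      using that by (intro sigma_sets.Basic) (auto simp: closedin_def)
    then have "space (borel_of_topology X) - (topspace X - S) \<in> sets (borel_of_topology X)"
      by (rule sets.compl_sets)
    then show ?thesis
      using closedin_subset[OF that] by (simp add: space double_diff)
  qed
  have fsigma: "S \<in> sets (borel_of_topology X)" if "fsigma_in X S" for S
    using that closed unfolding fsigma_in_def union_of_def by (auto intro!: sets.countable_Union)
  show ?thesis
    unfolding borel_of_topology_def[of Y]
  proof (rule measurable_measure_of[OF PowY])
    show "f \<in> space (borel_of_topology X) \<rightarrow> topspace Y"
      using assms by (simp add: space sigma02_measurable_def)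
    fix U assume "U \<in> {U. openin Y U}"
    then have "fsigma_in X {x \<in> topspace X. f x \<in> U}"
      using assms by (simp add: sigma02_measurable_def)
    moreover have "f -` U \<inter> space (borel_of_topology X) = {x \<in> topspace X. f x \<in> U}"
      by (auto simp: space)
    ultimately show "f -` U \<inter> space (borel_of_topology X) \<in> sets (borel_of_topology X)"
      using fsigma by simp
  qed
qed

section \<open>Tensor products of ideals depend lower semicontinuously on the ideals\<close>

context bimorphism
begin

text \<open>The target \<open>V\<close> varies in the induction over the span: continuity of the operations splits it
  into targets for the new elementary tensor and for the rest of the sum.\<close>

lemma span_products_hit_neighbourhood:
  assumes "ideal_wijsman d\<^sub>1 a\<^sub>1" "ideal_wijsman d\<^sub>2 a\<^sub>2"
    and I: "I \<in> closed_ideals" and J: "J \<in> closed_ideals"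
    and v: "v \<in> span {m x y | x y. x \<in> I \<and> y \<in> J}" and V: "open V" "v \<in> V"
  shows "\<exists>N. openin (prod_topology (ideal_space d\<^sub>1 a\<^sub>1) (ideal_space d\<^sub>2 a\<^sub>2)) N \<and> (I, J) \<in> N \<and>
    (\<forall>(I', J') \<in> N. span {m x y | x y. x \<in> I' \<and> y \<in> J'} \<inter> V \<noteq> {})"
  using v V
proof (induction arbitrary: V rule: span_induct_alt)
  case base
  interpret E: ideal_wijsman d\<^sub>1 a\<^sub>1 by fact
  interpret F: ideal_wijsman d\<^sub>2 a\<^sub>2 by fact
  let ?T = "prod_topology (ideal_space d\<^sub>1 a\<^sub>1) (ideal_space d\<^sub>2 a\<^sub>2)"
  show ?case
  proof (intro exI conjI)
    show "openin ?T (topspace ?T)" by (rule openin_topspace)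
    show "(I, J) \<in> topspace ?T" using I J by simp
    show "\<forall>(I', J') \<in> topspace ?T. span {m x y | x y. x \<in> I' \<and> y \<in> J'} \<inter> V \<noteq> {}"
      using span_0 base by blast
  qed
next
  case (step c z v)
  interpret E: ideal_wijsman d\<^sub>1 a\<^sub>1 by fact
  interpret F: ideal_wijsman d\<^sub>2 a\<^sub>2 by fact
  let ?T = "prod_topology (ideal_space d\<^sub>1 a\<^sub>1) (ideal_space d\<^sub>2 a\<^sub>2)"
  from step.hyps(1) obtain x y where z: "z = m x y" "x \<in> I" "y \<in> J" by blast
  have "open ((\<lambda>p. c *\<^sub>R fst p + snd p) -` V)"
    by (intro open_vimage step.prems(1) continuous_intros)
  moreover have "(z, v) \<in> (\<lambda>p. c *\<^sub>R fst p + snd p) -` V" using step.prems(2) by simp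
  ultimately obtain A B where AB: "open A" "open B" "(z, v) \<in> A \<times> B"
    "A \<times> B \<subseteq> (\<lambda>p. c *\<^sub>R fst p + snd p) -` V"
    by (rule open_prod_elim)
  have "open ((\<lambda>p. m (fst p) (snd p)) -` A)"
    by (intro open_vimage AB(1) bounded_bilinear.continuous_on[OF bounded_bilinear] continuous_intros)
  moreover have "(x, y) \<in> (\<lambda>p. m (fst p) (snd p)) -` A" using AB(3) z by simp
  ultimately obtain C D where CD: "open C" "open D" "(x, y) \<in> C \<times> D"
    "C \<times> D \<subseteq> (\<lambda>p. m (fst p) (snd p)) -` A"
    by (rule open_prod_elim)
  have "v \<in> B" using AB(3) by simp
  from step.IH[OF AB(2) this] obtain N where N: "openin ?T N" "(I, J) \<in> N"
    "\<forall>(I', J') \<in> N. span {m x y | x y. x \<in> I' \<and> y \<in> J'} \<inter> B \<noteq> {}" by blast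
  define M where "M = {J \<in> closed_ideals. J \<inter> C \<noteq> {}} \<times> {J \<in> closed_ideals. J \<inter> D \<noteq> {}}"
  have M: "openin ?T M"
    unfolding M_def openin_prod_Times_iff
    using E.openin_ideal_space_hit[OF CD(1)] F.openin_ideal_space_hit[OF CD(2)] by blast
  show ?case
  proof (intro exI conjI)
    show "openin ?T (N \<inter> M)" using N(1) M by (rule openin_Int)
    show "(I, J) \<in> N \<inter> M" using N(2) I J z CD(3) by (auto simp: M_def)
    show "\<forall>(I', J') \<in> N \<inter> M. span {m x y | x y. x \<in> I' \<and> y \<in> J'} \<inter> V \<noteq> {}"
    proof (clarify)
      fix I' J' assume NM: "(I', J') \<in> N" "(I', J') \<in> M"
        and empty: "span {m x y | x y. x \<in> I' \<and> y \<in> J'} \<inter> V = {}"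
      obtain v' where v': "v' \<in> span {m x y | x y. x \<in> I' \<and> y \<in> J'}" "v' \<in> B"
        using N(3) NM(1) by blast
      obtain x' y' where xy': "x' \<in> I'" "x' \<in> C" "y' \<in> J'" "y' \<in> D"
        using NM(2) unfolding M_def by blast
      have "c *\<^sub>R m x' y' + v' \<in> span {m x y | x y. x \<in> I' \<and> y \<in> J'}"
        by (intro span_add span_scale v'(1) span_base CollectI exI[of _ x'] exI[of _ y'] conjI refl xy')
      moreover have "m x' y' \<in> A" using CD(4) xy' by auto
      then have "c *\<^sub>R m x' y' + v' \<in> V" using AB(4) v'(2) by auto
      ultimately show False using empty by blast
    qed
  qed
qed

lemma ideal_tensor_lower_semicontinuous:
  assumes "ideal_wijsman d\<^sub>1 a\<^sub>1" "ideal_wijsman d\<^sub>2 a\<^sub>2" "open V"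
  defines "T \<equiv> prod_topology (ideal_space d\<^sub>1 a\<^sub>1) (ideal_space d\<^sub>2 a\<^sub>2)"
  shows "openin T {p \<in> topspace T. ideal_tensor m p \<inter> V \<noteq> {}}"
proof (subst openin_subopen, rule ballI)
  interpret E: ideal_wijsman d\<^sub>1 a\<^sub>1 by fact
  interpret F: ideal_wijsman d\<^sub>2 a\<^sub>2 by fact
  have hit: "ideal_tensor m (I, J) \<inter> V \<noteq> {} \<longleftrightarrow> span {m x y | x y. x \<in> I \<and> y \<in> J} \<inter> V \<noteq> {}" for I J
    unfolding ideal_tensor_def case_prod_conv
    using open_Int_closure_eq_empty[OF assms(3)] by (simp add: Int_commute)
  fix p assume p: "p \<in> {p \<in> topspace T. ideal_tensor m p \<inter> V \<noteq> {}}"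
  obtain I J where IJ: "p = (I, J)" by (cases p)
  have ideals: "I \<in> closed_ideals" "J \<in> closed_ideals" using p by (auto simp: IJ T_def)
  have "ideal_tensor m (I, J) \<inter> V \<noteq> {}" using p by (simp add: IJ)
  then obtain v where v: "v \<in> span {m x y | x y. x \<in> I \<and> y \<in> J}" "v \<in> V" unfolding hit by blast
  obtain N where N: "openin T N" "(I, J) \<in> N"
    "\<forall>(I', J') \<in> N. span {m x y | x y. x \<in> I' \<and> y \<in> J'} \<inter> V \<noteq> {}"
    using span_products_hit_neighbourhood[OF assms(1,2) ideals v(1) assms(3) v(2)]
    unfolding T_def by (elim exE conjE)
  have "N \<subseteq> {p \<in> topspace T. ideal_tensor m p \<inter> V \<noteq> {}}"
  proof
    fix q assume q: "q \<in> N"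
    obtain I' J' where q': "q = (I', J')" by (cases q)
    have "ideal_tensor m (I', J') \<inter> V \<noteq> {}" unfolding hit using bspec[OF N(3) q] unfolding q' case_prod_conv .
    then show "q \<in> {p \<in> topspace T. ideal_tensor m p \<inter> V \<noteq> {}}"
      using openin_subset[OF N(1)] q by (auto simp: q')
  qed
  with N(1,2) show "\<exists>N. openin T N \<and> p \<in> N \<and> N \<subseteq> {p \<in> topspace T. ideal_tensor m p \<inter> V \<noteq> {}}"
    unfolding IJ by (intro exI conjI)
qed

end

section \<open>Elementary tensors in the positive projective tensor product\<close>

lemma lattice_of_type_simps [simp]:
  "vcarrier lattice_of_type = UNIV" "vadd lattice_of_type = (+)" "vzero lattice_of_type = 0"
  "vscale lattice_of_type = (*\<^sub>R)" "vle lattice_of_type = (\<le>)" "vsup lattice_of_type = sup"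
  by (simp_all add: lattice_of_type_def)

text \<open>For positive \<open>x\<close>, \<open>y\<close> the tensor \<open>x \<otimes> y\<close> is its own modulus and so an admissible majorant of itself,
  which bounds its positive projective norm by \<open>\<parallel>x\<parallel> \<parallel>y\<parallel>\<close>.\<close>

lemma pos_proj_tensor_product_bimorphism:
  fixes G :: "'g vlat" and t :: "'e::banach_lattice \<Rightarrow> 'f::banach_lattice \<Rightarrow> 'g"
    and j :: "'g \<Rightarrow> 'z::banach_lattice"
  assumes "pos_proj_tensor_product G t j"
  shows "dense_bimorphism (\<lambda>x y. j (t x y))"
proof -
  have G: "vector_lattice G" and t: "lattice_bimorphism lattice_of_type lattice_of_type G t"
    and j: "lattice_hom G lattice_of_type j"
    and norm_j: "\<And>u. u \<in> algebraic_tensor G t \<Longrightarrow> norm (j u) = pos_proj_norm G t u"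
    and dense: "closure (j ` algebraic_tensor G t) = UNIV"
    using assms
    by (auto simp: pos_proj_tensor_product_def fremlin_tensor_product_def pos_proj_completion_def)
  interpret G: vector_lattice G by (rule G)
  have bilinear: "bilinear_map lattice_of_type lattice_of_type G t"
    and left: "\<And>x. 0 \<le> x \<Longrightarrow> lattice_hom lattice_of_type G (t x)"
    and right: "\<And>y. 0 \<le> y \<Longrightarrow> lattice_hom lattice_of_type G (\<lambda>x. t x y)"
    using t by (auto simp: lattice_bimorphism_def)
  have t_carrier: "t x y \<in> vcarrier G"
    and t_add: "t (x + x') y = vadd G (t x y) (t x' y)" "t x (y + y') = vadd G (t x y) (t x y')"
    and t_scale: "t (c *\<^sub>R x) y = vscale G c (t x y)" "t x (c *\<^sub>R y) = vscale G c (t x y)"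
    for x x' y y' c
    using bilinear by (simp_all add: bilinear_map_def)
  have t_sup: "0 \<le> y \<Longrightarrow> t (sup x x') y = vsup G (t x y) (t x' y)"
    "0 \<le> x \<Longrightarrow> t x (sup y y') = vsup G (t x y) (t x y')" for x x' y y'
    using left[of x] right[of y] by (simp_all add: lattice_hom_def)
  have j_hom: "j (vadd G u v) = j u + j v" "j (vscale G c u) = c *\<^sub>R j u"
    "j (vsup G u v) = sup (j u) (j v)" if "u \<in> vcarrier G" "v \<in> vcarrier G" for u v c
    using j that by (simp_all add: lattice_hom_def)
  have vsum_single: "vsum G (map (\<lambda>(x, y). t x y) [(x, y)]) = t x y" for x y
    by (simp add: vsum_def G.add_zero t_carrier)
  have norm_le: "norm (j (t x y)) \<le> norm x * norm y" if xy: "0 \<le> x" "0 \<le> y" for x y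
  proof -
    have "t x y \<in> algebraic_tensor G t"
      unfolding algebraic_tensor_def by (rule range_eqI) (rule vsum_single[symmetric])
    then have "norm (j (t x y)) = pos_proj_norm G t (t x y)" by (rule norm_j)
    also have "\<dots> \<le> norm x * norm y"
      unfolding pos_proj_norm_def
    proof (rule cInf_lower)
      have "vabs G (t x y) = t (sup x (- x)) y"
        using t_scale(1)[of "-1" x y] by (simp add: vabs_def t_sup(1)[OF xy(2)])
      also have "sup x (- x) = x" using xy(1) by (simp add: abs_lattice[symmetric])
      finally have "vle G (vabs G (t x y)) (vsum G (map (\<lambda>(x, y). t x y) [(x, y)]))"
        unfolding vsum_single by (simp add: G.le_refl t_carrier)
      then show "norm x * norm y \<in> {(\<Sum>(x, y)\<leftarrow>ps. norm x * norm y) | ps.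
          (\<forall>(x, y)\<in>set ps. 0 \<le> x \<and> 0 \<le> y) \<and> vle G (vabs G (t x y)) (vsum G (map (\<lambda>(x, y). t x y) ps))}"
        using xy by (intro CollectI exI[of _ "[(x, y)]"]) simp
      show "bdd_below {(\<Sum>(x, y)\<leftarrow>ps. norm x * norm y) | ps.
          (\<forall>(x, y)\<in>set ps. 0 \<le> x \<and> 0 \<le> y) \<and> vle G (vabs G (t x y)) (vsum G (map (\<lambda>(x, y). t x y) ps))}"
        by (rule bdd_belowI[of _ 0]) (auto intro!: sum_list_nonneg)
    qed
    finally show ?thesis .
  qed
  interpret bimorphism "\<lambda>x y. j (t x y)"
    by unfold_locales (simp_all add: t_add t_scale t_sup j_hom[OF t_carrier t_carrier] norm_le)
  have "j (vzero G) = 0"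
    using j_hom(1)[OF G.zero_closed G.zero_closed] G.add_zero[OF G.zero_closed] by simp
  then have vsum_span: "vsum G (map (\<lambda>(x, y). t x y) ps) \<in> vcarrier G \<and>
      j (vsum G (map (\<lambda>(x, y). t x y) ps)) \<in> span {j (t x y) | x y. x \<in> UNIV \<and> y \<in> UNIV}" for ps
  proof (induction ps)
    case (Cons p ps)
    obtain x y where "p = (x, y)" by (cases p)
    moreover have "j (t x y) \<in> span {j (t x y) | x y. x \<in> UNIV \<and> y \<in> UNIV}"
      by (intro span_base) auto
    ultimately show ?case
      using Cons by (auto simp: vsum_def G.add_closed t_carrier j_hom span_add)
  qed (simp add: vsum_def G.zero_closed span_0)
  have "UNIV \<subseteq> ideal_tensor (\<lambda>x y. j (t x y)) (UNIV, UNIV)"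
    unfolding dense[symmetric] ideal_tensor_def case_prod_conv algebraic_tensor_def
    using vsum_span by (intro closure_mono) auto
  then show ?thesis by unfold_locales auto
qed

section \<open>Complexity of the tensor product of ideals\<close>

theorem (in dense_bimorphism) ideal_tensor_complexity:
  assumes "ideal_wijsman d\<^sub>1 a\<^sub>1" "ideal_wijsman d\<^sub>2 a\<^sub>2" "ideal_wijsman d\<^sub>0 a\<^sub>0"
  defines "X \<equiv> ideal_space d\<^sub>1 a\<^sub>1" and "Y \<equiv> ideal_space d\<^sub>2 a\<^sub>2" and "Z \<equiv> ideal_space d\<^sub>0 a\<^sub>0"
  shows "sigma02_measurable (prod_topology X Y) Z (ideal_tensor m)"
    and "gdelta_in (prod_topology X (prod_topology Y Z))
      {(I, J, K). I \<in> closed_ideals \<and> J \<in> closed_ideals \<and> K \<in> closed_ideals \<and> K = ideal_tensor m (I, J)}"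
proof -
  interpret X: ideal_wijsman d\<^sub>1 a\<^sub>1 by fact
  interpret Y: ideal_wijsman d\<^sub>2 a\<^sub>2 by fact
  interpret Z: ideal_wijsman d\<^sub>0 a\<^sub>0 by fact
  have metrizable: "metrizable_space X" "metrizable_space Y" "metrizable_space Z"
    unfolding X_def Y_def Z_def
    by (rule X.metrizable_ideal_space Y.metrizable_ideal_space Z.metrizable_ideal_space)+
  have topspace: "topspace X = closed_ideals" "topspace Y = closed_ideals" "topspace Z = closed_ideals"
    by (simp_all add: X_def Y_def Z_def)
  have XY: "metrizable_space (prod_topology X Y)"
    and XYZ: "metrizable_space (prod_topology X (prod_topology Y Z))"
    using metrizable by (simp_all add: metrizable_space_prod_topology)
  have ideal: "ideal_tensor m \<in> topspace (prod_topology X Y) \<rightarrow> closed_ideals"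
    using ideal_tensor_closed_ideal by (auto simp: topspace)
  note lsc = ideal_tensor_lower_semicontinuous[OF assms(1,2), folded X_def Y_def]
  show "sigma02_measurable (prod_topology X Y) Z (ideal_tensor m)"
    unfolding Z_def by (rule Z.lower_semicontinuous_sigma02[OF XY ideal lsc])
  let ?T = "prod_topology X (prod_topology Y Z)"
  let ?h = "\<lambda>p. (fst p, fst (snd p))"
  have h: "continuous_map ?T (prod_topology X Y) ?h"
    by (intro continuous_map_pairedI continuous_map_fst continuous_map_compose[OF continuous_map_snd continuous_map_fst, unfolded o_def])
  have K: "continuous_map ?T Z (\<lambda>p. snd (snd p))"
    by (intro continuous_map_compose[OF continuous_map_snd continuous_map_snd, unfolded o_def])
  have "gdelta_in ?T {p \<in> topspace ?T. snd (snd p) = ideal_tensor m (?h p)}"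
  proof (rule Z.lower_semicontinuous_equalizer[OF XYZ])
    show "(\<lambda>p. ideal_tensor m (?h p)) \<in> topspace ?T \<rightarrow> closed_ideals"
      using ideal_tensor_closed_ideal by (auto simp: topspace)
    show "continuous_map ?T (ideal_space d\<^sub>0 a\<^sub>0) (\<lambda>p. snd (snd p))"
      using K by (simp add: Z_def)
    fix V :: "'z set" assume "open V"
    from openin_continuous_map_preimage[OF h lsc[OF this]]
    have "openin ?T {p \<in> topspace ?T. ?h p \<in> {q \<in> topspace (prod_topology X Y). ideal_tensor m q \<inter> V \<noteq> {}}}" .
    moreover have "{p \<in> topspace ?T. ?h p \<in> {q \<in> topspace (prod_topology X Y). ideal_tensor m q \<inter> V \<noteq> {}}} =
        {p \<in> topspace ?T. ideal_tensor m (?h p) \<inter> V \<noteq> {}}"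
      by auto
    ultimately show "openin ?T {p \<in> topspace ?T. ideal_tensor m (?h p) \<inter> V \<noteq> {}}" by simp
  qed
  moreover have "{p \<in> topspace ?T. snd (snd p) = ideal_tensor m (?h p)} =
      {(I, J, K). I \<in> closed_ideals \<and> J \<in> closed_ideals \<and> K \<in> closed_ideals \<and> K = ideal_tensor m (I, J)}"
    by (auto simp: topspace)
  ultimately show "gdelta_in ?T
      {(I, J, K). I \<in> closed_ideals \<and> J \<in> closed_ideals \<and> K \<in> closed_ideals \<and> K = ideal_tensor m (I, J)}"
    by simp
qed

theorem theorem5p4:
  fixes G :: "'g vlat"
    and t :: "ell1 fbl \<Rightarrow> ell1 fbl \<Rightarrow> 'g"
    and j :: "'g \<Rightarrow> 'z::banach_lattice"
    and d :: "ell1 fbl \<Rightarrow> ell1 fbl \<Rightarrow> real" and a :: "nat \<Rightarrow> ell1 fbl"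
    and d\<^sub>0 :: "'z \<Rightarrow> 'z \<Rightarrow> real" and a\<^sub>0 :: "nat \<Rightarrow> 'z"
  assumes "pos_proj_tensor_product G t j"
    and "compatible_metric d" and "dense_sequence a"
    and "compatible_metric d\<^sub>0" and "dense_sequence a\<^sub>0"
  shows "let X = ideal_space d a; Y = ideal_space d\<^sub>0 a\<^sub>0;
             \<Xi> = ideal_tensor (\<lambda>x y. j (t x y))
         in sigma02_measurable (prod_topology X X) Y \<Xi> \<and>
            \<Xi> \<in> borel_of_topology (prod_topology X X) \<rightarrow>\<^sub>M borel_of_topology Y \<and>
            gdelta_in (prod_topology X (prod_topology X Y))
              {(J\<^sub>1, J\<^sub>2, K). J\<^sub>1 \<in> closed_ideals \<and> J\<^sub>2 \<in> closed_ideals \<and> K \<in> closed_ideals \<and>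
                 K = \<Xi> (J\<^sub>1, J\<^sub>2)}"
proof -
  interpret dense_bimorphism "\<lambda>x y. j (t x y)"
    by (rule pos_proj_tensor_product_bimorphism[OF assms(1)])
  have E: "ideal_wijsman d a" and Z: "ideal_wijsman d\<^sub>0 a\<^sub>0"
    using assms by (simp_all add: ideal_wijsman_def wijsman_data_def)
  note complexity = ideal_tensor_complexity[OF E E Z]
  show ?thesis
    unfolding Let_def
    by (intro conjI complexity sigma02_measurable_imp_borel)
qed

end
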